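(* There is no fixed-parameter algorithm for \textsc{ConsCheck: Independent Set[degree]} (parameterized by $k+d$) unless $\mathsf{FPT}=\mathsf{W}[2]$.
   Context: \textsc{ConsCheck: Independent Set[degree]}: Input: integers $k,d$ and $\mathcal{I}=\{V,(E_i,\lambda_i)_{i\in[t]}\}$ where $V$ is a finite vertex set, each $G_i=(V,E_i)$ is a graph of maximum degree at most $d$, and $\lambda_i\in\{0,1\}$. Parameter: $k+d$. Task: compute $X\subseteq V$ with $|X|=k$ such that for each $i\in[t]$, $X$ is an independent set in $G_i$ iff $\lambda_i=1$, or report that none exists. A fixed-parameter algorithm runs in time $f(k+d)\cdot|\mathcal{I}|^{\mathcal{O}(1)}$ for a computable $f$. *)

theory Defs
  imports Main
begin

section \<open>Model of computation\<close>

text \<open>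
  Jones' WHILE language over binary trees. Every evaluation of an expression is charged the total
  size of all (intermediate) values, and not unit cost. Hence running time bounds the
  size of everything a program builds, and the model is polynomially equivalent to Turing machines
  (with unit cost, shared subtrees would allow exponentially large outputs in linear time).
\<close>

datatype tree = Atom | Node tree tree

primrec tsize :: "tree \<Rightarrow> nat" where
  "tsize Atom = 1"
| "tsize (Node l r) = 1 + tsize l + tsize r"

primrec thd :: "tree \<Rightarrow> tree" where
  "thd Atom = Atom"
| "thd (Node l r) = l"

primrec ttl :: "tree \<Rightarrow> tree" where
  "ttl Atom = Atom"
| "ttl (Node l r) = r"

primrec enc_bool :: "bool \<Rightarrow> tree" where
  "enc_bool False = Atom"
| "enc_bool True = Node Atom Atom"

type_synonym store = "nat \<Rightarrow> tree"

datatype expr = Var nat | Const tree | Cons_of expr expr | Hd expr | Tl expr | Eq expr expr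

primrec eval :: "expr \<Rightarrow> store \<Rightarrow> tree" where
  "eval (Var x) s = s x"
| "eval (Const v) s = v"
| "eval (Cons_of a b) s = Node (eval a s) (eval b s)"
| "eval (Hd a) s = thd (eval a s)"
| "eval (Tl a) s = ttl (eval a s)"
| "eval (Eq a b) s = enc_bool (eval a s = eval b s)"

primrec cost :: "expr \<Rightarrow> store \<Rightarrow> nat" where
  "cost (Var x) s = tsize (s x)"
| "cost (Const v) s = tsize v"
| "cost (Cons_of a b) s = cost a s + cost b s + tsize (eval (Cons_of a b) s)"
| "cost (Hd a) s = cost a s + tsize (eval (Hd a) s)"
| "cost (Tl a) s = cost a s + tsize (eval (Tl a) s)"
| "cost (Eq a b) s = cost a s + cost b s + tsize (eval (Eq a b) s)"

datatype prog = Skip | Assign nat expr | Seq prog prog | If expr prog prog | While expr prog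

text \<open>\<open>exec p s t s'\<close>: started in store \<open>s\<close>, \<open>p\<close> halts after time \<open>t\<close> in store \<open>s'\<close>.
  In conditions, \<open>Atom\<close> is false and every other tree is true.\<close>

inductive exec :: "prog \<Rightarrow> store \<Rightarrow> nat \<Rightarrow> store \<Rightarrow> bool" where
  Skip: "exec Skip s 1 s"
| Assign: "exec (Assign x e) s (1 + cost e s) (s(x := eval e s))"
| Seq: "exec p s t s' \<Longrightarrow> exec q s' t' s'' \<Longrightarrow> exec (Seq p q) s (1 + t + t') s''"
| IfTrue: "eval e s \<noteq> Atom \<Longrightarrow> exec p s t s' \<Longrightarrow> exec (If e p q) s (1 + cost e s + t) s'"
| IfFalse: "eval e s = Atom \<Longrightarrow> exec q s t s' \<Longrightarrow> exec (If e p q) s (1 + cost e s + t) s'"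
| WhileFalse: "eval e s = Atom \<Longrightarrow> exec (While e p) s (1 + cost e s) s"
| WhileTrue: "eval e s \<noteq> Atom \<Longrightarrow> exec p s t s' \<Longrightarrow> exec (While e p) s' t' s'' \<Longrightarrow>
    exec (While e p) s (1 + cost e s + t + t') s''"

text \<open>Variable \<open>0\<close> holds both input and output.\<close>

definition runs :: "prog \<Rightarrow> tree \<Rightarrow> nat \<Rightarrow> tree \<Rightarrow> bool" where
  "runs p x t y \<longleftrightarrow> (\<exists>s. exec p ((\<lambda>_. Atom)(0 := x)) t s \<and> s 0 = y)"

text \<open>Numbers are encoded in unary. They only occur as parameters and as names of vertices and
  of circuit nodes, where this changes sizes at most polynomially (up to a function of the
  parameter).\<close>

primrec enc_nat :: "nat \<Rightarrow> tree" where
  "enc_nat 0 = Atom"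
| "enc_nat (Suc n) = Node Atom (enc_nat n)"

primrec enc_list :: "('a \<Rightarrow> tree) \<Rightarrow> 'a list \<Rightarrow> tree" where
  "enc_list c [] = Atom"
| "enc_list c (x # xs) = Node (c x) (enc_list c xs)"

definition enc_pair :: "('a \<Rightarrow> tree) \<Rightarrow> ('b \<Rightarrow> tree) \<Rightarrow> 'a \<times> 'b \<Rightarrow> tree" where
  "enc_pair c c' xy = Node (c (fst xy)) (c' (snd xy))"

primrec enc_option :: "('a \<Rightarrow> tree) \<Rightarrow> 'a option \<Rightarrow> tree" where
  "enc_option c None = Atom"
| "enc_option c (Some x) = Node Atom (c x)"

definition computable :: "(nat \<Rightarrow> nat) \<Rightarrow> bool" where
  "computable f \<longleftrightarrow> (\<exists>p. \<forall>n. \<exists>t. runs p (enc_nat n) t (enc_nat (f n)))"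


section \<open>Parameterized problems\<close>

type_synonym param_problem = "(tree \<times> nat) set"

definition FPT :: "param_problem set" where
  "FPT = {L. \<exists>p f c. computable f \<and>
     (\<forall>x k. \<exists>t \<le> f k * tsize (Node x (enc_nat k)) ^ c.
        runs p (Node x (enc_nat k)) t (enc_bool ((x, k) \<in> L)))}"

definition fpt_reducible :: "param_problem \<Rightarrow> param_problem \<Rightarrow> bool" where
  "fpt_reducible A B \<longleftrightarrow> (\<exists>p f g c. computable f \<and> computable g \<and>
     (\<forall>x k. \<exists>x' k'. \<exists>t \<le> f k * tsize (Node x (enc_nat k)) ^ c.
        runs p (Node x (enc_nat k)) t (Node x' (enc_nat k')) \<and>
        k' \<le> g k \<and> ((x, k) \<in> A \<longleftrightarrow> (x', k') \<in> B)))"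


section \<open>Boolean circuits and the W-hierarchy\<close>

text \<open>A circuit is given by its nodes in topological order, together with the output node; a node
  refers to its in-neighbours by their positions.\<close>

datatype gate = Input | Neg nat | Conj "nat list" | Disj "nat list"

type_synonym circuit = "gate list \<times> nat"

primrec preds :: "gate \<Rightarrow> nat list" where
  "preds Input = []"
| "preds (Neg j) = [j]"
| "preds (Conj js) = js"
| "preds (Disj js) = js"

definition indegree_ok :: "gate \<Rightarrow> bool" where
  "indegree_ok g \<longleftrightarrow> (case g of Conj js \<Rightarrow> 2 \<le> length js | Disj js \<Rightarrow> 2 \<le> length js | _ \<Rightarrow> True)"

definition wf_circuit :: "circuit \<Rightarrow> bool" where
  "wf_circuit C \<longleftrightarrow> (case C of (gs, out) \<Rightarrow>
     (\<forall>i < length gs. indegree_ok (gs ! i) \<and> distinct (preds (gs ! i)) \<and>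
        set (preds (gs ! i)) \<subseteq> {..<i}) \<and>
     out < length gs \<and> (\<forall>g \<in> set gs. out \<notin> set (preds g)))"

definition inputs :: "circuit \<Rightarrow> nat set" where
  "inputs C = {i. i < length (fst C) \<and> fst C ! i = Input}"

definition input_output_path :: "circuit \<Rightarrow> nat list \<Rightarrow> bool" where
  "input_output_path C is \<longleftrightarrow> is \<noteq> [] \<and> set is \<subseteq> {..<length (fst C)} \<and>
     hd is \<in> inputs C \<and> last is = snd C \<and>
     (\<forall>m. Suc m < length is \<longrightarrow> is ! m \<in> set (preds (fst C ! (is ! Suc m))))"

definition large :: "gate \<Rightarrow> bool" where
  "large g \<longleftrightarrow> length (preds g) > 2"

definition depth_at_most :: "nat \<Rightarrow> circuit \<Rightarrow> bool" where
  "depth_at_most d C \<longleftrightarrow> (\<forall>is. input_output_path C is \<longrightarrow> length is - 1 \<le> d)"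

definition weft_at_most :: "nat \<Rightarrow> circuit \<Rightarrow> bool" where
  "weft_at_most t C \<longleftrightarrow>
     (\<forall>is. input_output_path C is \<longrightarrow> length (filter (\<lambda>i. large (fst C ! i)) is) \<le> t)"

text \<open>\<open>v\<close> gives the values of all nodes when exactly the input nodes in \<open>A\<close> receive \<open>True\<close>.\<close>

definition node_values :: "circuit \<Rightarrow> nat set \<Rightarrow> (nat \<Rightarrow> bool) \<Rightarrow> bool" where
  "node_values C A v \<longleftrightarrow> (\<forall>i < length (fst C). v i \<longleftrightarrow>
     (case fst C ! i of
        Input \<Rightarrow> i \<in> A
      | Neg j \<Rightarrow> \<not> v j
      | Conj js \<Rightarrow> (\<forall>j \<in> set js. v j)
      | Disj js \<Rightarrow> (\<exists>j \<in> set js. v j)))"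

definition satisfied_by :: "circuit \<Rightarrow> nat set \<Rightarrow> bool" where
  "satisfied_by C A \<longleftrightarrow> (\<exists>v. node_values C A v \<and> v (snd C))"

primrec enc_gate :: "gate \<Rightarrow> tree" where
  "enc_gate Input = Node (enc_nat 0) Atom"
| "enc_gate (Neg j) = Node (enc_nat 1) (enc_nat j)"
| "enc_gate (Conj js) = Node (enc_nat 2) (enc_list enc_nat js)"
| "enc_gate (Disj js) = Node (enc_nat 3) (enc_list enc_nat js)"

definition enc_circuit :: "circuit \<Rightarrow> tree" where
  "enc_circuit = enc_pair (enc_list enc_gate) enc_nat"

text \<open>Weighted circuit satisfiability for circuits of weft at most \<open>t\<close> and depth at most \<open>d\<close>.\<close>

definition WCS :: "nat \<Rightarrow> nat \<Rightarrow> param_problem" where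
  "WCS t d = {(enc_circuit C, k) | C k. wf_circuit C \<and> weft_at_most t C \<and> depth_at_most d C \<and>
     (\<exists>A. A \<subseteq> inputs C \<and> card A = k \<and> satisfied_by C A)}"

definition W_class :: "nat \<Rightarrow> param_problem set" where
  "W_class t = {L. \<exists>d \<ge> 1. fpt_reducible L (WCS t d)}"


section \<open>Consistency checking for independent set\<close>

type_synonym graph_edges = "nat set set"

definition is_graph :: "nat set \<Rightarrow> graph_edges \<Rightarrow> bool" where
  "is_graph V E \<longleftrightarrow> finite V \<and> (\<forall>e \<in> E. e \<subseteq> V \<and> card e = 2)"

definition max_degree_at_most :: "nat \<Rightarrow> nat set \<Rightarrow> graph_edges \<Rightarrow> bool" where
  "max_degree_at_most d V E \<longleftrightarrow> (\<forall>v \<in> V. card {e \<in> E. v \<in> e} \<le> d)"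

definition independent_set :: "nat set \<Rightarrow> graph_edges \<Rightarrow> nat set \<Rightarrow> bool" where
  "independent_set V E X \<longleftrightarrow> X \<subseteq> V \<and> (\<forall>u \<in> X. \<forall>v \<in> X. {u, v} \<notin> E)"

text \<open>A sample \<open>(es, l)\<close> consists of a list of edges and a label; the list may name an edge more
  than once and in either orientation.\<close>

type_synonym sample = "(nat \<times> nat) list \<times> bool"

definition edges_of :: "(nat \<times> nat) list \<Rightarrow> graph_edges" where
  "edges_of es = {{u, v} | u v. (u, v) \<in> set es}"

definition IS_instance :: "nat \<Rightarrow> nat list \<Rightarrow> sample list \<Rightarrow> bool" where
  "IS_instance d vs S \<longleftrightarrow> distinct vs \<and>
     (\<forall>(es, l) \<in> set S. is_graph (set vs) (edges_of es) \<and>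
        max_degree_at_most d (set vs) (edges_of es))"

definition IS_solution :: "nat \<Rightarrow> nat list \<Rightarrow> sample list \<Rightarrow> nat set \<Rightarrow> bool" where
  "IS_solution k vs S X \<longleftrightarrow> X \<subseteq> set vs \<and> card X = k \<and>
     (\<forall>(es, l) \<in> set S. independent_set (set vs) (edges_of es) X \<longleftrightarrow> l)"

definition enc_IS :: "nat \<Rightarrow> nat \<Rightarrow> nat list \<Rightarrow> sample list \<Rightarrow> tree" where
  "enc_IS k d vs S = Node (enc_nat k) (Node (enc_nat d) (Node (enc_list enc_nat vs)
     (enc_list (enc_pair (enc_list (enc_pair enc_nat enc_nat)) enc_bool) S)))"

text \<open>The output is \<open>Some xs\<close> for a solution \<open>set xs\<close>, or \<open>None\<close> to report that there is none.\<close>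

definition correct_IS_output :: "nat \<Rightarrow> nat list \<Rightarrow> sample list \<Rightarrow> nat list option \<Rightarrow> bool" where
  "correct_IS_output k vs S r \<longleftrightarrow> (case r of
      Some xs \<Rightarrow> IS_solution k vs S (set xs)
    | None \<Rightarrow> \<not> (\<exists>X. IS_solution k vs S X))"

definition fpt_algorithm_ConsCheck_IS_degree :: "prog \<Rightarrow> bool" where
  "fpt_algorithm_ConsCheck_IS_degree p \<longleftrightarrow> (\<exists>f c. computable f \<and>
     (\<forall>k d vs S. IS_instance d vs S \<longrightarrow>
        (\<exists>r. \<exists>t \<le> f (k + d) * tsize (enc_IS k d vs S) ^ c.
           runs p (enc_IS k d vs S) t (enc_option (enc_list enc_nat) r) \<and>
           correct_IS_output k vs S r)))"

end

theory Submission
  imports Defs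
begin

text \<open>
  An algorithm for consistency checking yields an fpt-algorithm for weighted satisfiability of
  circuits of weft at most \<open>2\<close> and depth at most \<open>d\<close>, because there is a polynomial-time
  disjunctive reduction with a new parameter that depends only on \<open>k\<close> and \<open>d\<close>.

  A set of \<open>k\<close> inputs is described by its \<open>k + 1\<close> gaps in the linear order of the nodes; one gap
  suffices to witness that a given input is in the set, or that it is not. The vertices of the
  instances are the tuples of \<open>2 ^ d\<close> gaps. As a node of weft \<open>0\<close> depends on at most \<open>2 ^ d\<close> inputs,
  its value is the disjunction of the vertices that force it. Pushing the large gates outwards, the
  output becomes a polynomially large disjunction of conjunctions of such disjunctions, and every
  disjunct is turned into one instance. There, a matching joins the two copies of each vertex: a
  sample with label \<open>0\<close> whose graph is a part of that matching demands that one of the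
  corresponding vertices be chosen, while samples with label \<open>1\<close> and a single edge exclude
  conflicting pairs. The size of the solution forces exactly one choice for each tuple of gap
  numbers. All graphs have maximum degree at most \<open>1\<close>.
\<close>

section \<open>Encodable types\<close>

text \<open>The samples of one instance act conjunctively, and a sample with label
  \<open>False\<close> is a disjunction over its edges. This gives the two inner levels of a weft-2
  normal form; the outer disjunction has no counterpart inside an instance, hence a list of
  instances whose answers are joined. A graph of bounded degree cannot join all rival vertices, but
  separate samples can, one edge each. A long disjunction over vertices becomes one over edges by
  doubling, since a matching may have arbitrarily many edges at degree 1. Gaps are used because the
  negation of an input must be a disjunction of choices as well: an input outside the set is
  attested by the one gap that jumps over it. The bound \<open>2 ^ d\<close> comes from fan-in at
  most 2 on paths of length at most \<open>d\<close>. In this model a claim of polynomial time needs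
  an actual program, so much of the development is a calculus that derives programs from the shape
  of a function. The parameter bound of the given algorithm is not assumed monotone and is replaced
  by a computable majorant.\<close>

class enc =
  fixes enc :: "'a \<Rightarrow> tree"
  assumes inj_enc: "inj enc"

lemma enc_inject [simp]: "enc x = enc y \<longleftrightarrow> x = y"
  using inj_enc by (auto dest: injD)

text \<open>Trees are their own codes, so that an arbitrary input, which may encode nothing, is also
  a value of an encodable type.\<close>

instantiation tree :: enc
begin
definition enc_tree :: "tree \<Rightarrow> tree" where [simp]: "enc_tree t = t"
instance by standard (simp add: inj_on_def)
end

instantiation unit :: enc
begin
definition enc_unit :: "unit \<Rightarrow> tree" where [simp]: "enc_unit u = Atom"
instance by standard (simp add: inj_on_def)
end

instantiation bool :: enc
begin
definition enc_bool' [simp]: "enc (b::bool) = enc_bool b"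
instance proof
  show "inj (enc :: bool \<Rightarrow> tree)"
    by (rule injI, rename_tac b b', case_tac b; case_tac b') auto
qed
end

instantiation nat :: enc
begin
definition enc_nat': "enc (n::nat) = enc_nat n"
instance proof
  have "enc_nat m = enc_nat n \<Longrightarrow> m = n" for m n
    by (induction m arbitrary: n) (case_tac n; simp)+
  then show "inj (enc :: nat \<Rightarrow> tree)"
    by (simp add: inj_on_def enc_nat')
qed
end

instantiation list :: (enc) enc
begin
definition enc_list': "enc (xs::'a list) = enc_list enc xs"
instance proof
  have "enc_list enc xs = enc_list enc ys \<Longrightarrow> xs = ys" for xs ys :: "'a list"
    by (induction xs arbitrary: ys) (case_tac ys; simp)+
  then show "inj (enc :: 'a list \<Rightarrow> tree)"
    by (simp add: inj_on_def enc_list')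
qed
end

instantiation prod :: (enc, enc) enc
begin
definition enc_prod': "enc (p::'a \<times> 'b) = enc_pair enc enc p"
instance by standard (auto simp: inj_on_def enc_prod' enc_pair_def)
end

lemma enc_simps [simp]:
  "enc (0::nat) = Atom"
  "enc (Suc n) = Node Atom (enc n)"
  "enc ([]::'a::enc list) = Atom"
  "enc (x # xs) = Node (enc x) (enc xs)"
  "enc (x, y) = Node (enc x) (enc y)"
  by (simp_all add: enc_nat' enc_list' enc_prod' enc_pair_def)

lemma enc_nat_simp [simp]: "enc_nat n = enc n"
  by (simp add: enc_nat')

lemma enc_list_simp [simp]: "enc_list enc xs = enc xs"
  by (simp add: enc_list')

instantiation gate :: enc
begin
definition enc_gate': "enc (g::gate) = enc_gate g"
instance proof
  have "enc_gate g = enc_gate h \<Longrightarrow> g = h" for g h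
    by (cases g; cases h)
      (simp_all add: numeral_2_eq_2 numeral_3_eq_3 enc_nat'[symmetric, abs_def])
  then show "inj (enc :: gate \<Rightarrow> tree)"
    by (simp add: inj_on_def enc_gate')
qed
end

lemma tsize_pos [simp]: "1 \<le> tsize t" "0 < tsize t" "Suc 0 \<le> tsize t" "tsize t \<noteq> 0"
  by (induction t) auto

lemma tsize_enc_nat [simp]: "tsize (enc n) = 2 * n + 1"
  by (induction n) auto

lemma length_le_tsize: "length xs < tsize (enc xs)"
  by (induction xs) auto

lemma tsize_enc_append: "tsize (enc (xs @ ys)) + 1 = tsize (enc xs) + tsize (enc ys)"
  by (induction xs) auto

lemma tsize_le_list: "x \<in> set xs \<Longrightarrow> tsize (enc x) \<le> tsize (enc xs)"
  by (induction xs) auto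

lemma tsize_thd: "tsize (thd t) \<le> tsize t" and tsize_ttl: "tsize (ttl t) \<le> tsize t"
  by (cases t; simp)+

section \<open>Running programs\<close>

primrec vars :: "expr \<Rightarrow> nat set" where
  "vars (Var x) = {x}"
| "vars (Const v) = {}"
| "vars (Cons_of a b) = vars a \<union> vars b"
| "vars (Hd a) = vars a"
| "vars (Tl a) = vars a"
| "vars (Eq a b) = vars a \<union> vars b"

primrec pvars :: "prog \<Rightarrow> nat set" where
  "pvars Skip = {}"
| "pvars (Assign x e) = insert x (vars e)"
| "pvars (Seq p q) = pvars p \<union> pvars q"
| "pvars (If e p q) = vars e \<union> pvars p \<union> pvars q"
| "pvars (While e p) = vars e \<union> pvars p"

lemma finite_vars: "finite (vars e)"
  by (induction e) auto

lemma finite_pvars: "finite (pvars p)"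
  by (induction p) (auto simp: finite_vars)

lemma eval_cong:
  "(\<And>i. i \<in> vars e \<Longrightarrow> s i = r i) \<Longrightarrow> eval e s = eval e r \<and> cost e s = cost e r"
  by (induction e) fastforce+

text \<open>A program reads and writes only its own variables. The set \<open>M\<close> may exceed
  \<open>pvars p\<close>, so that one set serves all parts of a compound program. A run from the
  otherwise empty store of \<open>runs\<close> can thus be repeated where other data are
  kept.\<close>

lemma exec_frame:
  assumes "exec p s t s'" "pvars p \<subseteq> M" "\<And>i. i \<in> M \<Longrightarrow> r i = s i"
  shows "exec p r t (\<lambda>i. if i \<in> M then s' i else r i)"
  using assms
proof (induction arbitrary: r rule: exec.induct)
  case (Skip s)
  then have "(\<lambda>i. if i \<in> M then s i else r i) = r" by auto
  then show ?case using exec.Skip[of r] by simp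
next
  case (Assign x e s)
  then have e: "eval e r = eval e s \<and> cost e r = cost e s"
    by (intro eval_cong) auto
  have "(\<lambda>i. if i \<in> M then (s(x := eval e s)) i else r i) = r(x := eval e r)"
    using Assign e by (auto simp: fun_eq_iff)
  then show ?case using e exec.Assign[of x e r] by simp
next
  case (Seq p s t s' q t' s'')
  let ?r = "\<lambda>i. if i \<in> M then s' i else r i"
  have "exec p r t ?r" using Seq by simp
  moreover have "exec q ?r t' (\<lambda>i. if i \<in> M then s'' i else ?r i)"
    using Seq.prems by (intro Seq.IH) auto
  moreover have "(\<lambda>i. if i \<in> M then s'' i else ?r i) = (\<lambda>i. if i \<in> M then s'' i else r i)"
    by auto
  ultimately show ?case using exec.Seq by metis
next
  case (IfTrue e s p t s' q)
  then have "eval e r = eval e s \<and> cost e r = cost e s"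
    by (intro eval_cong) auto
  moreover have "exec p r t (\<lambda>i. if i \<in> M then s' i else r i)"
    using IfTrue by simp
  ultimately show ?case using exec.IfTrue IfTrue.hyps(1) by metis
next
  case (IfFalse e s q t s' p)
  then have "eval e r = eval e s \<and> cost e r = cost e s"
    by (intro eval_cong) auto
  moreover have "exec q r t (\<lambda>i. if i \<in> M then s' i else r i)"
    using IfFalse by simp
  ultimately show ?case using exec.IfFalse IfFalse.hyps(1) by metis
next
  case (WhileFalse e s p)
  then have "eval e r = eval e s \<and> cost e r = cost e s"
    by (intro eval_cong) auto
  moreover have "(\<lambda>i. if i \<in> M then s i else r i) = r" using WhileFalse by auto
  ultimately show ?case using exec.WhileFalse[of e r p] WhileFalse.hyps by simp
next
  case (WhileTrue e s p t s' t' s'')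
  let ?r = "\<lambda>i. if i \<in> M then s' i else r i"
  have e: "eval e r = eval e s \<and> cost e r = cost e s"
    using WhileTrue.prems by (intro eval_cong) auto
  have "exec p r t ?r" using WhileTrue by simp
  moreover have "exec (While e p) ?r t' (\<lambda>i. if i \<in> M then s'' i else ?r i)"
    using WhileTrue.prems by (intro WhileTrue.IH) auto
  moreover have "(\<lambda>i. if i \<in> M then s'' i else ?r i) = (\<lambda>i. if i \<in> M then s'' i else r i)"
    by auto
  ultimately show ?case using exec.WhileTrue e WhileTrue.hyps(1) by metis
qed

lemma tsize_eval_le_cost: "tsize (eval e s) \<le> cost e s"
  by (cases e) auto

text \<open>Evaluating an expression costs at least the size of its value, so an assigned variable
  holds nothing larger than the elapsed time. In this way time bounds become size bounds, which are
  needed to bound the time of whatever runs next.\<close>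

lemma exec_size: "exec p s t s' \<Longrightarrow> s' i = s i \<or> tsize (s' i) \<le> t"
proof (induction rule: exec.induct)
  case (Assign x e s)
  then show ?case using tsize_eval_le_cost[of e s] by auto
qed (force, force, force, force, force, force)

text \<open>Upper bounds, unlike the exact times of \<open>exec\<close>, can be weakened to a
  convenient form, and the two branches of a conditional can share one.\<close>

definition execs :: "prog \<Rightarrow> store \<Rightarrow> nat \<Rightarrow> store \<Rightarrow> bool" where
  "execs p s T s' \<longleftrightarrow> (\<exists>t \<le> T. exec p s t s')"

lemma execs_Skip: "1 \<le> T \<Longrightarrow> execs Skip s T s"
  unfolding execs_def using exec.Skip by blast

lemma execs_Assign: "s' = s(x := eval e s) \<Longrightarrow> 1 + cost e s \<le> T \<Longrightarrow> execs (Assign x e) s T s'"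
  unfolding execs_def using exec.Assign by blast

lemma execs_Seq: "execs p s T s' \<Longrightarrow> execs q s' T' s'' \<Longrightarrow> execs (Seq p q) s (1 + T + T') s''"
  unfolding execs_def by (meson exec.Seq add_le_mono le_refl)

lemma execs_If:
  "(eval e s \<noteq> Atom \<Longrightarrow> execs p s T s') \<Longrightarrow> (eval e s = Atom \<Longrightarrow> execs q s T s') \<Longrightarrow>
    execs (If e p q) s (1 + cost e s + T) s'"
  unfolding execs_def by (meson exec.IfTrue exec.IfFalse add_le_mono le_refl)

lemma execs_mono: "execs p s T s' \<Longrightarrow> T \<le> T' \<Longrightarrow> execs p s T' s'"
  unfolding execs_def by (meson order_trans)

lemma execs_WhileFalse: "eval e s = Atom \<Longrightarrow> execs (While e p) s (1 + cost e s) s"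
  unfolding execs_def using exec.WhileFalse by blast

lemma execs_WhileTrue:
  "eval e s \<noteq> Atom \<Longrightarrow> execs p s T s' \<Longrightarrow> execs (While e p) s' T' s'' \<Longrightarrow>
    execs (While e p) s (1 + cost e s + T + T') s''"
  unfolding execs_def by (meson exec.WhileTrue add_le_mono le_refl)

text \<open>A program may use further variables as long as it finds them empty and leaves them empty;
  everything else survives. This makes programs composable without renaming.\<close>

definition computes :: "('a::enc \<Rightarrow> bool) \<Rightarrow> ('a \<Rightarrow> 'b::enc) \<Rightarrow> ('a \<Rightarrow> nat) \<Rightarrow> bool" where
  "computes D f T \<longleftrightarrow> (\<exists>p m. \<forall>s x. D x \<longrightarrow> s 0 = enc x \<longrightarrow> (\<forall>i. 0 < i \<and> i < m \<longrightarrow> s i = Atom) \<longrightarrow>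
     execs p s (T x) (s(0 := enc (f x))))"

lemma computesI:
  assumes "\<And>s x. D x \<Longrightarrow> s 0 = enc x \<Longrightarrow> (\<And>i. 0 < i \<Longrightarrow> i < m \<Longrightarrow> s i = Atom) \<Longrightarrow>
     execs p s (T x) (s(0 := enc (f x)))"
  shows "computes D f T"
  unfolding computes_def using assms by blast

lemma computesE:
  assumes "computes D f T"
  obtains p m where "\<And>s x. D x \<Longrightarrow> s 0 = enc x \<Longrightarrow> (\<And>i. 0 < i \<Longrightarrow> i < m \<Longrightarrow> s i = Atom) \<Longrightarrow>
     execs p s (T x) (s(0 := enc (f x)))"
  using assms unfolding computes_def by blast

lemma computes_mono:
  assumes "computes D f T" "\<And>x. E x \<Longrightarrow> D x" "\<And>x. E x \<Longrightarrow> T x \<le> T' x" "\<And>x. E x \<Longrightarrow> f x = g x"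
  shows "computes E g T'"
proof -
  obtain p m where p: "\<And>s x. D x \<Longrightarrow> s 0 = enc x \<Longrightarrow> (\<And>i. 0 < i \<Longrightarrow> i < m \<Longrightarrow> s i = Atom) \<Longrightarrow>
     execs p s (T x) (s(0 := enc (f x)))"
    using assms(1) by (rule computesE) (auto)
  show ?thesis
    by (rule computesI[where p = p and m = m]) (metis p assms(2-) execs_mono)
qed

text \<open>Restores the discipline of \<open>computes\<close> after a foreign program, which may
  leave anything in its scratch variables; variable 0, the output, is spared.\<close>

primrec clean :: "nat \<Rightarrow> prog" where
  "clean 0 = Skip"
| "clean (Suc n) = Seq (clean n) (Assign (Suc n) (Const Atom))"

lemma execs_clean: "execs (clean n) s (1 + 3 * n) (\<lambda>i. if 0 < i \<and> i \<le> n then Atom else s i)"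
proof (induction n)
  case 0
  have "(\<lambda>i. if 0 < i \<and> i \<le> 0 then Atom else s i) = s" by auto
  then show ?case by (simp add: execs_Skip)
next
  case (Suc n)
  let ?s = "\<lambda>i. if 0 < i \<and> i \<le> n then Atom else s i"
  have "execs (Assign (Suc n) (Const Atom)) ?s 2 (\<lambda>i. if 0 < i \<and> i \<le> Suc n then Atom else s i)"
    by (rule execs_Assign) (auto simp: fun_eq_iff)
  from execs_Seq[OF Suc this] show ?case by (simp add: eval_nat_numeral)
qed

text \<open>Brings programs known only through \<open>runs\<close>, such as the given algorithm,
  into the calculus. By \<open>exec_frame\<close> the run is repeated in a store that agrees with
  the empty one on the variables concerned; clearing them afterwards costs a constant, as their
  number is fixed by the program.\<close>

lemma computes_of_runs:
  assumes "\<And>x. D x \<Longrightarrow> \<exists>t \<le> T x. runs p (enc x) t (enc (f x))"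
  shows "\<exists>c. computes D f (\<lambda>x. T x + c)"
proof -
  obtain n where n: "pvars p \<subseteq> {..n}"
    using finite_pvars[of p] finite_nat_set_iff_bounded_le by (metis atMost_iff subsetI)
  have "computes D f (\<lambda>x. T x + (3 * n + 2))"
  proof (rule computesI[where p = "Seq p (clean n)" and m = "Suc n"])
    fix s :: store and x
    assume x: "D x" "s 0 = enc x" and clean: "\<And>i. 0 < i \<Longrightarrow> i < Suc n \<Longrightarrow> s i = Atom"
    obtain t s' where t: "t \<le> T x" and ex: "exec p ((\<lambda>_. Atom)(0 := enc x)) t s'"
      and s': "s' 0 = enc (f x)"
      using assms[OF x(1)] unfolding runs_def by blast
    have "exec p s t (\<lambda>i. if i \<in> {..n} then s' i else s i)"
      by (rule exec_frame[OF ex n]) (auto simp: x(2) clean)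
    then have "execs p s (T x) (\<lambda>i. if i \<in> {..n} then s' i else s i)"
      unfolding execs_def using t by blast
    note execs_Seq[OF this execs_clean[of n]]
    moreover have "(\<lambda>i. if 0 < i \<and> i \<le> n then Atom else if i \<in> {..n} then s' i else s i)
        = s(0 := enc (f x))"
      using s' clean by (auto simp: fun_eq_iff)
    ultimately show "execs (Seq p (clean n)) s (T x + (3 * n + 2)) (s(0 := enc (f x)))"
      by (simp add: algebra_simps)
  qed
  then show ?thesis by blast
qed

lemma runs_of_computes:
  assumes "computes D f T"
  shows "\<exists>p. \<forall>x. D x \<longrightarrow> (\<exists>t \<le> T x. runs p (enc x) t (enc (f x)))"
proof -
  obtain p m where p: "\<And>s x. D x \<Longrightarrow> s 0 = enc x \<Longrightarrow> (\<And>i. 0 < i \<Longrightarrow> i < m \<Longrightarrow> s i = Atom) \<Longrightarrow>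
     execs p s (T x) (s(0 := enc (f x)))"
    using assms by (rule computesE) auto
  have "\<exists>t \<le> T x. runs p (enc x) t (enc (f x))" if "D x" for x
    using p[OF that, of "(\<lambda>_. Atom)(0 := enc x)"] unfolding execs_def runs_def
    by (metis fun_upd_same fun_upd_other less_irrefl)
  then show ?thesis by blast
qed

lemma computes_size:
  assumes "computes D f T" "D x"
  shows "tsize (enc (f x)) \<le> tsize (enc x) + T x"
proof -
  obtain p t where "t \<le> T x" "runs p (enc x) t (enc (f x))"
    using runs_of_computes[OF assms(1)] assms(2) by blast
  then obtain s where "exec p ((\<lambda>_. Atom)(0 := enc x)) t s" "s 0 = enc (f x)"
    unfolding runs_def by blast
  then show ?thesis
    using exec_size[of p _ t s 0] \<open>t \<le> T x\<close> by fastforce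
qed

section \<open>Programs that evaluate one expression\<close>

lemma expr_linear:
  "vars e \<subseteq> {0} \<Longrightarrow> \<exists>c. \<forall>s. tsize (eval e s) \<le> c * tsize (s 0) \<and> cost e s \<le> c * tsize (s 0)"
proof (induction e)
  case (Var x)
  then show ?case by (intro exI[of _ 1]) auto
next
  case (Const v)
  then show ?case by (intro exI[of _ "tsize v"]) auto
next
  case (Cons_of a b)
  then obtain c d where
    c: "\<And>s. tsize (eval a s) \<le> c * tsize (s 0) \<and> cost a s \<le> c * tsize (s 0)" and
    d: "\<And>s. tsize (eval b s) \<le> d * tsize (s 0) \<and> cost b s \<le> d * tsize (s 0)"
    by auto
  have "tsize (eval (Cons_of a b) s) \<le> (2*c + 2*d + 1) * tsize (s 0) \<and>
    cost (Cons_of a b) s \<le> (2*c + 2*d + 1) * tsize (s 0)" for s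
    using c[of s] d[of s] tsize_pos(1)[of "s 0"] by (simp add: algebra_simps del: tsize_pos)
  then show ?case by blast
next
  case (Hd a)
  then obtain c where
    c: "\<And>s. tsize (eval a s) \<le> c * tsize (s 0) \<and> cost a s \<le> c * tsize (s 0)" by auto
  have "tsize (eval (Hd a) s) \<le> (2*c) * tsize (s 0) \<and> cost (Hd a) s \<le> (2*c) * tsize (s 0)" for s
    using c[of s] tsize_thd[of "eval a s"] by simp
  then show ?case by blast
next
  case (Tl a)
  then obtain c where
    c: "\<And>s. tsize (eval a s) \<le> c * tsize (s 0) \<and> cost a s \<le> c * tsize (s 0)" by auto
  have "tsize (eval (Tl a) s) \<le> (2*c) * tsize (s 0) \<and> cost (Tl a) s \<le> (2*c) * tsize (s 0)" for s
    using c[of s] tsize_ttl[of "eval a s"] by simp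
  then show ?case by blast
next
  case (Eq a b)
  then obtain c d where
    c: "\<And>s. tsize (eval a s) \<le> c * tsize (s 0) \<and> cost a s \<le> c * tsize (s 0)" and
    d: "\<And>s. tsize (eval b s) \<le> d * tsize (s 0) \<and> cost b s \<le> d * tsize (s 0)"
    by auto
  have b: "tsize (enc_bool v) \<le> 3" for v by (cases v) auto
  have "tsize (eval (Eq a b) s) \<le> (c + d + 3) * tsize (s 0) \<and>
    cost (Eq a b) s \<le> (c + d + 3) * tsize (s 0)" for s
    using c[of s] d[of s] tsize_pos(1)[of "s 0"] b[of "eval a s = eval b s"]
    by (simp add: algebra_simps del: tsize_pos)
  then show ?case by blast
qed

lemma computes_expr:
  assumes "vars e \<subseteq> {0}" "\<And>x s. D x \<Longrightarrow> s 0 = enc x \<Longrightarrow> eval e s = enc (f x)"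
  shows "\<exists>c. computes D f (\<lambda>x. c * tsize (enc x))"
proof -
  obtain c where c: "\<And>s. cost e s \<le> c * tsize (s 0)"
    using expr_linear[OF assms(1)] by blast
  have "computes D f (\<lambda>x. Suc c * tsize (enc x))"
  proof (rule computesI[where p = "Assign 0 e" and m = 0])
    fix s :: store and x
    assume "D x" "s 0 = enc x"
    then show "execs (Assign 0 e) s (Suc c * tsize (enc x)) (s(0 := enc (f x)))"
      using c[of s] assms(2)[of x s] tsize_pos(1)[of "enc x"]
      by (intro execs_Assign) (simp_all del: tsize_pos)
  qed
  then show ?thesis by blast
qed

section \<open>Sequencing, pairing and branching\<close>

lemma computes_comp:
  assumes "computes D f T" "computes E g U" "\<And>x. D x \<Longrightarrow> E (f x)"
  shows "computes D (\<lambda>x. g (f x)) (\<lambda>x. 1 + T x + U (f x))"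
proof -
  obtain p m where p: "\<And>s x. D x \<Longrightarrow> s 0 = enc x \<Longrightarrow> (\<And>i. 0 < i \<Longrightarrow> i < m \<Longrightarrow> s i = Atom) \<Longrightarrow>
     execs p s (T x) (s(0 := enc (f x)))"
    using assms(1) by (rule computesE) auto
  obtain q n where q: "\<And>s x. E x \<Longrightarrow> s 0 = enc x \<Longrightarrow> (\<And>i. 0 < i \<Longrightarrow> i < n \<Longrightarrow> s i = Atom) \<Longrightarrow>
     execs q s (U x) (s(0 := enc (g x)))"
    using assms(2) by (rule computesE) auto
  show ?thesis
  proof (rule computesI[where p = "Seq p q" and m = "max m n"])
    fix s :: store and x
    assume x: "D x" "s 0 = enc x" and clean: "\<And>i. 0 < i \<Longrightarrow> i < max m n \<Longrightarrow> s i = Atom"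
    have "execs p s (T x) (s(0 := enc (f x)))"
      by (rule p) (auto simp: x clean)
    moreover have "execs q (s(0 := enc (f x))) (U (f x)) (s(0 := enc (f x), 0 := enc (g (f x))))"
      by (rule q) (auto simp: x assms(3) clean)
    ultimately show "execs (Seq p q) s (1 + T x + U (f x)) (s(0 := enc (g (f x))))"
      using execs_Seq by fastforce
  qed
qed

lemma computes_pair:
  assumes "computes D f T" "computes D g U"
  shows "computes D (\<lambda>x. (f x, g x))
    (\<lambda>x. 20 + 2 * T x + 2 * U x + 2 * tsize (enc x) + 3 * tsize (enc (f x)) + 2 * tsize (enc (g x)))"
proof -
  obtain p m where p: "\<And>s x. D x \<Longrightarrow> s 0 = enc x \<Longrightarrow> (\<And>i. 0 < i \<Longrightarrow> i < m \<Longrightarrow> s i = Atom) \<Longrightarrow>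
     execs p s (T x) (s(0 := enc (f x)))"
    using assms(1) by (rule computesE) auto
  obtain q n where q: "\<And>s x. D x \<Longrightarrow> s 0 = enc x \<Longrightarrow> (\<And>i. 0 < i \<Longrightarrow> i < n \<Longrightarrow> s i = Atom) \<Longrightarrow>
     execs q s (U x) (s(0 := enc (g x)))"
    using assms(2) by (rule computesE) auto
  \<comment> \<open>Two variables above the scratch of both programs: \<open>z\<close> keeps the
    input while the first program overwrites it, \<open>Suc z\<close> keeps the first result during
    the second program.\<close>
  define z where "z = Suc (max m n)"
  have z: "z \<noteq> 0" "m < z" "n < z" by (auto simp: z_def)
  let ?P = "Seq (Assign z (Var 0)) (Seq p (Seq (Assign (Suc z) (Var 0)) (Seq (Assign 0 (Var z))
     (Seq (Assign z (Const Atom)) (Seq q (Seq (Assign 0 (Cons_of (Var (Suc z)) (Var 0)))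
     (Assign (Suc z) (Const Atom))))))))"
  show ?thesis
  proof (rule computesI[where p = ?P and m = "Suc (Suc z)"])
    fix s :: store and x
    assume x: "D x" "s 0 = enc x" and clean: "\<And>i. 0 < i \<Longrightarrow> i < Suc (Suc z) \<Longrightarrow> s i = Atom"
    have 1: "execs (Assign z (Var 0)) s (1 + tsize (enc x)) (s(z := enc x))"
      by (rule execs_Assign) (auto simp: x)
    have 2: "execs p (s(z := enc x)) (T x) (s(z := enc x, 0 := enc (f x)))"
      by (rule p) (use z in \<open>auto simp: x clean\<close>)
    have 3: "execs (Assign (Suc z) (Var 0)) (s(z := enc x, 0 := enc (f x))) (1 + tsize (enc (f x)))
      (s(z := enc x, 0 := enc (f x), Suc z := enc (f x)))"
      by (rule execs_Assign) auto
    have 4: "execs (Assign 0 (Var z)) (s(z := enc x, 0 := enc (f x), Suc z := enc (f x)))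
      (1 + tsize (enc x)) (s(z := enc x, 0 := enc x, Suc z := enc (f x)))"
      by (rule execs_Assign) (use z in \<open>auto simp: fun_eq_iff\<close>)
    have 5: "execs (Assign z (Const Atom)) (s(z := enc x, 0 := enc x, Suc z := enc (f x)))
      2 (s(Suc z := enc (f x)))"
      by (rule execs_Assign) (use z x clean in \<open>auto simp: fun_eq_iff\<close>)
    have 6: "execs q (s(Suc z := enc (f x))) (U x) (s(Suc z := enc (f x), 0 := enc (g x)))"
      by (rule q) (use z in \<open>auto simp: x clean\<close>)
    have 7: "execs (Assign 0 (Cons_of (Var (Suc z)) (Var 0))) (s(Suc z := enc (f x), 0 := enc (g x)))
      (2 + 2 * tsize (enc (f x)) + 2 * tsize (enc (g x))) (s(Suc z := enc (f x), 0 := enc (f x, g x)))"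
      by (rule execs_Assign) (use z in \<open>auto simp: fun_eq_iff\<close>)
    have 8: "execs (Assign (Suc z) (Const Atom)) (s(Suc z := enc (f x), 0 := enc (f x, g x)))
      2 (s(0 := enc (f x, g x)))"
      by (rule execs_Assign) (use z clean in \<open>auto simp: fun_eq_iff\<close>)
    note execs_Seq[OF 1 execs_Seq[OF 2 execs_Seq[OF 3 execs_Seq[OF 4 execs_Seq[OF 5
        execs_Seq[OF 6 execs_Seq[OF 7 8]]]]]]]
    then show "execs ?P s (20 + 2 * T x + 2 * U x + 2 * tsize (enc x) + 3 * tsize (enc (f x)) +
        2 * tsize (enc (g x))) (s(0 := enc (f x, g x)))"
      by (rule execs_mono) linarith
  qed
qed

text \<open>Each branch is required to be correct only where the test selects it; this permits
  decoding a value after checking that it can be decoded.\<close>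

lemma computes_if:
  assumes "computes D b TB" "computes (\<lambda>x. D x \<and> b x) f T" "computes (\<lambda>x. D x \<and> \<not> b x) g U"
  shows "computes D (\<lambda>x. if b x then f x else g x)
    (\<lambda>x. 20 + TB x + 2 * tsize (enc x) + (if b x then T x else U x))"
proof -
  obtain p m where p: "\<And>s x. D x \<Longrightarrow> s 0 = enc x \<Longrightarrow> (\<And>i. 0 < i \<Longrightarrow> i < m \<Longrightarrow> s i = Atom) \<Longrightarrow>
     execs p s (TB x) (s(0 := enc (b x)))"
    using assms(1) by (rule computesE) auto
  obtain q n where q: "\<And>s x. D x \<and> b x \<Longrightarrow> s 0 = enc x \<Longrightarrow>
     (\<And>i. 0 < i \<Longrightarrow> i < n \<Longrightarrow> s i = Atom) \<Longrightarrow> execs q s (T x) (s(0 := enc (f x)))"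
    using assms(2) by (rule computesE) auto
  obtain r l where r: "\<And>s x. D x \<and> \<not> b x \<Longrightarrow> s 0 = enc x \<Longrightarrow>
     (\<And>i. 0 < i \<Longrightarrow> i < l \<Longrightarrow> s i = Atom) \<Longrightarrow> execs r s (U x) (s(0 := enc (g x)))"
    using assms(3) by (rule computesE) auto
  define z where "z = Suc (max m (max n l))"
  have z: "z \<noteq> 0" "m < z" "n < z" "l < z" by (auto simp: z_def)
  let ?R = "\<lambda>q. Seq (Assign 0 (Var z)) (Seq (Assign z (Const Atom)) q)"
  let ?P = "Seq (Assign z (Var 0)) (Seq p (If (Var 0) (?R q) (?R r)))"
  show ?thesis
  proof (rule computesI[where p = ?P and m = "Suc z"])
    fix s :: store and x
    assume x: "D x" "s 0 = enc x" and clean: "\<And>i. 0 < i \<Longrightarrow> i < Suc z \<Longrightarrow> s i = Atom"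
    let ?h = "if b x then f x else g x" and ?V = "if b x then T x else U x"
    have 1: "execs (Assign z (Var 0)) s (1 + tsize (enc x)) (s(z := enc x))"
      by (rule execs_Assign) (auto simp: x)
    have 2: "execs p (s(z := enc x)) (TB x) (s(z := enc x, 0 := enc (b x)))"
      by (rule p) (use z in \<open>auto simp: x clean\<close>)
    have 3: "execs (Assign 0 (Var z)) (s(z := enc x, 0 := enc (b x)))
      (1 + tsize (enc x)) (s(z := enc x))"
      by (rule execs_Assign) (use z x in \<open>auto simp: fun_eq_iff\<close>)
    have 4: "execs (Assign z (Const Atom)) (s(z := enc x)) 2 s"
      by (rule execs_Assign) (use z x clean in \<open>auto simp: fun_eq_iff\<close>)
    have 5: "execs q s ?V (s(0 := enc ?h))" if "b x"
      using q[of x s] that x clean z by simp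
    have 6: "execs r s ?V (s(0 := enc ?h))" if "\<not> b x"
      using r[of x s] that x clean z by simp
    have 7: "execs (If (Var 0) (?R q) (?R r)) (s(z := enc x, 0 := enc (b x)))
      (1 + cost (Var 0) (s(z := enc x, 0 := enc (b x))) + (1 + (1 + tsize (enc x)) + (1 + 2 + ?V)))
      (s(0 := enc ?h))"
    proof (rule execs_If)
      assume "eval (Var 0) (s(z := enc x, 0 := enc (b x))) \<noteq> Atom"
      then have "b x" by (cases "b x") auto
      then show "execs (?R q) (s(z := enc x, 0 := enc (b x)))
        (1 + (1 + tsize (enc x)) + (1 + 2 + ?V)) (s(0 := enc ?h))"
        using execs_Seq[OF 3 execs_Seq[OF 4 5]] by blast
    next
      assume "eval (Var 0) (s(z := enc x, 0 := enc (b x))) = Atom"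
      then have "\<not> b x" by (cases "b x") auto
      then show "execs (?R r) (s(z := enc x, 0 := enc (b x)))
        (1 + (1 + tsize (enc x)) + (1 + 2 + ?V)) (s(0 := enc ?h))"
        using execs_Seq[OF 3 execs_Seq[OF 4 6]] by blast
    qed
    have "tsize (enc (b x)) \<le> 3" by (cases "b x") auto
    then show "execs ?P s (20 + TB x + 2 * tsize (enc x) + ?V) (s(0 := enc ?h))"
      by (intro execs_mono[OF execs_Seq[OF 1 execs_Seq[OF 2 7]]]) simp
  qed
qed

section \<open>Loops over lists\<close>

lemma computes_fold_body:
  fixes S :: "'a::enc \<times> 'b::enc \<times> 'c::enc \<Rightarrow> 'c"
  assumes "computes E S TS"
  shows "\<exists>c. computes (\<lambda>(l, x, acc). l \<noteq> [] \<and> E (x, hd l, acc))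
    (\<lambda>(l, x, acc). (tl l, x, S (x, hd l, acc)))
    (\<lambda>(l, x, acc). c * (tsize (enc (l, x, acc)) + TS (x, hd l, acc)))"
proof -
  let ?D = "\<lambda>(l, x, acc). l \<noteq> [] \<and> E (x, hd l, acc)"
  let ?arg = "\<lambda>(l, x, acc). (x, hd l, acc)"
  obtain a where a: "computes ?D ?arg (\<lambda>\<sigma>. a * tsize (enc \<sigma>))"
    by (atomize_elim, rule computes_expr[where e = "Cons_of (Hd (Tl (Var 0))) (Cons_of (Hd (Hd (Var 0))) (Tl (Tl (Var 0))))"])
      (auto simp: neq_Nil_conv)
  have S: "computes ?D (\<lambda>\<sigma>. S (?arg \<sigma>)) (\<lambda>\<sigma>. 1 + a * tsize (enc \<sigma>) + TS (?arg \<sigma>))"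
    by (rule computes_comp[OF a assms]) auto
  obtain b where b: "computes ?D (\<lambda>(l, x, acc). (tl l, x)) (\<lambda>\<sigma>. b * tsize (enc \<sigma>))"
    by (atomize_elim, rule computes_expr[where e = "Cons_of (Tl (Hd (Var 0))) (Hd (Tl (Var 0)))"])
      (auto simp: neq_Nil_conv)
  obtain d where d: "computes (\<lambda>_. True) (\<lambda>((l :: 'b list, x :: 'a), acc :: 'c). (l, x, acc)) (\<lambda>\<sigma>. d * tsize (enc \<sigma>))"
    by (atomize_elim, rule computes_expr[where e = "Cons_of (Hd (Hd (Var 0))) (Cons_of (Tl (Hd (Var 0))) (Tl (Var 0)))"])
      auto
  note P = computes_comp[OF computes_pair[OF b S] d]
  let ?c = "100 + 10 * a + 10 * b + 10 * d + 10 * d * (a + b)"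
  have "computes ?D (\<lambda>(l, x, acc). (tl l, x, S (x, hd l, acc)))
    (\<lambda>(l, x, acc). ?c * (tsize (enc (l, x, acc)) + TS (x, hd l, acc)))"
  proof (rule computes_mono[OF P])
    fix \<sigma> assume "?D \<sigma>"
    obtain l x acc where \<sigma>: "\<sigma> = (l, x, acc)" by (cases \<sigma>)
    let ?s = "tsize (enc \<sigma>)" and ?T = "TS (x, hd l, acc)" and ?r = "tsize (enc (S (x, hd l, acc)))"
    let ?q = "tsize (enc (tl l, x))"
    have r: "?r \<le> 1 + (a + 1) * ?s + ?T"
      using computes_size[OF S \<open>?D \<sigma>\<close>] by (simp add: \<sigma>)
    have q: "?q \<le> (b + 1) * ?s"
      using computes_size[OF b \<open>?D \<sigma>\<close>] by (simp add: \<sigma>)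
    have e: "tsize (enc ((tl l, x), S (x, hd l, acc))) = 1 + ?q + ?r" by simp
    have "1 + ?q + ?r \<le> 2 + (a + b + 2) * ?s + ?T"
      using q r by (simp add: algebra_simps)
    then have dd: "d * (1 + ?q + ?r) \<le> d * (2 + (a + b + 2) * ?s + ?T)" by (rule mult_le_mono2)
    have s1: "1 \<le> ?s" by (rule tsize_pos)
    have aux: "1 + (20 + 2 * bs + 2 * (1 + as + T) + 2 * s + 3 * q + 2 * r) + dd
      \<le> 25 + 2 * bs + 2 * as + 4 * T + 2 * s + 3 * b' + 2 * a' + dd'"
      if "q \<le> b'" "r \<le> 1 + a' + T" "dd \<le> dd'" for q r dd b' a' T dd' bs as s :: nat
      using that by simp
    have aux2: "25 + 2 * (b * s) + 2 * (a * s) + 4 * T + 2 * s + 3 * ((b + 1) * s) +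
      2 * ((a + 1) * s) + d * (2 + (a + b + 2) * s + T) \<le> ?c * (s + T)" if "1 \<le> s" for s T
      using that by (cases s) (simp_all add: algebra_simps)
    have "1 + (20 + 2 * (b * ?s) + 2 * (1 + a * ?s + ?T) + 2 * ?s + 3 * ?q + 2 * ?r) + d * (1 + ?q + ?r)
      \<le> 25 + 2 * (b * ?s) + 2 * (a * ?s) + 4 * ?T + 2 * ?s + 3 * ((b + 1) * ?s) + 2 * ((a + 1) * ?s) + d * (2 + (a + b + 2) * ?s + ?T)"
      by (rule aux[OF q r dd])
    also have "\<dots> \<le> ?c * (?s + ?T)"
      by (rule aux2[OF s1])
    finally show "1 + (20 + 2 * (b * ?s) + 2 * (1 + a * ?s + TS (case \<sigma> of (l, x, acc) \<Rightarrow> (x, hd l, acc))) + 2 * ?s +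
       3 * tsize (enc (case \<sigma> of (l, x, acc) \<Rightarrow> (tl l, x))) + 2 * tsize (enc (S (case \<sigma> of (l, x, acc) \<Rightarrow> (x, hd l, acc))))) +
       d * tsize (enc (case \<sigma> of (l, x, acc) \<Rightarrow> (tl l, x), S (case \<sigma> of (l, x, acc) \<Rightarrow> (x, hd l, acc))))
       \<le> (case \<sigma> of (l, x, acc) \<Rightarrow> ?c * (tsize (enc (l, x, acc)) + TS (x, hd l, acc)))"
      using e by (simp add: \<sigma>)
  qed auto
  then show ?thesis by blast
qed

text \<open>The state consists of the remaining list, the fixed data \<open>x\<close> and the
  accumulator. The bounds \<open>M\<close>, \<open>Z\<close> and \<open>B\<close> are functions of
  \<open>x\<close> alone because only \<open>x\<close> survives an iteration unchanged; accumulators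
  are constrained only where they are reached after a prefix of the list.\<close>

lemma computes_fold_loop:
  fixes S :: "'a::enc \<times> 'b::enc \<times> 'c::enc \<Rightarrow> 'c"
  assumes "computes E S TS"
  shows "\<exists>c. computes
    (\<lambda>(l, x, acc). D x \<and> (\<forall>n < length l. E (x, l ! n, foldl (\<lambda>acc a. S (x, a, acc)) acc (take n l)) \<and>
        TS (x, l ! n, foldl (\<lambda>acc a. S (x, a, acc)) acc (take n l)) \<le> B x) \<and>
       (\<forall>n \<le> length l. tsize (enc (foldl (\<lambda>acc a. S (x, a, acc)) acc (take n l))) \<le> Z x) \<and>
       tsize (enc l) \<le> M x)
    (\<lambda>(l, x, acc). ([] :: 'b list, x, foldl (\<lambda>acc a. S (x, a, acc)) acc l))
    (\<lambda>(l, x, acc). Suc (length l) * (c * (M x + tsize (enc x) + Z x + B x + 1)))"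
proof -
  let ?G = "\<lambda>x acc a. S (x :: 'a, a :: 'b, acc :: 'c)"
  obtain c where "computes (\<lambda>(l, x, acc). l \<noteq> [] \<and> E (x, hd l, acc))
    (\<lambda>(l, x, acc). (tl l, x, S (x, hd l, acc)))
    (\<lambda>(l, x, acc). c * (tsize (enc (l, x, acc)) + TS (x, hd l, acc)))"
    using computes_fold_body[OF assms] by blast
  then obtain p m where p: "\<And>s \<sigma>. (case \<sigma> of (l, x, acc) \<Rightarrow> l \<noteq> [] \<and> E (x, hd l, acc)) \<Longrightarrow> s 0 = enc \<sigma> \<Longrightarrow>
     (\<And>i. 0 < i \<Longrightarrow> i < m \<Longrightarrow> s i = Atom) \<Longrightarrow>
     execs p s (case \<sigma> of (l, x, acc) \<Rightarrow> c * (tsize (enc (l, x, acc)) + TS (x, hd l, acc)))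
      (s(0 := enc (case \<sigma> of (l, x, acc) \<Rightarrow> (tl l, x, S (x, hd l, acc)))))"
    by (rule computesE) auto
  let ?K = "\<lambda>x. (c * 3 + 10) * (M x + tsize (enc x) + Z x + B x + 1)"
  \<comment> \<open>The guard reads the code of the remaining list, which is \<open>Atom\<close>
    exactly for the empty list.\<close>
  have loop: "execs (While (Hd (Var 0)) p) s (Suc (length l) * ?K x) (s(0 := enc ([] :: 'b list, x, foldl (?G x) acc l)))"
    if "s 0 = enc (l, x, acc)" "\<And>i. 0 < i \<Longrightarrow> i < m \<Longrightarrow> s i = Atom"
      "\<And>n. n < length l \<Longrightarrow> E (x, l ! n, foldl (?G x) acc (take n l)) \<and>
        TS (x, l ! n, foldl (?G x) acc (take n l)) \<le> B x"
      "\<And>n. n \<le> length l \<Longrightarrow> tsize (enc (foldl (?G x) acc (take n l))) \<le> Z x"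
      "tsize (enc l) \<le> M x"
    for s l x acc
    using that
  proof (induction l arbitrary: s acc)
    case Nil
    have "s(0 := enc ([] :: 'b list, x, foldl (?G x) acc [])) = s" using Nil(1) by auto
    moreover have "execs (While (Hd (Var 0)) p) s (1 + cost (Hd (Var 0)) s) s"
      by (rule execs_WhileFalse) (simp add: Nil(1))
    moreover have "1 + cost (Hd (Var 0)) s \<le> Suc (length ([] :: 'b list)) * ?K x"
      using Nil(4)[of 0] by (simp add: Nil(1) algebra_simps)
    ultimately show ?case using execs_mono by (metis (no_types, lifting))
  next
    case (Cons a l)
    let ?acc = "S (x, a, acc)"
    have sz: "tsize (enc acc) \<le> Z x" using Cons.prems(4)[of 0] by simp
    have E: "E (x, a, acc)" and T: "TS (x, a, acc) \<le> B x" using Cons.prems(3)[of 0] by auto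
    have 1: "execs p s (c * (tsize (enc (a # l, x, acc)) + TS (x, a, acc))) (s(0 := enc (l, x, ?acc)))"
      using p[of "(a # l, x, acc)" s] Cons.prems(1,2) E by simp
    have "c * (tsize (enc (a # l, x, acc)) + TS (x, a, acc)) \<le> c * (3 * (M x + tsize (enc x) + Z x + B x + 1))"
      using sz T Cons.prems(5) by (intro mult_le_mono2) simp
    with 1 have 1: "execs p s (c * (3 * (M x + tsize (enc x) + Z x + B x + 1))) (s(0 := enc (l, x, ?acc)))"
      by (rule execs_mono)
    let ?s = "s(0 := enc (l, x, ?acc))"
    have 2: "execs (While (Hd (Var 0)) p) ?s (Suc (length l) * ?K x)
      (?s(0 := enc ([] :: 'b list, x, foldl (?G x) ?acc l)))"
    proof (rule Cons.IH)
      show "?s 0 = enc (l, x, ?acc)" by simp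
      show "?s i = Atom" if "0 < i" "i < m" for i using Cons.prems(2) that by simp
      show "E (x, l ! n, foldl (?G x) ?acc (take n l)) \<and>
        TS (x, l ! n, foldl (?G x) ?acc (take n l)) \<le> B x" if "n < length l" for n
        using Cons.prems(3)[of "Suc n"] that by simp
      show "tsize (enc (foldl (?G x) ?acc (take n l))) \<le> Z x" if "n \<le> length l" for n
        using Cons.prems(4)[of "Suc n"] that by simp
      show "tsize (enc l) \<le> M x" using Cons.prems(5) by simp
    qed
    have "execs (While (Hd (Var 0)) p) s (1 + cost (Hd (Var 0)) s + c * (3 * (M x + tsize (enc x) + Z x + B x + 1)) +
      Suc (length l) * ?K x) (?s(0 := enc ([] :: 'b list, x, foldl (?G x) ?acc l)))"
      by (rule execs_WhileTrue[OF _ 1 2]) (simp add: Cons.prems(1))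
    moreover have "cost (Hd (Var 0)) s \<le> 6 * (M x + tsize (enc x) + Z x + B x + 1)"
      using sz Cons.prems(5) by (simp add: Cons.prems(1))
    ultimately have "execs (While (Hd (Var 0)) p) s (Suc (length (a # l)) * ?K x)
      (?s(0 := enc ([] :: 'b list, x, foldl (?G x) ?acc l)))"
      by (elim execs_mono) (simp add: algebra_simps)
    then show ?case by (simp only: fun_upd_upd foldl_Cons)
  qed
  show ?thesis
    by (intro exI[of _ "c * 3 + 10"] computesI[where p = "While (Hd (Var 0)) p" and m = m])
      (clarify, use loop in \<open>simp del: enc_simps mult_Suc\<close>)
qed

text \<open>No polynomial bound is assumed: domain, time and size are checked only at the
  accumulators that actually occur. This generality serves two loops whose steps call the given
  algorithm or an arbitrary computable function.\<close>

lemma computes_foldl: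
  fixes L :: "'e::enc \<Rightarrow> 'a::enc list" and I :: "'e \<Rightarrow> 'b::enc"
  assumes S: "computes E S TS" and L: "computes D L TL" and I: "computes D I TI"
    and E: "\<And>x n. D x \<Longrightarrow> n < length (L x) \<Longrightarrow> E (x, L x ! n, foldl (\<lambda>acc a. S (x, a, acc)) (I x) (take n (L x)))"
    and B: "\<And>x n. D x \<Longrightarrow> n < length (L x) \<Longrightarrow> TS (x, L x ! n, foldl (\<lambda>acc a. S (x, a, acc)) (I x) (take n (L x))) \<le> B x"
    and Z: "\<And>x n. D x \<Longrightarrow> n \<le> length (L x) \<Longrightarrow> tsize (enc (foldl (\<lambda>acc a. S (x, a, acc)) (I x) (take n (L x)))) \<le> Z x"
  shows "\<exists>c. computes D (\<lambda>x. foldl (\<lambda>acc a. S (x, a, acc)) (I x) (L x))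
    (\<lambda>x. c * (TL x + TI x + tsize (enc (L x)) * (tsize (enc (L x)) + tsize (enc x) + Z x + B x + 1)))"
proof -
  let ?G = "\<lambda>x acc a. S (x, a, acc)"
  obtain a where a: "computes D (\<lambda>x. x) (\<lambda>x. a * tsize (enc x))"
    using computes_expr[of "Var 0" D "\<lambda>x. x"] by auto
  note init = computes_pair[OF L computes_pair[OF a I]]
  obtain c where c: "computes
    (\<lambda>(l, x, acc). D x \<and> (\<forall>n < length l. E (x, l ! n, foldl (?G x) acc (take n l)) \<and>
        TS (x, l ! n, foldl (?G x) acc (take n l)) \<le> B x) \<and>
       (\<forall>n \<le> length l. tsize (enc (foldl (?G x) acc (take n l))) \<le> Z x) \<and>
       tsize (enc l) \<le> tsize (enc (L x)))
    (\<lambda>(l, x, acc). ([] :: 'a list, x, foldl (?G x) acc l))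
    (\<lambda>(l, x, acc). Suc (length l) * (c * (tsize (enc (L x)) + tsize (enc x) + Z x + B x + 1)))"
    using computes_fold_loop[OF S, of D B Z "\<lambda>x. tsize (enc (L x))"] by blast
  obtain b where b: "computes (\<lambda>_. True) (\<lambda>(l :: 'a list, x :: 'e, acc :: 'b). acc) (\<lambda>\<sigma>. b * tsize (enc \<sigma>))"
    by (atomize_elim, rule computes_expr[where e = "Tl (Tl (Var 0))"]) auto
  note P = computes_comp[OF computes_comp[OF init c] b]
  let ?c = "200 + 20 * a + c + 20 * b"
  have "computes D (\<lambda>x. foldl (?G x) (I x) (L x))
    (\<lambda>x. ?c * (TL x + TI x + tsize (enc (L x)) * (tsize (enc (L x)) + tsize (enc x) + Z x + B x + 1)))"
  proof (rule computes_mono[OF P])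
    fix x assume x: "D x"
    define q where "q = tsize (enc (L x)) + tsize (enc x) + Z x + B x + 1"
    define l where "l = tsize (enc (L x))"
    have l: "Suc (length (L x)) \<le> l" "l \<ge> 1" using length_le_tsize[of "L x"] by (auto simp: l_def)
    have i: "tsize (enc (I x)) \<le> Z x" using Z[OF x, of 0] by simp
    have f: "tsize (enc (foldl (?G x) (I x) (L x))) \<le> Z x" using Z[OF x, of "length (L x)"] by simp
    have lc: "Suc (length (L x)) * (c * q) \<le> c * (l * q)"
      using mult_le_mono1[OF l(1), of "c * q"] by (simp add: algebra_simps)
    have q1: "q \<le> l * q" using l(2) by (cases l) auto
    have aq: "a * tsize (enc x) \<le> a * (l * q)" using q1 by (intro mult_le_mono2) (simp add: q_def)
    have bq: "b * (3 + tsize (enc x) + tsize (enc (foldl (?G x) (I x) (L x)))) \<le> b * (3 * (l * q))"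
      using q1 f by (intro mult_le_mono2) (simp add: q_def)
    have "100 + 2 * TL x + 4 * TI x + 4 * (a * tsize (enc x)) + 40 * q +
        Suc (length (L x)) * (c * q) + b * (3 + tsize (enc x) + tsize (enc (foldl (?G x) (I x) (L x))))
        \<le> 100 + 2 * TL x + 4 * TI x + 4 * (a * (l * q)) + 40 * (l * q) + c * (l * q) + b * (3 * (l * q))"
      using lc aq bq q1 by linarith
    also have "\<dots> \<le> ?c * (TL x + TI x + l * q)"
    proof -
      have "100 + 2 * t + 4 * i + 4 * (a * v) + 40 * v + c * v + b * (3 * v)
        \<le> (200 + 20 * a + c + 20 * b) * (t + i + v)" if "1 \<le> v" for t i v
        using that by (simp add: algebra_simps)
      moreover have "1 \<le> l * q" using q1 by (simp add: q_def)
      ultimately show ?thesis by blast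
    qed
    finally have main: "100 + 2 * TL x + 4 * TI x + 4 * (a * tsize (enc x)) + 40 * q +
        Suc (length (L x)) * (c * q) + b * (3 + tsize (enc x) + tsize (enc (foldl (?G x) (I x) (L x))))
        \<le> ?c * (TL x + TI x + l * q)" .
    show "1 + (1 + (20 + 2 * TL x + 2 * (20 + 2 * (a * tsize (enc x)) + 2 * TI x + 2 * tsize (enc x) + 3 * tsize (enc x) + 2 * tsize (enc (I x))) +
       2 * tsize (enc x) + 3 * tsize (enc (L x)) + 2 * tsize (enc (x, I x))) +
       (case (L x, x, I x) of (l, x, acc) \<Rightarrow> Suc (length l) * (c * (tsize (enc (L x)) + tsize (enc x) + Z x + B x + 1)))) +
       b * tsize (enc (case (L x, x, I x) of (l, x, acc) \<Rightarrow> ([] :: 'a list, x, foldl (?G x) acc l)))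
      \<le> ?c * (TL x + TI x + tsize (enc (L x)) * (tsize (enc (L x)) + tsize (enc x) + Z x + B x + 1))"
      by (rule order_trans[OF _ main[unfolded l_def q_def]])
         (use i in \<open>simp add: algebra_simps\<close>)
  qed (auto simp: E B Z)
  then show ?thesis by blast
qed

section \<open>Polynomial time\<close>

text \<open>One constant can be both factor and exponent, since sizes are at least 1.\<close>

definition pbounded :: "('a::enc \<Rightarrow> bool) \<Rightarrow> ('a \<Rightarrow> nat) \<Rightarrow> bool" where
  "pbounded D T \<longleftrightarrow> (\<exists>c. \<forall>x. D x \<longrightarrow> T x \<le> c * tsize (enc x) ^ c)"

lemma pbounded_mono: "pbounded D T \<Longrightarrow> (\<And>x. D x \<Longrightarrow> U x \<le> T x) \<Longrightarrow> pbounded D U"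
  unfolding pbounded_def by (meson order_trans)

lemma pbounded_dom: "pbounded D T \<Longrightarrow> (\<And>x. E x \<Longrightarrow> D x) \<Longrightarrow> pbounded E T"
  unfolding pbounded_def by meson

lemma pbounded_const [intro]: "pbounded D (\<lambda>x. c)"
  unfolding pbounded_def by (intro exI[of _ c]) simp

lemma pbounded_size [intro]: "pbounded D (\<lambda>x. tsize (enc x))"
  unfolding pbounded_def by (intro exI[of _ 1]) simp

lemma poly_weaken: "c \<le> d \<Longrightarrow> e \<le> f \<Longrightarrow> c * tsize t ^ e \<le> d * tsize t ^ f"
  by (intro mult_le_mono power_increasing) auto

lemma pbounded_add [intro]:
  assumes "pbounded D T" "pbounded D U" shows "pbounded D (\<lambda>x. T x + U x)"
proof -
  obtain c d where c: "\<And>x. D x \<Longrightarrow> T x \<le> c * tsize (enc x) ^ c"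
    and d: "\<And>x. D x \<Longrightarrow> U x \<le> d * tsize (enc x) ^ d"
    using assms unfolding pbounded_def by blast
  have "T x + U x \<le> (c + d) * tsize (enc x) ^ (c + d)" if "D x" for x
    using order_trans[OF c[OF that] poly_weaken[of c c c "c + d" "enc x"]]
      order_trans[OF d[OF that] poly_weaken[of d d d "c + d" "enc x"]]
    by (simp add: distrib_right)
  then show ?thesis unfolding pbounded_def by blast
qed

lemma pbounded_mult [intro]:
  assumes "pbounded D T" "pbounded D U" shows "pbounded D (\<lambda>x. T x * U x)"
proof -
  obtain c d where c: "\<And>x. D x \<Longrightarrow> T x \<le> c * tsize (enc x) ^ c"
    and d: "\<And>x. D x \<Longrightarrow> U x \<le> d * tsize (enc x) ^ d"
    using assms unfolding pbounded_def by blast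
  have "T x * U x \<le> (c + d + c * d) * tsize (enc x) ^ (c + d + c * d)" if "D x" for x
    using mult_le_mono[OF c[OF that] d[OF that]]
      poly_weaken[of "c * d" "c + d + c * d" "c + d" "c + d + c * d" "enc x"]
    by (simp add: algebra_simps power_add)
  then show ?thesis unfolding pbounded_def by blast
qed

lemma pbounded_comp:
  assumes "pbounded E U" "pbounded D (\<lambda>x. tsize (enc (f x)))" "\<And>x. D x \<Longrightarrow> E (f x)"
  shows "pbounded D (\<lambda>x. U (f x))"
proof -
  obtain c d where c: "\<And>x. E x \<Longrightarrow> U x \<le> c * tsize (enc x) ^ c"
    and d: "\<And>x. D x \<Longrightarrow> tsize (enc (f x)) \<le> d * tsize (enc x) ^ d"
    using assms unfolding pbounded_def by blast
  let ?e = "c * d ^ c + d * c"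
  have "U (f x) \<le> ?e * tsize (enc x) ^ ?e" if "D x" for x
  proof -
    have "U (f x) \<le> c * tsize (enc (f x)) ^ c" using c assms(3) that by blast
    also have "\<dots> \<le> c * (d * tsize (enc x) ^ d) ^ c"
      by (intro mult_le_mono2 power_mono d that) auto
    also have "\<dots> = (c * d ^ c) * tsize (enc x) ^ (d * c)"
      by (simp add: power_mult_distrib power_mult)
    also have "\<dots> \<le> ?e * tsize (enc x) ^ ?e" by (rule poly_weaken) auto
    finally show ?thesis .
  qed
  then show ?thesis unfolding pbounded_def by blast
qed

definition ptime_on :: "('a::enc \<Rightarrow> bool) \<Rightarrow> ('a \<Rightarrow> 'b::enc) \<Rightarrow> bool" where
  "ptime_on D f \<longleftrightarrow> (\<exists>T. computes D f T \<and> pbounded D T)"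

abbreviation ptime :: "('a::enc \<Rightarrow> 'b::enc) \<Rightarrow> bool" where
  "ptime \<equiv> ptime_on (\<lambda>_. True)"

lemma ptime_onI: "computes D f T \<Longrightarrow> pbounded D T \<Longrightarrow> ptime_on D f"
  unfolding ptime_on_def by blast

lemma ptime_size:
  assumes "ptime_on D f"
  shows "pbounded D (\<lambda>x. tsize (enc (f x)))"
proof -
  obtain T where T: "computes D f T" "pbounded D T" using assms unfolding ptime_on_def by blast
  show ?thesis
    by (rule pbounded_mono[OF pbounded_add[OF pbounded_size T(2)] computes_size[OF T(1)]])
qed

lemma ptime_dom:
  assumes "ptime_on D f" "\<And>x. E x \<Longrightarrow> D x"
  shows "ptime_on E f"
proof -
  obtain T where T: "computes D f T" "pbounded D T" using assms(1) unfolding ptime_on_def by blast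
  show ?thesis
    by (rule ptime_onI[OF computes_mono[OF T(1)] pbounded_dom[OF T(2)]]) (simp_all add: assms(2))
qed

lemma ptime_cong:
  assumes "ptime_on D f" "\<And>x. D x \<Longrightarrow> f x = g x"
  shows "ptime_on D g"
proof -
  obtain T where T: "computes D f T" "pbounded D T" using assms(1) unfolding ptime_on_def by blast
  show ?thesis
    by (rule ptime_onI[OF computes_mono[OF T(1)] T(2)]) (simp_all add: assms(2))
qed

lemma ptime_expr:
  assumes "vars e \<subseteq> {0}" "\<And>x s. D x \<Longrightarrow> s 0 = enc x \<Longrightarrow> eval e s = enc (f x)"
  shows "ptime_on D f"
proof -
  obtain c where "computes D f (\<lambda>x. c * tsize (enc x))"
    using computes_expr[where e = e and D = D and f = f] assms by blast
  then show ?thesis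
    by (rule ptime_onI) (intro pbounded_mult pbounded_const pbounded_size)
qed

lemma ptime_comp_on:
  assumes "ptime_on E g" "ptime_on D f" "\<And>x. D x \<Longrightarrow> E (f x)"
  shows "ptime_on D (\<lambda>x. g (f x))"
proof -
  obtain T U where T: "computes D f T" "pbounded D T" and U: "computes E g U" "pbounded E U"
    using assms unfolding ptime_on_def by blast
  show ?thesis
    by (rule ptime_onI[OF computes_comp[OF T(1) U(1)]])
      (intro assms(3) pbounded_add pbounded_const T pbounded_comp[OF U(2) ptime_size[OF assms(2)]]
        | assumption)+
qed

lemma ptime_comp: "ptime g \<Longrightarrow> ptime_on D f \<Longrightarrow> ptime_on D (\<lambda>x. g (f x))"
  by (rule ptime_comp_on) auto

lemma ptime_pair:
  assumes "ptime_on D f" "ptime_on D g"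
  shows "ptime_on D (\<lambda>x. (f x, g x))"
proof -
  obtain T U where T: "computes D f T" "pbounded D T" and U: "computes D g U" "pbounded D U"
    using assms unfolding ptime_on_def by blast
  show ?thesis
    by (rule ptime_onI[OF computes_pair[OF T(1) U(1)]])
      (intro pbounded_add pbounded_mult pbounded_const pbounded_size T U ptime_size assms)
qed

lemma ptime_comp2:
  assumes "ptime (\<lambda>p. h (fst p) (snd p))" "ptime_on D f" "ptime_on D g"
  shows "ptime_on D (\<lambda>x. h (f x) (g x))"
  using ptime_comp[OF assms(1) ptime_pair[OF assms(2,3)]] by simp

lemma ptime_if_on:
  assumes "ptime_on D b" "ptime_on (\<lambda>x. D x \<and> b x) f" "ptime_on (\<lambda>x. D x \<and> \<not> b x) g"
  shows "ptime_on D (\<lambda>x. if b x then f x else g x)"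
proof -
  obtain TB T U where TB: "computes D b TB" "pbounded D TB"
    and T: "computes (\<lambda>x. D x \<and> b x) f T" "pbounded (\<lambda>x. D x \<and> b x) T"
    and U: "computes (\<lambda>x. D x \<and> \<not> b x) g U" "pbounded (\<lambda>x. D x \<and> \<not> b x) U"
    using assms unfolding ptime_on_def by blast
  obtain c d where c: "\<And>x. D x \<and> b x \<Longrightarrow> T x \<le> c * tsize (enc x) ^ c"
    and d: "\<And>x. D x \<and> \<not> b x \<Longrightarrow> U x \<le> d * tsize (enc x) ^ d"
    using T(2) U(2) unfolding pbounded_def by blast
  have "pbounded D (\<lambda>x. if b x then T x else U x)"
    unfolding pbounded_def
  proof (intro exI[of _ "c + d"] allI impI)
    fix x assume "D x"
    then show "(if b x then T x else U x) \<le> (c + d) * tsize (enc x) ^ (c + d)"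
      using c[of x] d[of x] poly_weaken[of c "c + d" c "c + d" "enc x"]
        poly_weaken[of d "c + d" d "c + d" "enc x"] by auto
  qed
  then show ?thesis
    by (intro ptime_onI[OF computes_if[OF TB(1) T(1) U(1)]] pbounded_add pbounded_mult
        pbounded_const pbounded_size TB)
qed

lemma ptime_if:
  "ptime_on D b \<Longrightarrow> ptime_on D f \<Longrightarrow> ptime_on D g \<Longrightarrow> ptime_on D (\<lambda>x. if b x then f x else g x)"
  by (rule ptime_if_on) (auto intro: ptime_dom)

text \<open>Iterating a polynomial-time step may double the accumulator every time, so a polynomial
  bound \<open>Z\<close> on all intermediate accumulators has to be supplied; with it, each single
  step runs within the polynomial \<open>?B\<close>.\<close>

lemma ptime_foldl:
  fixes S :: "'e::enc \<Rightarrow> 'b::enc \<Rightarrow> 'a::enc \<Rightarrow> 'b"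
  assumes "ptime (\<lambda>p. S (fst p) (snd (snd p)) (fst (snd p)))" "ptime_on D I" "ptime_on D L"
    and Z: "pbounded D Z"
    "\<And>x n. D x \<Longrightarrow> n \<le> length (L x) \<Longrightarrow> tsize (enc (foldl (S x) (I x) (take n (L x)))) \<le> Z x"
  shows "ptime_on D (\<lambda>x. foldl (S x) (I x) (L x))"
proof -
  let ?S = "\<lambda>p. S (fst p) (snd (snd p)) (fst (snd p))"
  obtain TS TI TL where S: "computes (\<lambda>_. True) ?S TS" "pbounded (\<lambda>_. True) TS"
    and I: "computes D I TI" "pbounded D TI" and L: "computes D L TL" "pbounded D TL"
    using assms unfolding ptime_on_def by blast
  obtain c where c: "\<And>p. TS p \<le> c * tsize (enc p) ^ c"
    using S(2) unfolding pbounded_def by blast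
  let ?B = "\<lambda>x. c * (2 + tsize (enc x) + tsize (enc (L x)) + Z x) ^ c"
  have "pbounded D (\<lambda>x. (2 + tsize (enc x) + tsize (enc (L x)) + Z x) ^ n)" for n
    by (induction n) (auto intro!: pbounded_add pbounded_mult pbounded_const pbounded_size Z ptime_size assms)
  then have B: "pbounded D ?B" by (intro pbounded_mult pbounded_const)
  have "\<exists>c. computes D (\<lambda>x. foldl (\<lambda>acc a. ?S (x, a, acc)) (I x) (L x))
    (\<lambda>x. c * (TL x + TI x + tsize (enc (L x)) * (tsize (enc (L x)) + tsize (enc x) + Z x + ?B x + 1)))"
  proof (rule computes_foldl[OF S(1) L(1) I(1)])
    fix x n assume x: "D x" "n < length (L x)"
    let ?p = "(x, L x ! n, foldl (\<lambda>acc a. ?S (x, a, acc)) (I x) (take n (L x)))"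
    have "tsize (enc ?p) \<le> 2 + tsize (enc x) + tsize (enc (L x)) + Z x"
      using tsize_le_list[of "L x ! n" "L x"] x Z(2)[of x n] by simp
    then have "c * tsize (enc ?p) ^ c \<le> ?B x"
      by (intro mult_le_mono2 power_mono) auto
    then show "TS ?p \<le> ?B x" using c order_trans by blast
  qed (use Z(2) in auto)
  then obtain c' where "computes D (\<lambda>x. foldl (\<lambda>acc a. ?S (x, a, acc)) (I x) (L x))
    (\<lambda>x. c' * (TL x + TI x + tsize (enc (L x)) * (tsize (enc (L x)) + tsize (enc x) + Z x + ?B x + 1)))"
    by blast
  then have "ptime_on D (\<lambda>x. foldl (\<lambda>acc a. ?S (x, a, acc)) (I x) (L x))"
    by (rule ptime_onI)
      (intro pbounded_add pbounded_mult pbounded_const pbounded_size Z B I L ptime_size assms)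
  then show ?thesis by simp
qed

text \<open>Each rule peels off one outer function symbol, so \<open>intro pt\<close> follows the
  syntax of a definition and assembles its program. Many later definitions use projections and tests
  in place of pattern matching for this reason.\<close>

named_theorems pt

lemma ptime_id [pt]: "ptime_on D (\<lambda>x. x)"
  by (rule ptime_expr[where e = "Var 0"]) auto

lemma ptime_const [pt]: "ptime_on D (\<lambda>x. c)"
  by (rule ptime_expr[where e = "Const (enc c)"]) auto

lemmas [pt] = ptime_pair ptime_if

text \<open>Distinct types share codes, for instance the pair \<open>(x, xs)\<close> and the list
  \<open>x # xs\<close>. A map between them that preserves codes is the identity at run
  time.\<close>

lemma ptime_coerce: "(\<And>x. D x \<Longrightarrow> enc (f x) = enc x) \<Longrightarrow> ptime_on D f"
  by (rule ptime_expr[where e = "Var 0"]) auto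

lemma ptime_hd_coerce: "(\<And>x. D x \<Longrightarrow> enc (f x) = thd (enc x)) \<Longrightarrow> ptime_on D f"
  by (rule ptime_expr[where e = "Hd (Var 0)"]) auto

lemma ptime_tl_coerce: "(\<And>x. D x \<Longrightarrow> enc (f x) = ttl (enc x)) \<Longrightarrow> ptime_on D f"
  by (rule ptime_expr[where e = "Tl (Var 0)"]) auto

lemma ptime_fst [pt]: "ptime_on D f \<Longrightarrow> ptime_on D (\<lambda>x. fst (f x))"
  by (rule ptime_comp[where g = fst], rule ptime_hd_coerce) (auto simp: split_paired_all)

lemma ptime_snd [pt]: "ptime_on D f \<Longrightarrow> ptime_on D (\<lambda>x. snd (f x))"
  by (rule ptime_comp[where g = snd], rule ptime_tl_coerce) (auto simp: split_paired_all)

lemma ptime_thd [pt]: "ptime_on D f \<Longrightarrow> ptime_on D (\<lambda>x. thd (f x))"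
  by (rule ptime_comp[where g = thd], rule ptime_hd_coerce) auto

lemma ptime_ttl [pt]: "ptime_on D f \<Longrightarrow> ptime_on D (\<lambda>x. ttl (f x))"
  by (rule ptime_comp[where g = ttl], rule ptime_tl_coerce) auto

lemma ptime_tl [pt]: "ptime_on D f \<Longrightarrow> ptime_on D (\<lambda>x. tl (f x))"
  by (rule ptime_comp[where g = tl], rule ptime_tl_coerce) (case_tac x; simp)

lemma ptime_Suc [pt]: "ptime_on D f \<Longrightarrow> ptime_on D (\<lambda>x. Suc (f x))"
  by (rule ptime_comp[where g = Suc], rule ptime_expr[where e = "Cons_of (Const Atom) (Var 0)"]) auto

lemma ptime_Cons [pt]: "ptime_on D f \<Longrightarrow> ptime_on D g \<Longrightarrow> ptime_on D (\<lambda>x. f x # g x)"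
  by (rule ptime_comp2[where h = "(#)"], rule ptime_coerce) (auto simp: split_paired_all)

lemma ptime_Node [pt]: "ptime_on D f \<Longrightarrow> ptime_on D g \<Longrightarrow> ptime_on D (\<lambda>x. Node (f x) (g x))"
  by (rule ptime_comp2[where h = Node], rule ptime_coerce) (auto simp: split_paired_all)

lemma ptime_eq [pt]: "ptime_on D f \<Longrightarrow> ptime_on D g \<Longrightarrow> ptime_on D (\<lambda>x. f x = g x)"
  by (rule ptime_comp2[where h = "(=)"], rule ptime_expr[where e = "Eq (Hd (Var 0)) (Tl (Var 0))"])
    (auto simp: split_paired_all)

lemma ptime_not [pt]: "ptime_on D b \<Longrightarrow> ptime_on D (\<lambda>x. \<not> b x)"
  using ptime_if[of D b "\<lambda>_. False" "\<lambda>_. True"] by (simp add: ptime_const if_bool_eq_conj cong: if_cong)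

lemma ptime_conj [pt]: "ptime_on D b \<Longrightarrow> ptime_on D c \<Longrightarrow> ptime_on D (\<lambda>x. b x \<and> c x)"
  by (rule ptime_cong[OF ptime_if[of D b c "\<lambda>_. False"]]) (simp_all add: ptime_const)

lemma ptime_disj [pt]: "ptime_on D b \<Longrightarrow> ptime_on D c \<Longrightarrow> ptime_on D (\<lambda>x. b x \<or> c x)"
  by (rule ptime_cong[OF ptime_if[of D b "\<lambda>_. True" c]]) (simp_all add: ptime_const)

lemma ptime_imp [pt]: "ptime_on D b \<Longrightarrow> ptime_on D c \<Longrightarrow> ptime_on D (\<lambda>x. b x \<longrightarrow> c x)"
  by (rule ptime_cong[OF ptime_if[of D b c "\<lambda>_. True"]]) (simp_all add: ptime_const)

lemma tsize_rev [simp]: "tsize (enc (rev xs)) = tsize (enc xs)"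
proof (induction xs)
  case (Cons a xs)
  then show ?case using tsize_enc_append[of "rev xs" "[a]"] by simp
qed simp

lemma tsize_take: "tsize (enc (take n xs)) \<le> tsize (enc xs)"
  by (induction xs arbitrary: n) (case_tac n; simp)+

lemma tsize_drop: "tsize (enc (drop n xs)) \<le> tsize (enc xs)"
proof (induction xs arbitrary: n)
  case (Cons a xs)
  show ?case using Cons[of "n - 1"] by (cases n) auto
qed simp

lemma ptime_rev [pt]:
  fixes f :: "'x::enc \<Rightarrow> 'a::enc list"
  shows "ptime_on D f \<Longrightarrow> ptime_on D (\<lambda>x. rev (f x))"
proof (rule ptime_comp[where g = rev])
  have r: "rev xs = foldl (\<lambda>acc a. a # acc) [] xs" for xs :: "'a list"
    by (induction xs rule: rev_induct) auto
  have "ptime (\<lambda>l :: 'a list. foldl (\<lambda>acc a. a # acc) [] l)"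
  proof (rule ptime_foldl)
    show "pbounded (\<lambda>_. True) (\<lambda>x :: 'a list. tsize (enc x))" ..
    show "tsize (enc (foldl (\<lambda>acc a. a # acc) [] (take n x))) \<le> tsize (enc x)" for n and x :: "'a list"
      by (simp add: r[symmetric] tsize_take)
  qed (intro pt)+
  then show "ptime (rev :: 'a list \<Rightarrow> _)" by (simp add: r[symmetric])
qed

lemma ptime_append [pt]:
  fixes f g :: "'x::enc \<Rightarrow> 'a::enc list"
  shows "ptime_on D f \<Longrightarrow> ptime_on D g \<Longrightarrow> ptime_on D (\<lambda>x. f x @ g x)"
proof (rule ptime_comp2[where h = append])
  have r: "rev xs @ ys = foldl (\<lambda>acc a. a # acc) ys xs" for xs ys :: "'a list"
    by (induction xs rule: rev_induct) auto
  have "ptime (\<lambda>p. foldl (\<lambda>acc a. a # acc) (snd p) (rev (fst p :: 'a list)))"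
  proof (rule ptime_foldl)
    show "pbounded (\<lambda>_. True) (\<lambda>x :: 'a list \<times> 'a list. tsize (enc x))" ..
    show "tsize (enc (foldl (\<lambda>acc a. a # acc) (snd p) (take n (rev (fst p))))) \<le> tsize (enc p)"
      for n and p :: "'a list \<times> 'a list"
      using tsize_enc_append[of "rev (take n (rev (fst p)))" "snd p"] tsize_take[of n "rev (fst p)"]
      by (cases p) (simp add: r[symmetric])
  qed (intro pt)+
  then show "ptime (\<lambda>p. fst p @ (snd p :: 'a list))" by (simp add: r[symmetric])
qed

lemma tsize_concat_map:
  "(\<And>a. a \<in> set l \<Longrightarrow> tsize (enc (F a)) \<le> B) \<Longrightarrow> tsize (enc (concat (map F l))) \<le> 1 + length l * B"
proof (induction l)
  case (Cons a l)
  then have "tsize (enc (concat (map F l))) \<le> 1 + length l * B" "tsize (enc (F a)) \<le> B" by auto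
  then show ?case using tsize_enc_append[of "F a" "concat (map F l)"] by simp
qed simp

text \<open>The source of the rules for maps, filters and bounded quantifiers. Since
  \<open>F\<close> also receives the outer argument, comprehensions may be nested. The result stays
  polynomial because each piece is, and there are fewer pieces than the size of the list.\<close>

lemma ptime_concat_map [pt]:
  assumes F: "ptime (\<lambda>p. F (fst p) (snd p))" and L: "ptime_on D L"
  shows "ptime_on D (\<lambda>x. concat (map (F x) (L x)))"
proof -
  have r: "concat (map (F x) l) = foldl (\<lambda>acc a. acc @ F x a) [] l" for x l
    by (induction l rule: rev_induct) auto
  obtain c where c: "\<And>p. tsize (enc (F (fst p) (snd p))) \<le> c * tsize (enc p) ^ c"
    using ptime_size[OF F] unfolding pbounded_def by blast
  let ?B = "\<lambda>x. c * (1 + tsize (enc x) + tsize (enc (L x))) ^ c"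
  have "pbounded D (\<lambda>x. (1 + tsize (enc x) + tsize (enc (L x))) ^ n)" for n
    by (induction n) (auto intro!: pbounded_add pbounded_mult pbounded_const pbounded_size ptime_size L)
  then have B: "pbounded D ?B" by (intro pbounded_mult pbounded_const)
  have Z: "pbounded D (\<lambda>x. 1 + tsize (enc (L x)) * ?B x)"
    by (intro pbounded_add pbounded_mult pbounded_const ptime_size L B)
  have "ptime_on D (\<lambda>x. foldl (\<lambda>acc a. acc @ F x a) [] (L x))"
  proof (rule ptime_foldl[OF _ _ L Z])
    fix x n assume "D x" "n \<le> length (L x)"
    have b: "tsize (enc (F x a)) \<le> ?B x" if "a \<in> set (take n (L x))" for a
    proof -
      have "tsize (enc (x, a)) \<le> 1 + tsize (enc x) + tsize (enc (L x))"
        using tsize_le_list[of a "L x"] that by (auto dest: in_set_takeD)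
      then have "c * tsize (enc (x, a)) ^ c \<le> ?B x" by (intro mult_le_mono2 power_mono) auto
      then show ?thesis using c[of "(x, a)"] unfolding fst_conv snd_conv by (rule order_trans[rotated])
    qed
    have "length (take n (L x)) * ?B x \<le> tsize (enc (L x)) * ?B x"
      using length_le_tsize[of "L x"] by (intro mult_le_mono1) auto
    then show "tsize (enc (foldl (\<lambda>acc a. acc @ F x a) [] (take n (L x)))) \<le> 1 + tsize (enc (L x)) * ?B x"
      unfolding r[symmetric] using tsize_concat_map[of "take n (L x)" "F x" "?B x", OF b] by linarith
  qed (intro pt ptime_comp2[OF F])+
  then show ?thesis by (simp add: r)
qed

lemma ptime_map [pt]:
  assumes "ptime (\<lambda>p. F (fst p) (snd p))" "ptime_on D L"
  shows "ptime_on D (\<lambda>x. map (F x) (L x))"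
  by (rule ptime_cong[OF ptime_concat_map[of "\<lambda>x a. [F x a]" D L]]) (intro pt assms | simp)+

lemma ptime_concat [pt]: "ptime_on D L \<Longrightarrow> ptime_on D (\<lambda>x. concat (L x))"
  by (rule ptime_cong[OF ptime_concat_map[of "\<lambda>x a. a" D L]]) (intro pt | simp)+

lemma ptime_filter [pt]:
  assumes "ptime (\<lambda>p. F (fst p) (snd p))" "ptime_on D L"
  shows "ptime_on D (\<lambda>x. filter (F x) (L x))"
proof (rule ptime_cong[OF ptime_concat_map[of "\<lambda>x a. if F x a then [a] else []" D L]])
  have "concat (map (\<lambda>a. if F x a then [a] else []) l) = filter (F x) l" for x l
    by (induction l) auto
  then show "concat (map (\<lambda>a. if F x a then [a] else []) (L x)) = filter (F x) (L x)" for x .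
qed (intro pt assms)+

lemma ptime_list_ex [pt]:
  assumes "ptime (\<lambda>p. F (fst p) (snd p))" "ptime_on D L"
  shows "ptime_on D (\<lambda>x. \<exists>a \<in> set (L x). F x a)"
  by (rule ptime_cong[of _ "\<lambda>x. filter (F x) (L x) \<noteq> []"])
    (intro pt assms | auto simp: filter_empty_conv)+

lemma ptime_list_all [pt]:
  assumes "ptime (\<lambda>p. F (fst p) (snd p))" "ptime_on D L"
  shows "ptime_on D (\<lambda>x. \<forall>a \<in> set (L x). F x a)"
  by (rule ptime_cong[of _ "\<lambda>x. \<not> (\<exists>a \<in> set (L x). \<not> F x a)"]) (intro pt assms | auto)+

lemma ptime_member [pt]:
  assumes "ptime_on D a" "ptime_on D L"
  shows "ptime_on D (\<lambda>x. a x \<in> set (L x))"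
proof -
  have "ptime_on D (\<lambda>x. \<exists>b \<in> set (snd (a x, L x)). b = fst (a x, L x))"
    by (rule ptime_comp[of "\<lambda>p. \<exists>b \<in> set (snd p). b = fst p"]) (intro pt assms)+
  then show ?thesis by simp
qed

text \<open>A unary number has the code of the list of that many units; hence counting loops are
  folds over lists, and arithmetic reduces to list operations.\<close>

lemma enc_replicate_unit: "enc (replicate n ()) = enc n"
  by (induction n) auto

lemma ptime_replicate_unit [pt]: "ptime_on D f \<Longrightarrow> ptime_on D (\<lambda>x. replicate (f x) ())"
  by (rule ptime_comp[where g = "\<lambda>n. replicate n ()"], rule ptime_coerce)
    (simp_all add: enc_replicate_unit)

lemma ptime_length [pt]:
  fixes f :: "'x::enc \<Rightarrow> 'a::enc list"
  shows "ptime_on D f \<Longrightarrow> ptime_on D (\<lambda>x. length (f x))"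
proof (rule ptime_comp[where g = length])
  have enc_u: "enc (u :: unit list) = enc (length u)" for u by (induction u) auto
  have "ptime (\<lambda>l :: 'a list. length (map (\<lambda>_. ()) l))"
    by (rule ptime_comp[where g = length], rule ptime_coerce) (simp add: enc_u, intro pt)
  then show "ptime (length :: 'a list \<Rightarrow> nat)" by simp
qed

lemma ptime_drop [pt]:
  fixes f :: "'x::enc \<Rightarrow> 'a::enc list"
  shows "ptime_on D n \<Longrightarrow> ptime_on D f \<Longrightarrow> ptime_on D (\<lambda>x. drop (n x) (f x))"
proof (rule ptime_comp2[where h = drop])
  have r: "drop n xs = foldl (\<lambda>l u. tl l) xs (replicate n ())" for n and xs :: "'a list"
    by (induction n arbitrary: xs) (auto simp: drop_Suc)
  have "ptime (\<lambda>p. foldl (\<lambda>l u. tl l) (snd p :: 'a list) (replicate (fst p) ()))"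
  proof (rule ptime_foldl)
    show "pbounded (\<lambda>_. True) (\<lambda>x :: nat \<times> 'a list. tsize (enc x))" ..
    show "tsize (enc (foldl (\<lambda>l u. tl l) (snd p) (take n (replicate (fst p) ())))) \<le> tsize (enc p)"
      for n and p :: "nat \<times> 'a list"
      using tsize_drop[of "min n (fst p)" "snd p"]
      by (cases p) (simp add: r[symmetric])
  qed (intro pt)+
  then show "ptime (\<lambda>p. drop (fst p) (snd p :: 'a list))" by (simp add: r[symmetric])
qed

lemma ptime_less [pt]: "ptime_on D m \<Longrightarrow> ptime_on D n \<Longrightarrow> ptime_on D (\<lambda>x. m x < (n x :: nat))"
  by (rule ptime_cong[of _ "\<lambda>x. drop (m x) (replicate (n x) ()) \<noteq> []"]) (intro pt | auto)+

lemma ptime_le [pt]: "ptime_on D m \<Longrightarrow> ptime_on D n \<Longrightarrow> ptime_on D (\<lambda>x. m x \<le> (n x :: nat))"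
  by (rule ptime_cong[of _ "\<lambda>x. m x < Suc (n x)"]) (intro pt | auto)+

lemma ptime_add [pt]: "ptime_on D m \<Longrightarrow> ptime_on D n \<Longrightarrow> ptime_on D (\<lambda>x. m x + (n x :: nat))"
  by (rule ptime_cong[of _ "\<lambda>x. length (replicate (m x) () @ replicate (n x) ())"]) (intro pt | simp)+

lemma ptime_mult [pt]: "ptime_on D m \<Longrightarrow> ptime_on D n \<Longrightarrow> ptime_on D (\<lambda>x. m x * (n x :: nat))"
proof (rule ptime_comp2[where h = "(*)"])
  show "ptime (\<lambda>p. fst p * (snd p :: nat))"
    by (rule ptime_cong[of _ "\<lambda>p. length (concat (map (\<lambda>_. replicate (snd p) ()) (replicate (fst p) ())))"])
      (intro pt | simp add: length_concat map_replicate_const sum_list_replicate)+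
qed

text \<open>The exponent is a constant of the program: with a variable exponent the unary result
  could have exponential size.\<close>

lemma ptime_power [pt]: "ptime_on D m \<Longrightarrow> ptime_on D (\<lambda>x. m x ^ k :: nat)"
  by (induction k) (simp_all add: ptime_const ptime_mult)

lemma ptime_enumerate [pt]:
  fixes f :: "'x::enc \<Rightarrow> 'a::enc list"
  shows "ptime_on D f \<Longrightarrow> ptime_on D (\<lambda>x. enumerate 0 (f x))"
proof (rule ptime_comp[where g = "enumerate 0"])
  have r: "enumerate 0 xs = foldl (\<lambda>acc a. acc @ [(length acc, a)]) [] xs" for xs :: "'a list"
  proof (induction xs rule: rev_induct)
    case (snoc a xs)
    show ?case by (simp add: enumerate_append_eq snoc[symmetric])
  qed simp
  have sz: "tsize (enc (enumerate m xs)) \<le> 3 * (m + length xs + 1) * length xs + tsize (enc xs)" for m and xs :: "'a list"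
  proof (induction xs arbitrary: m)
    case (Cons a xs)
    show ?case using Cons[of "Suc m"] by (simp add: algebra_simps)
  qed simp
  have "ptime (\<lambda>l :: 'a list. foldl (\<lambda>acc a. acc @ [(length acc, a)]) [] l)"
  proof (rule ptime_foldl)
    show "pbounded (\<lambda>_. True) (\<lambda>x :: 'a list. 3 * (tsize (enc x) + 1) * tsize (enc x) + tsize (enc x))"
      by (intro pbounded_add pbounded_mult pbounded_const pbounded_size)
    show "tsize (enc (foldl (\<lambda>acc a. acc @ [(length acc, a)]) [] (take n x))) \<le>
       3 * (tsize (enc x) + 1) * tsize (enc x) + tsize (enc x)" for n and x :: "'a list"
    proof -
      have l: "length (take n x) \<le> tsize (enc x)" using length_le_tsize[of x] by simp
      have "3 * (0 + length (take n x) + 1) * length (take n x) \<le> 3 * (tsize (enc x) + 1) * tsize (enc x)"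
        using l by (intro mult_le_mono) auto
      then show ?thesis unfolding r[symmetric]
        using sz[of 0 "take n x"] tsize_take[of n x] by linarith
    qed
  qed (intro pt)+
  then show "ptime (enumerate 0 :: 'a list \<Rightarrow> _)" by (simp add: r[symmetric])
qed

lemma ptime_upt [pt]: "ptime_on D f \<Longrightarrow> ptime_on D (\<lambda>x. [0..<f x])"
  by (rule ptime_cong[of _ "\<lambda>x. map fst (enumerate 0 (replicate (f x) ()))"]) (intro pt | simp)+

lemma ptime_distinct [pt]:
  fixes f :: "'x::enc \<Rightarrow> 'a::enc list"
  shows "ptime_on D f \<Longrightarrow> ptime_on D (\<lambda>x. distinct (f x))"
proof (rule ptime_comp[where g = distinct])
  have "distinct l \<longleftrightarrow> (\<forall>p \<in> set (enumerate 0 l). \<forall>q \<in> set (enumerate 0 l). fst p \<noteq> fst q \<longrightarrow> snd p \<noteq> snd q)"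
    for l :: "'a list"
    by (simp add: distinct_conv_nth in_set_enumerate_eq split_paired_all Ball_def)
  then show "ptime (distinct :: 'a list \<Rightarrow> bool)"
    by (intro ptime_cong[where g = "distinct :: 'a list \<Rightarrow> bool" and f = "\<lambda>l. (\<forall>p \<in> set (enumerate 0 l). \<forall>q \<in> set (enumerate 0 l). fst p \<noteq> fst q \<longrightarrow> snd p \<noteq> snd q)"])
      (intro pt | simp)+
qed

text \<open>Decoding costs nothing: where the check succeeds, the decoded value has the same code as
  the argument.\<close>

lemma ptime_decode:
  assumes "ptime v" "\<And>t. v t \<Longrightarrow> enc (dec t) = enc t" "ptime f"
  shows "ptime (\<lambda>t. if v t then f (dec t) else c)"
proof (rule ptime_if_on)
  show "ptime_on (\<lambda>t. True \<and> v t) (\<lambda>t. f (dec t))"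
    by (rule ptime_comp[OF assms(3)], rule ptime_coerce) (simp add: assms(2))
qed (intro pt assms)+

text \<open>Permits programming a function directly on the codes of a datatype; the result is
  retyped by \<open>inv enc\<close>, which leaves the code alone.\<close>

lemma ptime_via_trees:
  fixes f :: "'a::enc \<Rightarrow> 'b::enc"
  assumes "ptime F" "\<And>x. F (enc x) = enc (f x)"
  shows "ptime f"
proof -
  have 1: "ptime (\<lambda>x :: 'a. F (enc x))"
    by (rule ptime_comp[OF assms(1)], rule ptime_coerce) simp
  have 2: "ptime_on (\<lambda>t. t \<in> range (enc :: 'b \<Rightarrow> tree)) (inv enc :: tree \<Rightarrow> 'b)"
    by (rule ptime_coerce) (simp add: f_inv_into_f del: enc_inject)
  have "ptime (\<lambda>x :: 'a. inv enc (F (enc x)) :: 'b)"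
    by (rule ptime_comp_on[OF 2 1]) (simp add: assms(2))
  then show ?thesis by (simp add: assms(2) inj_enc)
qed

section \<open>The reduction\<close>

subsection \<open>Recognising circuits\<close>

text \<open>Every tree is the code of exactly one list of trees, its left subtrees along the right
  spine; so an unchecked input can be scanned by the rules for lists.\<close>

primrec tlist :: "tree \<Rightarrow> tree list" where
  "tlist Atom = []"
| "tlist (Node l r) = l # tlist r"

lemma enc_tlist: "enc (tlist t) = t"
  by (induction t) auto

lemma tlist_enc: "tlist (enc xs) = map enc xs"
  by (induction xs) auto

lemma ptime_tlist [pt]: "ptime_on D f \<Longrightarrow> ptime_on D (\<lambda>x. tlist (f x))"
  by (rule ptime_comp[where g = tlist], rule ptime_coerce) (auto simp: enc_tlist)

lemma range_enc_list:
  assumes "\<And>t. v t \<longleftrightarrow> t \<in> range (enc :: 'a::enc \<Rightarrow> tree)"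
  shows "(\<forall>u \<in> set (tlist t). v u) \<longleftrightarrow> t \<in> range (enc :: 'a list \<Rightarrow> tree)"
proof
  assume "\<forall>u \<in> set (tlist t). v u"
  then have "\<exists>xs :: 'a list. t = enc xs"
  proof (induction t)
    case Atom
    show ?case by (rule exI[of _ "[]"]) simp
  next
    case (Node l r)
    then obtain x :: 'a and xs :: "'a list" where "l = enc x" "r = enc xs" using assms by (auto simp del: enc_inject)
    then show ?case by (intro exI[of _ "x # xs"]) simp
  qed
  then show "t \<in> range (enc :: 'a list \<Rightarrow> tree)" by blast
qed (auto simp: tlist_enc assms)

definition is_nat :: "tree \<Rightarrow> bool" where
  "is_nat t \<longleftrightarrow> (\<forall>u \<in> set (tlist t). u = Atom)"

lemma is_nat_iff: "is_nat t \<longleftrightarrow> t \<in> range (enc :: nat \<Rightarrow> tree)"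
proof -
  have "is_nat t \<longleftrightarrow> t \<in> range (enc :: unit list \<Rightarrow> tree)"
    unfolding is_nat_def by (rule range_enc_list) auto
  moreover have "range (enc :: unit list \<Rightarrow> tree) = range (enc :: nat \<Rightarrow> tree)"
  proof
    have "enc (u :: unit list) = enc (length u)" for u by (induction u) auto
    then show "range (enc :: unit list \<Rightarrow> tree) \<subseteq> range (enc :: nat \<Rightarrow> tree)" by blast
    show "range (enc :: nat \<Rightarrow> tree) \<subseteq> range (enc :: unit list \<Rightarrow> tree)"
      unfolding enc_replicate_unit[symmetric] by blast
  qed
  ultimately show ?thesis by simp
qed

lemma ptime_is_nat [pt]: "ptime_on D f \<Longrightarrow> ptime_on D (\<lambda>x. is_nat (f x))"
  unfolding is_nat_def by (intro pt)

text \<open>The test for \<open>Atom\<close> matters: head and tail of \<open>Atom\<close> are again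
  \<open>Atom\<close>, so it would otherwise pass for the code of \<open>Input\<close>.\<close>

definition is_gate :: "tree \<Rightarrow> bool" where
  "is_gate t \<longleftrightarrow> t \<noteq> Atom \<and> (thd t = enc (0::nat) \<and> ttl t = Atom \<or> thd t = enc (1::nat) \<and> is_nat (ttl t) \<or>
     (thd t = enc (2::nat) \<or> thd t = enc (3::nat)) \<and> (\<forall>u \<in> set (tlist (ttl t)). is_nat u))"

lemma enc_nat_eq: "enc_nat = enc"
  by (rule ext) simp

lemma enc_gate_simps [simp]:
  "enc Input = Node (enc (0::nat)) Atom"
  "enc (Neg j) = Node (enc (1::nat)) (enc j)"
  "enc (Conj js) = Node (enc (2::nat)) (enc js)"
  "enc (Disj js) = Node (enc (3::nat)) (enc js)"
  by (simp_all add: enc_gate' enc_nat_eq)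

lemma is_gate_iff: "is_gate t \<longleftrightarrow> t \<in> range (enc :: gate \<Rightarrow> tree)"
proof
  assume "is_gate t"
  then obtain a b where t: "t = Node a b"
    and "a = enc (0::nat) \<and> b = Atom \<or> a = enc (1::nat) \<and> is_nat b \<or>
      (a = enc (2::nat) \<or> a = enc (3::nat)) \<and> (\<forall>u \<in> set (tlist b). is_nat u)"
    unfolding is_gate_def by (cases t) auto
  then consider "t = enc Input" | j where "t = enc (Neg j)" | js where "t = enc (Conj js)"
    | js where "t = enc (Disj js)"
    unfolding is_nat_iff[abs_def] range_enc_list[of "\<lambda>t. t \<in> range (enc :: nat \<Rightarrow> tree)", OF refl] t
      enc_gate_simps by blast
  then show "t \<in> range (enc :: gate \<Rightarrow> tree)" by cases blast+
next
  assume "t \<in> range (enc :: gate \<Rightarrow> tree)"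
  then obtain g :: gate where "t = enc g" by blast
  then show "is_gate t"
    by (cases g) (auto simp: is_gate_def is_nat_iff tlist_enc)
qed

lemma ptime_is_gate [pt]: "ptime_on D f \<Longrightarrow> ptime_on D (\<lambda>x. is_gate (f x))"
  unfolding is_gate_def by (intro pt)

definition is_circuit :: "tree \<Rightarrow> bool" where
  "is_circuit t \<longleftrightarrow> t \<noteq> Atom \<and> (\<forall>u \<in> set (tlist (thd t)). is_gate u) \<and> is_nat (ttl t)"

lemma is_circuit_iff: "is_circuit t \<longleftrightarrow> t \<in> range (enc :: circuit \<Rightarrow> tree)"
proof -
  have "is_circuit t \<longleftrightarrow> (\<exists>a b. t = Node a b \<and> a \<in> range (enc :: gate list \<Rightarrow> tree) \<and> b \<in> range (enc :: nat \<Rightarrow> tree))"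
    unfolding is_circuit_def is_nat_iff range_enc_list[OF is_gate_iff] by (cases t) auto
  then show ?thesis by (auto simp: image_iff)
qed

lemma ptime_is_circuit [pt]: "ptime_on D f \<Longrightarrow> ptime_on D (\<lambda>x. is_circuit (f x))"
  unfolding is_circuit_def by (intro pt)

lemma enc_circuit_eq: "enc_circuit C = enc C"
proof -
  have "enc_gate = enc" by (rule ext) (simp add: enc_gate')
  then show ?thesis by (cases C) (simp add: enc_circuit_def enc_pair_def)
qed

text \<open>The number at the head of a gate's code; comparing tags lets the definitions below do
  without case distinctions on gates.\<close>

primrec tag :: "gate \<Rightarrow> nat" where
  "tag Input = 0"
| "tag (Neg j) = 1"
| "tag (Conj js) = 2"
| "tag (Disj js) = 3"

lemma tag_eq: "tag g = 0 \<longleftrightarrow> g = Input"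
  by (cases g) auto

lemma ptime_tag [pt]: "ptime_on D f \<Longrightarrow> ptime_on D (\<lambda>x. tag (f x))"
  by (rule ptime_comp[where g = tag], rule ptime_hd_coerce) (case_tac x; simp)

lemma ptime_preds [pt]: "ptime_on D f \<Longrightarrow> ptime_on D (\<lambda>x. preds (f x))"
proof (rule ptime_comp[where g = preds], rule ptime_via_trees)
  \<comment> \<open>A negation stores its predecessor as a bare number, from which a one-element
    list is made; conjunctions and disjunctions already store their list.\<close>
  let ?F = "\<lambda>t. if thd t = Atom then Atom else if thd t = Node Atom Atom then Node (ttl t) Atom else ttl t"
  show "ptime ?F" by (intro pt)
  show "?F (enc g) = enc (preds g)" for g
    by (cases g) (simp_all add: numeral_2_eq_2 numeral_3_eq_3)
qed

lemma set_enumerate0: "set (enumerate 0 xs) = (\<lambda>i. (i, xs ! i)) ` {i. i < length xs}"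
  by (auto simp: in_set_enumerate_eq image_iff)

lemma ptime_wf_circuit [pt]: "ptime_on D f \<Longrightarrow> ptime_on D (\<lambda>x. wf_circuit (f x))"
proof (rule ptime_comp[where g = wf_circuit])
  let ?w = "\<lambda>C. (\<forall>p \<in> set (enumerate 0 (fst C)). (tag (snd p) < 2 \<or> 2 \<le> length (preds (snd p))) \<and>
      distinct (preds (snd p)) \<and> (\<forall>j \<in> set (preds (snd p)). j < fst p)) \<and>
      snd C < length (fst C) \<and> (\<forall>g \<in> set (fst C). snd C \<notin> set (preds g))"
  have "indegree_ok g \<longleftrightarrow> tag g < 2 \<or> 2 \<le> length (preds g)" for g
    by (cases g) (auto simp: indegree_ok_def)
  then have "?w C \<longleftrightarrow> wf_circuit C" for C
    unfolding wf_circuit_def set_enumerate0 case_prod_beta ball_simps by (simp add: subset_iff Ball_def)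
  moreover have "ptime ?w" by (intro pt)
  ultimately show "ptime wf_circuit" by simp
qed

subsection \<open>Letters\<close>

text \<open>
  A set of \<open>k\<close> inputs, with positions shifted by one so that \<open>0\<close> and \<open>n + 1\<close> serve as sentinels, is
  described by its \<open>k + 1\<close> gaps. The letter \<open>(r, lo, hi)\<close> says that the \<open>r\<close>-th gap extends from
  \<open>lo\<close> to \<open>hi\<close>. A single letter witnesses that a position belongs to the set (\<open>lo\<close> does), and also
  that a position does not belong to it (those strictly between \<open>lo\<close> and \<open>hi\<close> do not).
\<close>

type_synonym letter = "nat \<times> nat \<times> nat"

abbreviation lo :: "letter \<Rightarrow> nat" where "lo l \<equiv> fst (snd l)"
abbreviation hi :: "letter \<Rightarrow> nat" where "hi l \<equiv> snd (snd l)"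

definition input_positions :: "circuit \<Rightarrow> nat list" where
  "input_positions C = map (\<lambda>p. Suc (fst p)) (filter (\<lambda>p. tag (snd p) = 0) (enumerate 0 (fst C)))"

text \<open>The side conditions bind the first gap to the sentinel \<open>0\<close> and the last one
  to \<open>n + 1\<close>, and keep all other gaps from starting or ending there. With this built
  into single letters, pairs of letters only have to agree when their gap numbers are equal or
  consecutive.\<close>

definition letters :: "nat \<Rightarrow> circuit \<Rightarrow> letter list" where
  "letters k C = filter (\<lambda>l. lo l < hi l \<and> (fst l = 0 \<longleftrightarrow> lo l = 0) \<and>
       (fst l = k \<longleftrightarrow> hi l = Suc (length (fst C))))
     (concat (map (\<lambda>r. concat (map (\<lambda>a. map (\<lambda>b. (r, a, b))
       (input_positions C @ [Suc (length (fst C))])) (0 # input_positions C))) [0..<Suc k]))"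

lemma ptime_letters [pt]: "ptime_on D k \<Longrightarrow> ptime_on D C \<Longrightarrow> ptime_on D (\<lambda>x. letters (k x) (C x))"
  by (rule ptime_comp2[of letters]) (unfold letters_def input_positions_def, intro pt)

text \<open>The length \<open>w\<close> is fixed, so there are only polynomially many
  tuples.\<close>

lemma ptime_n_lists [pt]: "ptime_on D f \<Longrightarrow> ptime_on D (\<lambda>x. List.n_lists w (f x))"
proof (rule ptime_comp[where g = "List.n_lists w"])
  show "ptime (\<lambda>xs. List.n_lists w xs)"
    by (induction w) (unfold n_lists.simps, (intro pt | assumption)+)
qed

text \<open>Consistency of a whole collection of letters is reduced to pairs, and pairs are what
  single-edge samples can exclude.\<close>

definition compatible :: "letter \<Rightarrow> letter \<Rightarrow> bool" where
  "compatible l m \<longleftrightarrow> (fst l = fst m \<longrightarrow> l = m) \<and> (Suc (fst l) = fst m \<longrightarrow> hi l = lo m) \<and>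
     (Suc (fst m) = fst l \<longrightarrow> hi m = lo l)"

definition conflict :: "letter list \<Rightarrow> letter list \<Rightarrow> bool" where
  "conflict v u \<longleftrightarrow> (\<exists>l \<in> set v. \<exists>m \<in> set u. \<not> compatible l m)"

lemma ptime_conflict [pt]: "ptime_on D v \<Longrightarrow> ptime_on D u \<Longrightarrow> ptime_on D (\<lambda>x. conflict (v x) (u x))"
  by (rule ptime_comp2[of conflict]) (unfold conflict_def compatible_def, intro pt)

type_synonym vertices = "(nat \<times> letter list) list"

definition verts :: "nat \<Rightarrow> nat \<Rightarrow> circuit \<Rightarrow> vertices" where
  "verts w k C = enumerate 0 (List.n_lists w (letters k C))"

lemma ptime_verts [pt]: "ptime_on D k \<Longrightarrow> ptime_on D C \<Longrightarrow> ptime_on D (\<lambda>x. verts w (k x) (C x))"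
  unfolding verts_def by (intro pt)

subsection \<open>Normal forms of circuit nodes\<close>

text \<open>
  Every node is given by a pair of normal forms, for the node and for its negation. For nodes of
  weft \<open>0\<close>, \<open>1\<close>, \<open>2\<close> they are, respectively, a list of vertices (a disjunction), a conjunction of
  such, and a disjunction of these. A table entry is empty if the node exceeds the weft or the
  depth under consideration, and a singleton otherwise.
\<close>

primrec list_or_Nil :: "'a list list \<Rightarrow> 'a list" where
  "list_or_Nil [] = []"
| "list_or_Nil (x # xs) = x"

lemma ptime_list_or_Nil [pt]: "ptime_on D f \<Longrightarrow> ptime_on D (\<lambda>x. list_or_Nil (f x))"
  by (rule ptime_comp[where g = list_or_Nil], rule ptime_hd_coerce) (case_tac x; simp)

primrec nat_or_0 :: "nat list \<Rightarrow> nat" where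
  "nat_or_0 [] = 0"
| "nat_or_0 (x # xs) = x"

lemma ptime_nat_or_0 [pt]: "ptime_on D f \<Longrightarrow> ptime_on D (\<lambda>x. nat_or_0 (f x))"
  by (rule ptime_comp[where g = nat_or_0], rule ptime_hd_coerce) (case_tac x; simp)

definition look :: "'a list list \<Rightarrow> nat \<Rightarrow> 'a list" where
  "look tab j = list_or_Nil (drop j tab)"

lemma ptime_look [pt]: "ptime_on D tab \<Longrightarrow> ptime_on D j \<Longrightarrow> ptime_on D (\<lambda>x. look (tab x) (j x))"
  unfolding look_def by (intro pt)

definition input_entry :: "vertices \<Rightarrow> nat \<Rightarrow> nat list \<times> nat list" where
  "input_entry T j =
    (map fst (filter (\<lambda>p. \<exists>l \<in> set (snd p). lo l = Suc j) T),
     map fst (filter (\<lambda>p. \<exists>l \<in> set (snd p). lo l < Suc j \<and> Suc j < hi l) T))"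

lemma ptime_input_entry [pt]:
  "ptime_on D T \<Longrightarrow> ptime_on D j \<Longrightarrow> ptime_on D (\<lambda>x. input_entry (T x) (j x))"
  by (rule ptime_comp2[of input_entry]) (unfold input_entry_def, intro pt)

text \<open>Meant for gates with at most two predecessors. A negation swaps the forms for the node
  and its negation, and by de Morgan the second component always uses the dual operation. A missing
  entry of a predecessor makes the result empty of its own accord.\<close>

definition small_entry :: "('x \<Rightarrow> 'x \<Rightarrow> 'x) \<Rightarrow> ('x \<Rightarrow> 'x \<Rightarrow> 'x) \<Rightarrow> ('x \<times> 'x) list list \<Rightarrow> gate \<Rightarrow> ('x \<times> 'x) list"
  where "small_entry cj dj tab g =
    (if tag g = 1 then map (\<lambda>e. (snd e, fst e)) (look tab (nat_or_0 (preds g)))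
     else concat (map (\<lambda>e. map (\<lambda>e'.
        if tag g = 2 then (cj (fst e) (fst e'), dj (snd e) (snd e'))
        else (dj (fst e) (fst e'), cj (snd e) (snd e')))
       (look tab (nat_or_0 (tl (preds g))))) (look tab (nat_or_0 (preds g)))))"

lemma ptime_small_entry:
  assumes "ptime (\<lambda>p. cj (fst p) (snd p))" "ptime (\<lambda>p. dj (fst p) (snd p))"
  shows "ptime_on D tab \<Longrightarrow> ptime_on D g \<Longrightarrow> ptime_on D (\<lambda>x. small_entry cj dj (tab x) (g x))"
  by (rule ptime_comp2[of "small_entry cj dj"])
    (unfold small_entry_def, intro pt ptime_comp2[OF assms(1)] ptime_comp2[OF assms(2)])

text \<open>The result may have another type than the entries read, because a large gate uses up one
  level of weft. The explicit test is needed since the concatenation would silently skip a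
  predecessor without entry.\<close>

definition large_entry :: "('y list \<Rightarrow> 'x) \<Rightarrow> ('y list \<Rightarrow> 'x) \<Rightarrow> ('y \<times> 'y) list list \<Rightarrow> gate \<Rightarrow> ('x \<times> 'x) list"
  where "large_entry cl dl tab g =
    (if \<exists>j \<in> set (preds g). look tab j = [] then []
     else if tag g = 2 then
       [(cl (map fst (concat (map (look tab) (preds g)))), dl (map snd (concat (map (look tab) (preds g)))))]
     else
       [(dl (map fst (concat (map (look tab) (preds g)))), cl (map snd (concat (map (look tab) (preds g)))))])"

lemma ptime_large_entry:
  assumes "ptime cl" "ptime dl"
  shows "ptime_on D tab \<Longrightarrow> ptime_on D g \<Longrightarrow> ptime_on D (\<lambda>x. large_entry cl dl (tab x) (g x))"
  by (rule ptime_comp2[of "large_entry cl dl"])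
    (unfold large_entry_def, intro pt ptime_comp[OF assms(1)] ptime_comp[OF assms(2)])

definition build :: "circuit \<Rightarrow> (nat \<Rightarrow> 'x) \<Rightarrow> (gate \<Rightarrow> 'x list) \<Rightarrow> (gate \<Rightarrow> 'x list) \<Rightarrow> 'x list list" where
  "build C ie se le = map (\<lambda>p. if tag (snd p) = 0 then [ie (fst p)]
     else if length (preds (snd p)) \<le> 2 then se (snd p) else le (snd p)) (enumerate 0 (fst C))"

text \<open>Conjunction at weft \<open>0\<close>. Keeping only the vertices that force both
  conjuncts loses nothing as long as one tuple can attest all inputs on which the two depend; this
  is why vertices are tuples and not single letters.\<close>

definition inter :: "'a list \<Rightarrow> 'a list \<Rightarrow> 'a list" where
  "inter xs ys = filter (\<lambda>x. x \<in> set ys) xs"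

text \<open>The distributive law, which turns a disjunction of two conjunctive forms into one such
  form, or dually. It multiplies sizes, which is harmless at constant depth.\<close>

definition distrib :: "'a list list \<Rightarrow> 'a list list \<Rightarrow> 'a list list" where
  "distrib xs ys = concat (map (\<lambda>x. map (\<lambda>y. x @ y) ys) xs)"

text \<open>The first argument is the depth still available: the table for \<open>h\<close> has
  entries for the nodes whose paths from inputs have length at most \<open>h\<close> and contain no
  large gate.\<close>

primrec tab0 :: "nat \<Rightarrow> circuit \<Rightarrow> vertices \<Rightarrow> (nat list \<times> nat list) list list" where
  "tab0 0 C T = build C (input_entry T) (\<lambda>g. []) (\<lambda>g. [])"
| "tab0 (Suc h) C T = build C (input_entry T) (\<lambda>g. small_entry inter (@) (tab0 h C T) g) (\<lambda>g. [])"

text \<open>A large conjunction of disjunctions is a conjunctive form as it stands; a large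
  disjunction of disjunctions merges into a single clause.\<close>

primrec tab1 :: "nat \<Rightarrow> circuit \<Rightarrow> vertices \<Rightarrow> (nat list list \<times> nat list list) list list" where
  "tab1 0 C T = build C (\<lambda>j. ([fst (input_entry T j)], [snd (input_entry T j)])) (\<lambda>g. []) (\<lambda>g. [])"
| "tab1 (Suc h) C T = build C (\<lambda>j. ([fst (input_entry T j)], [snd (input_entry T j)]))
    (\<lambda>g. small_entry (@) distrib (tab1 h C T) g)
    (\<lambda>g. large_entry (\<lambda>ys. ys) (\<lambda>ys. [concat ys]) (tab0 h C T) g)"

text \<open>A large disjunction of conjunctive forms is kept as it stands; a large conjunction
  merges them into a single disjunct.\<close>

primrec tab2 :: "nat \<Rightarrow> circuit \<Rightarrow> vertices \<Rightarrow> (nat list list list \<times> nat list list list) list list" where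
  "tab2 0 C T = build C (\<lambda>j. ([[fst (input_entry T j)]], [[snd (input_entry T j)]])) (\<lambda>g. []) (\<lambda>g. [])"
| "tab2 (Suc h) C T = build C (\<lambda>j. ([[fst (input_entry T j)]], [[snd (input_entry T j)]]))
    (\<lambda>g. small_entry distrib (@) (tab2 h C T) g)
    (\<lambda>g. large_entry (\<lambda>ys. [concat ys]) (\<lambda>ys. ys) (tab1 h C T) g)"

lemma ptime_inter: "ptime (\<lambda>p. inter (fst p) (snd p))"
  unfolding inter_def by (intro pt)

lemma ptime_distrib: "ptime (\<lambda>p. distrib (fst p) (snd p))"
  unfolding distrib_def by (intro pt)

lemmas ptime_entries =
  ptime_small_entry[OF ptime_inter ptime_append[OF ptime_fst[OF ptime_id] ptime_snd[OF ptime_id]]]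
  ptime_small_entry[OF ptime_append[OF ptime_fst[OF ptime_id] ptime_snd[OF ptime_id]] ptime_distrib]
  ptime_small_entry[OF ptime_distrib ptime_append[OF ptime_fst[OF ptime_id] ptime_snd[OF ptime_id]]]
  ptime_large_entry[OF ptime_id, where dl = "\<lambda>ys. [concat ys]"]
  ptime_large_entry[OF _ ptime_id, where cl = "\<lambda>ys. [concat ys]"]

text \<open>Each level is a polynomial-time map of the table below it, and there are only constantly
  many levels.\<close>

lemma ptime_tab0: "ptime (\<lambda>p. tab0 h (fst p) (snd p))"
proof (induction h)
  case (Suc h)
  then show ?case unfolding tab0.simps build_def by (intro pt ptime_entries ptime_comp2[OF Suc])
qed (unfold tab0.simps build_def, intro pt)

lemma ptime_tab1: "ptime (\<lambda>p. tab1 h (fst p) (snd p))"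
proof (induction h)
  case (Suc h)
  then show ?case unfolding tab1.simps build_def
    by (intro pt ptime_entries ptime_comp2[OF Suc] ptime_comp2[OF ptime_tab0])
qed (unfold tab1.simps build_def, intro pt)

lemma ptime_tab2 [pt]:
  "ptime_on D C \<Longrightarrow> ptime_on D T \<Longrightarrow> ptime_on D (\<lambda>x. tab2 h (C x) (T x))"
proof (rule ptime_comp2[where h = "tab2 h"])
  show "ptime (\<lambda>p. tab2 h (fst p) (snd p))"
  proof (induction h)
    case (Suc h)
    then show ?case unfolding tab2.simps build_def
      by (intro pt ptime_entries ptime_comp2[OF Suc] ptime_comp2[OF ptime_tab1])
  qed (unfold tab2.simps build_def, intro pt)
qed

subsection \<open>The instances\<close>

type_synonym IS_inst = "nat \<times> nat \<times> nat list \<times> sample list"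

text \<open>Every vertex is doubled, so that it becomes an edge of a matching.\<close>

definition named :: "vertices \<Rightarrow> vertices" where
  "named T = concat (map (\<lambda>p. [(fst p + fst p, snd p), (Suc (fst p + fst p), snd p)]) T)"

text \<open>Pairs with the same tuple are included: the two copies of a tuple that contradicts
  itself are in conflict.\<close>

definition conflict_samples :: "vertices \<Rightarrow> sample list" where
  "conflict_samples T = concat (map (\<lambda>p. map (\<lambda>q. ([(fst p, fst q)], True))
     (filter (\<lambda>q. fst p \<noteq> fst q \<and> conflict (snd p) (snd q)) (named T))) (named T))"

text \<open>Label \<open>False\<close> asks for an edge inside the solution, so an empty clause
  becomes an unsatisfiable sample, as it should. The filter keeps all edges within the vertex set
  for arbitrary \<open>cs\<close>, so that validity of an instance does not depend on how its
  clauses arose.\<close>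

definition clause_samples :: "vertices \<Rightarrow> nat list list \<Rightarrow> sample list" where
  "clause_samples T cs = map (\<lambda>c. (map (\<lambda>i. (i + i, Suc (i + i)))
     (filter (\<lambda>i. i \<in> set (map fst T)) c), False)) cs"

text \<open>The solution size counts the \<open>Suc k ^ w\<close> tuples of gap numbers, two copies
  each; the second component is the degree bound.\<close>

definition inst :: "nat \<Rightarrow> nat \<Rightarrow> vertices \<Rightarrow> nat list list \<Rightarrow> IS_inst" where
  "inst w k T cs = (2 * Suc k ^ w, 1, map fst (named T), conflict_samples T @ clause_samples T cs)"

definition circuit_instances :: "nat \<Rightarrow> circuit \<times> nat \<Rightarrow> IS_inst list" where
  "circuit_instances d p = (if wf_circuit (fst p) then
     map (\<lambda>cs. inst (2 ^ d) (snd p) (verts (2 ^ d) (snd p) (fst p)) cs)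
       (concat (map fst (look (tab2 d (fst p) (verts (2 ^ d) (snd p) (fst p))) (snd (fst p)))))
     else [])"

text \<open>An input that encodes no well-formed circuit yields no instance at all, hence a negative
  answer.\<close>

definition instances :: "nat \<Rightarrow> tree \<times> nat \<Rightarrow> IS_inst list" where
  "instances d p = (if is_circuit (fst p) then circuit_instances d (inv enc (fst p), snd p) else [])"

lemma ptime_circuit_instances: "ptime (circuit_instances d)"
  unfolding circuit_instances_def[abs_def] inst_def clause_samples_def conflict_samples_def named_def
  by (intro pt)

lemma ptime_instances: "ptime (instances d)"
  unfolding instances_def[abs_def]
proof (rule ptime_decode[where dec = "\<lambda>p. (inv enc (fst p), snd p)", OF _ _ ptime_circuit_instances])
  show "ptime (\<lambda>p :: tree \<times> nat. is_circuit (fst p))" by (intro pt)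
  show "enc (inv enc (fst p) :: circuit, snd p) = enc p" if "is_circuit (fst p)" for p :: "tree \<times> nat"
    using that by (cases p) (auto simp: is_circuit_iff f_inv_into_f simp del: enc_inject)
qed

subsection \<open>Depth and weft\<close>

text \<open>The depth and weft bounds in the recursive form that the tables follow: \<open>h\<close>
  and \<open>r\<close> are the depth and the weft still available.\<close>

primrec shallow :: "circuit \<Rightarrow> nat \<Rightarrow> nat \<Rightarrow> nat \<Rightarrow> bool" where
  "shallow C 0 r i \<longleftrightarrow> fst C ! i = Input"
| "shallow C (Suc h) r i \<longleftrightarrow> fst C ! i = Input \<or>
    (if large (fst C ! i) then 1 \<le> r \<and> (\<forall>j \<in> set (preds (fst C ! i)). shallow C h (r - 1) j)
     else (\<forall>j \<in> set (preds (fst C ! i)). shallow C h r j))"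

text \<open>Input-output paths with an arbitrary end node, as needed for induction along the
  circuit.\<close>

definition path_to :: "circuit \<Rightarrow> nat \<Rightarrow> nat list \<Rightarrow> bool" where
  "path_to C i is \<longleftrightarrow> is \<noteq> [] \<and> set is \<subseteq> {..<length (fst C)} \<and> hd is \<in> inputs C \<and> last is = i \<and>
     (\<forall>m. Suc m < length is \<longrightarrow> is ! m \<in> set (preds (fst C ! (is ! Suc m))))"

lemma input_output_path_iff: "input_output_path C is \<longleftrightarrow> path_to C (snd C) is"
  by (simp add: input_output_path_def path_to_def)

lemma path_to_snoc:
  assumes "path_to C j is" "i < length (fst C)" "j \<in> set (preds (fst C ! i))"
  shows "path_to C i (is @ [i])"
  unfolding path_to_def
proof (intro conjI allI impI)
  fix m assume m: "Suc m < length (is @ [i])"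
  show "(is @ [i]) ! m \<in> set (preds (fst C ! ((is @ [i]) ! Suc m)))"
  proof (cases "Suc m < length is")
    case True
    then show ?thesis using assms(1) by (simp add: path_to_def nth_append)
  next
    case False
    then have *: "Suc m = length is" using m by simp
    then have "is \<noteq> []" "length is - 1 = m" by auto
    then have "is ! m = j" using assms(1) by (simp add: path_to_def last_conv_nth)
    then show ?thesis using assms(3) * by (simp add: nth_append)
  qed
qed (use assms in \<open>auto simp: path_to_def\<close>)

lemma path_to_cases:
  assumes "path_to C i is"
  obtains "is = [i]" "i \<in> inputs C"
  | is' j where "is = is' @ [i]" "path_to C j is'" "j \<in> set (preds (fst C ! i))"
proof (cases "is" rule: rev_cases)
  case Nil
  then show ?thesis using assms by (simp add: path_to_def)
next
  case (snoc is' i')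
  then have i': "i' = i" using assms by (simp add: path_to_def)
  show ?thesis
  proof (cases "is' = []")
    case True
    then show ?thesis using that(1) assms snoc i' by (simp add: path_to_def)
  next
    case False
    define n where "n = length is' - 1"
    have n: "Suc n = length is'" using False by (simp add: n_def)
    have e: "is ! m \<in> set (preds (fst C ! (is ! Suc m)))" if "Suc m < length is" for m
      using assms that by (simp add: path_to_def)
    have "last is' = is ! n"
      using False by (simp add: snoc last_conv_nth nth_append n_def)
    moreover have "is ! Suc n = i" using n by (simp add: snoc i' nth_append)
    ultimately have "last is' \<in> set (preds (fst C ! i))"
      using e[of n] n by (simp add: snoc)
    moreover have "path_to C (last is') is'"
      unfolding path_to_def
    proof (intro conjI allI impI)
      fix m assume "Suc m < length is'"
      then show "is' ! m \<in> set (preds (fst C ! (is' ! Suc m)))"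
        using e[of m] by (simp add: snoc nth_append)
    qed (use assms snoc False in \<open>auto simp: path_to_def\<close>)
    ultimately show ?thesis using that(2) snoc i' by blast
  qed
qed

lemma path_to_Input: "path_to C i is \<Longrightarrow> fst C ! i = Input \<Longrightarrow> is = [i]"
  by (erule path_to_cases) auto

context
  fixes C :: circuit
  assumes wf: "wf_circuit C"
begin

lemma preds_less: "i < length (fst C) \<Longrightarrow> j \<in> set (preds (fst C ! i)) \<Longrightarrow> j < i"
  using wf by (auto simp: wf_circuit_def split: prod.splits)

lemma preds_nonempty:
  assumes "i < length (fst C)" "fst C ! i \<noteq> Input"
  shows "\<exists>j. j \<in> set (preds (fst C ! i))"
proof -
  have "indegree_ok (fst C ! i)"
    using wf assms(1) by (auto simp: wf_circuit_def split: prod.splits)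
  then have "preds (fst C ! i) \<noteq> []"
    using assms(2) by (cases "fst C ! i") (auto simp: indegree_ok_def)
  then show ?thesis by (cases "preds (fst C ! i)") auto
qed

lemma path_exists: "i < length (fst C) \<Longrightarrow> \<exists>is. path_to C i is"
proof (induction i rule: less_induct)
  case (less i)
  show ?case
  proof (cases "fst C ! i = Input")
    case True
    then have "path_to C i [i]" using less by (simp add: path_to_def inputs_def)
    then show ?thesis ..
  next
    case False
    then obtain j where j: "j \<in> set (preds (fst C ! i))"
      using preds_nonempty less.prems by blast
    then obtain "is" where "path_to C j is" using less preds_less[OF less.prems j] by force
    then show ?thesis using path_to_snoc j less.prems by blast
  qed
qed

text \<open>By splitting off the last node of a path. Well-formedness enters through
  \<open>path_exists\<close>: every node ends some path, so conditions on all paths are never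
  vacuous, and the bound \<open>1 \<le> r\<close> at a large gate can be recovered.\<close>

lemma shallow_iff_paths:
  "i < length (fst C) \<Longrightarrow> shallow C h r i \<longleftrightarrow>
    (\<forall>is. path_to C i is \<longrightarrow> length is - 1 \<le> h \<and> length (filter (\<lambda>i. large (fst C ! i)) is) \<le> r)"
proof (induction h arbitrary: r i)
  case 0
  show ?case
  proof
    assume "shallow C 0 r i"
    then have I: "fst C ! i = Input" by simp
    show "\<forall>is. path_to C i is \<longrightarrow> length is - 1 \<le> 0 \<and> length (filter (\<lambda>i. large (fst C ! i)) is) \<le> r"
      using I by (auto dest: path_to_Input simp: large_def)
  next
    assume R: "\<forall>is. path_to C i is \<longrightarrow> length is - 1 \<le> 0 \<and> length (filter (\<lambda>i. large (fst C ! i)) is) \<le> r"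
    show "shallow C 0 r i"
    proof (rule ccontr)
      assume "\<not> shallow C 0 r i"
      then obtain j where j: "j \<in> set (preds (fst C ! i))"
        using preds_nonempty 0 by auto
      then obtain "is" where "path_to C j is"
        using path_exists preds_less 0 by (meson less_trans)
      then have "path_to C i (is @ [i])" "is \<noteq> []" using path_to_snoc j 0 by (auto simp: path_to_def)
      then show False using R by fastforce
    qed
  qed
next
  case (Suc h)
  let ?g = "fst C ! i"
  show ?case
  proof (cases "?g = Input")
    case True
    then have *: "is = [i]" if "path_to C i is" for "is" using path_to_Input that by blast
    have "length is - 1 \<le> Suc h \<and> length (filter (\<lambda>i. large (fst C ! i)) is) \<le> r"
      if "path_to C i is" for "is" using *[OF that] True by (simp add: large_def)
    then show ?thesis using True by simp
  next
    case False
    let ?L = "if large ?g then 1 else 0 :: nat"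
    have p: "path_to C i is \<longleftrightarrow> (\<exists>is' j. is = is' @ [i] \<and> path_to C j is' \<and> j \<in> set (preds ?g))" for "is"
    proof
      assume "path_to C i is"
      then show "\<exists>is' j. is = is' @ [i] \<and> path_to C j is' \<and> j \<in> set (preds ?g)"
        using False by - (erule path_to_cases, auto simp: inputs_def)
    qed (use path_to_snoc Suc.prems in blast)
    have "(\<forall>is. path_to C i is \<longrightarrow> length is - 1 \<le> Suc h \<and> length (filter (\<lambda>i. large (fst C ! i)) is) \<le> r) \<longleftrightarrow>
      (\<forall>j \<in> set (preds ?g). \<forall>is. path_to C j is \<longrightarrow> length is \<le> Suc h \<and>
        length (filter (\<lambda>i. large (fst C ! i)) is) + ?L \<le> r)"
    proof -
      have "length (is @ [i]) - 1 \<le> Suc h \<and> length (filter (\<lambda>i. large (fst C ! i)) (is @ [i])) \<le> r \<longleftrightarrow>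
        length is \<le> Suc h \<and> length (filter (\<lambda>i. large (fst C ! i)) is) + ?L \<le> r" for "is" by simp
      then show ?thesis unfolding p by blast
    qed
    also have "\<dots> \<longleftrightarrow> ?L \<le> r \<and> (\<forall>j \<in> set (preds ?g). \<forall>is. path_to C j is \<longrightarrow> length is - 1 \<le> h \<and>
        length (filter (\<lambda>i. large (fst C ! i)) is) \<le> r - ?L)"
    proof -
      obtain j "is" where "j \<in> set (preds ?g)" "path_to C j is"
        using preds_nonempty[OF Suc.prems False] path_exists preds_less[OF Suc.prems] Suc.prems
        by (meson less_trans)
      moreover have *: "a \<le> Suc h \<and> b + ?L \<le> r \<longleftrightarrow> a - 1 \<le> h \<and> b \<le> r - ?L \<and> ?L \<le> r" for a b
        by auto
      ultimately show ?thesis unfolding * by blast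
    qed
    also have "\<dots> \<longleftrightarrow> ?L \<le> r \<and> (\<forall>j \<in> set (preds ?g). shallow C h (r - ?L) j)"
    proof -
      have "shallow C h q j \<longleftrightarrow> (\<forall>is. path_to C j is \<longrightarrow> length is - 1 \<le> h \<and>
          length (filter (\<lambda>i. large (fst C ! i)) is) \<le> q)" if "j \<in> set (preds ?g)" for j q
        using Suc.IH[of j q] preds_less[OF Suc.prems that] Suc.prems by simp
      then show ?thesis by blast
    qed
    also have "\<dots> \<longleftrightarrow> shallow C (Suc h) r i" using False by simp
    finally show ?thesis by (rule sym)
  qed
qed

lemma shallow_iff: "shallow C d t (snd C) \<longleftrightarrow> weft_at_most t C \<and> depth_at_most d C"
proof -
  have "snd C < length (fst C)" using wf by (auto simp: wf_circuit_def split: prod.splits)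
  from shallow_iff_paths[OF this] show ?thesis
    unfolding weft_at_most_def depth_at_most_def input_output_path_iff
    by (simp only: imp_conjR all_conj_distrib conj_commute)
qed

end

section \<open>Which table entries exist\<close>

lemma look_nth: "i < length tab \<Longrightarrow> look tab i = tab ! i"
  unfolding look_def by (subst Cons_nth_drop_Suc[symmetric]) simp_all

lemma look_build: "i < length (fst C) \<Longrightarrow> look (build C ie se le) i =
  (if fst C ! i = Input then [ie i] else if large (fst C ! i) then le (fst C ! i) else se (fst C ! i))"
  by (subst look_nth) (simp_all add: build_def tag_eq large_def nth_enumerate_eq)

lemma two_elements: "2 \<le> length js \<Longrightarrow> \<not> 2 < length js \<Longrightarrow> \<exists>a b. js = [a, b]"
proof -
  assume "2 \<le> length js" "\<not> 2 < length js"
  then have "length js = Suc (Suc 0)" by simp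
  then show ?thesis by (auto simp: length_Suc_conv)
qed

lemma small_entry_empty:
  assumes "g \<noteq> Input" "indegree_ok g" "\<not> large g"
  shows "small_entry cj dj tab g = [] \<longleftrightarrow> (\<exists>j \<in> set (preds g). look tab j = [])"
proof (cases g)
  case (Conj js)
  then obtain a b where "js = [a, b]" using assms
    using two_elements[of js] by (auto simp: indegree_ok_def large_def)
  then show ?thesis using Conj by (cases "look tab a"; cases "look tab b") (auto simp: small_entry_def)
next
  case (Disj js)
  then obtain a b where "js = [a, b]" using assms
    using two_elements[of js] by (auto simp: indegree_ok_def large_def)
  then show ?thesis using Disj by (cases "look tab a"; cases "look tab b") (auto simp: small_entry_def)
qed (use assms in \<open>auto simp: small_entry_def\<close>)

lemma large_entry_empty:
  "large_entry cl dl tab g = [] \<longleftrightarrow> (\<exists>j \<in> set (preds g). look tab j = [])"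
  by (auto simp: large_entry_def)

context
  fixes C :: circuit
  assumes wf: "wf_circuit C"
begin

lemma indegree: "i < length (fst C) \<Longrightarrow> indegree_ok (fst C ! i)"
  using wf by (auto simp: wf_circuit_def split: prod.splits)

lemma tab0_empty: "i < length (fst C) \<Longrightarrow> look (tab0 h C T) i = [] \<longleftrightarrow> \<not> shallow C h 0 i"
proof (induction h arbitrary: i)
  case (Suc h)
  have "look (tab0 h C T) j = [] \<longleftrightarrow> \<not> shallow C h 0 j" if "j \<in> set (preds (fst C ! i))" for j
    using Suc.IH preds_less[OF wf Suc.prems that] Suc.prems by simp
  then show ?case
    using indegree Suc.prems by (auto simp: look_build small_entry_empty large_entry_empty)
qed (auto simp: look_build)

lemma tab1_empty: "i < length (fst C) \<Longrightarrow> look (tab1 h C T) i = [] \<longleftrightarrow> \<not> shallow C h 1 i"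
proof (induction h arbitrary: i)
  case (Suc h)
  have "look (tab1 h C T) j = [] \<longleftrightarrow> \<not> shallow C h 1 j" if "j \<in> set (preds (fst C ! i))" for j
    using Suc.IH preds_less[OF wf Suc.prems that] Suc.prems by simp
  moreover have "look (tab0 h C T) j = [] \<longleftrightarrow> \<not> shallow C h 0 j" if "j \<in> set (preds (fst C ! i))" for j
    using tab0_empty preds_less[OF wf Suc.prems that] Suc.prems by simp
  ultimately show ?case
    using indegree Suc.prems by (auto simp: look_build small_entry_empty large_entry_empty)
qed (auto simp: look_build)

text \<open>Missing entries propagate exactly as \<open>shallow\<close> fails, whatever the vertices
  are. The reduction thereby recognises weft and depth bounds without a separate test.\<close>

lemma tab2_empty: "i < length (fst C) \<Longrightarrow> look (tab2 h C T) i = [] \<longleftrightarrow> \<not> shallow C h 2 i"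
proof (induction h arbitrary: i)
  case (Suc h)
  have "look (tab2 h C T) j = [] \<longleftrightarrow> \<not> shallow C h 2 j" if "j \<in> set (preds (fst C ! i))" for j
    using Suc.IH preds_less[OF wf Suc.prems that] Suc.prems by simp
  moreover have "look (tab1 h C T) j = [] \<longleftrightarrow> \<not> shallow C h 1 j" if "j \<in> set (preds (fst C ! i))" for j
    using tab1_empty preds_less[OF wf Suc.prems that] Suc.prems by simp
  ultimately show ?case
    using indegree Suc.prems by (auto simp: look_build small_entry_empty large_entry_empty)
qed (auto simp: look_build)

end

subsection \<open>Correctness of the normal forms\<close>

definition gate_value :: "(nat \<Rightarrow> bool) \<Rightarrow> gate \<Rightarrow> bool" where
  "gate_value v g \<longleftrightarrow> (case g of Input \<Rightarrow> False | Neg j \<Rightarrow> \<not> v j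
      | Conj js \<Rightarrow> (\<forall>j \<in> set js. v j) | Disj js \<Rightarrow> (\<exists>j \<in> set js. v j))"

definition decides :: "('x \<Rightarrow> bool) \<Rightarrow> 'x \<times> 'x \<Rightarrow> bool \<Rightarrow> bool" where
  "decides holds e b \<longleftrightarrow> (holds (fst e) \<longleftrightarrow> b) \<and> (holds (snd e) \<longleftrightarrow> \<not> b)"

lemma small_entry_cases:
  assumes "e \<in> set (small_entry cj dj tab g)" "g \<noteq> Input" "indegree_ok g" "\<not> large g"
  obtains j a where "g = Neg j" "a \<in> set (look tab j)" "e = (snd a, fst a)"
  | i j a b where "g = Conj [i, j]" "a \<in> set (look tab i)" "b \<in> set (look tab j)"
      "e = (cj (fst a) (fst b), dj (snd a) (snd b))"
  | i j a b where "g = Disj [i, j]" "a \<in> set (look tab i)" "b \<in> set (look tab j)"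
      "e = (dj (fst a) (fst b), cj (snd a) (snd b))"
proof (cases g)
  case (Neg j)
  then show ?thesis using assms(1) that(1)[of j] by (auto simp: small_entry_def)
next
  case (Conj js)
  then obtain a b where "js = [a, b]" using assms
    using two_elements[of js] by (auto simp: indegree_ok_def large_def)
  then show ?thesis using assms(1) Conj that(2)[of a b] by (auto simp: small_entry_def)
next
  case (Disj js)
  then obtain a b where "js = [a, b]" using assms
    using two_elements[of js] by (auto simp: indegree_ok_def large_def)
  then show ?thesis using assms(1) Disj that(3)[of a b] by (auto simp: small_entry_def)
qed (use assms in auto)

lemma small_entry_decides:
  assumes "e \<in> set (small_entry cj dj tab g)" "g \<noteq> Input" "indegree_ok g" "\<not> large g"
    and IH: "\<And>j e. j \<in> set (preds g) \<Longrightarrow> e \<in> set (look tab j) \<Longrightarrow> decides holds e (v j)"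
    and cj: "\<And>x y. holds (cj x y) \<longleftrightarrow> holds x \<and> holds y"
    and dj: "\<And>x y. holds (dj x y) \<longleftrightarrow> holds x \<or> holds y"
  shows "decides holds e (gate_value v g)"
  using assms(1-4)
proof (cases rule: small_entry_cases)
  case (1 j a)
  then show ?thesis using IH[of j a] by (auto simp: decides_def gate_value_def)
next
  case (2 i j a b)
  then show ?thesis using IH[of i a] IH[of j b] by (auto simp: decides_def gate_value_def cj dj)
next
  case (3 i j a b)
  then show ?thesis using IH[of i a] IH[of j b] by (auto simp: decides_def gate_value_def cj dj)
qed

text \<open>Quantifying over the concatenated entries is the same as quantifying over the
  predecessors, because each predecessor contributes at least one entry and all its entries decide
  the same value.\<close>

lemma large_entry_decides:
  assumes "e \<in> set (large_entry cl dl tab g)" "large g"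
    and IH: "\<And>j e. j \<in> set (preds g) \<Longrightarrow> e \<in> set (look tab j) \<Longrightarrow> decides holds e (v j)"
    and cl: "\<And>ys. holds' (cl ys) \<longleftrightarrow> (\<forall>y \<in> set ys. holds y)"
    and dl: "\<And>ys. holds' (dl ys) \<longleftrightarrow> (\<exists>y \<in> set ys. holds y)"
  shows "decides holds' e (gate_value v g)"
proof -
  let ?es = "concat (map (look tab) (preds g))"
  have ne: "look tab j \<noteq> []" if "j \<in> set (preds g)" for j
    using assms(1) that by (auto simp: large_entry_def split: if_splits)
  have f: "(\<forall>y \<in> fst ` set ?es. holds y) \<longleftrightarrow> (\<forall>j \<in> set (preds g). v j)"
    "(\<exists>y \<in> fst ` set ?es. holds y) \<longleftrightarrow> (\<exists>j \<in> set (preds g). v j)"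
    "(\<forall>y \<in> snd ` set ?es. holds y) \<longleftrightarrow> (\<forall>j \<in> set (preds g). \<not> v j)"
    "(\<exists>y \<in> snd ` set ?es. holds y) \<longleftrightarrow> (\<exists>j \<in> set (preds g). \<not> v j)"
  proof -
    have s: "set ?es = (\<Union>j \<in> set (preds g). set (look tab j))" by simp
    have n: "\<exists>e. e \<in> set (look tab j)" if "j \<in> set (preds g)" for j
      using ne[OF that] by (meson ex_in_conv set_empty)
    have H: "holds (fst e) \<longleftrightarrow> v j" "holds (snd e) \<longleftrightarrow> \<not> v j"
      if "j \<in> set (preds g)" "e \<in> set (look tab j)" for j e
      using IH[OF that] by (auto simp: decides_def)
    have Q: "(\<forall>e \<in> set (look tab j). holds (fst e)) \<longleftrightarrow> v j"
      "(\<exists>e \<in> set (look tab j). holds (fst e)) \<longleftrightarrow> v j"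
      "(\<forall>e \<in> set (look tab j). holds (snd e)) \<longleftrightarrow> \<not> v j"
      "(\<exists>e \<in> set (look tab j). holds (snd e)) \<longleftrightarrow> \<not> v j"
      if "j \<in> set (preds g)" for j
      using n[OF that] H[OF that] by auto
    show "(\<forall>y \<in> fst ` set ?es. holds y) \<longleftrightarrow> (\<forall>j \<in> set (preds g). v j)"
      "(\<exists>y \<in> fst ` set ?es. holds y) \<longleftrightarrow> (\<exists>j \<in> set (preds g). v j)"
      "(\<forall>y \<in> snd ` set ?es. holds y) \<longleftrightarrow> (\<forall>j \<in> set (preds g). \<not> v j)"
      "(\<exists>y \<in> snd ` set ?es. holds y) \<longleftrightarrow> (\<exists>j \<in> set (preds g). \<not> v j)"
      unfolding s ball_simps bex_simps UN_ball_bex_simps by (simp_all only: Q cong: ball_cong bex_cong)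
  qed
  show ?thesis
  proof (cases g)
    case (Conj js)
    then have e: "e = (cl (map fst ?es), dl (map snd ?es))"
      using assms(1) by (simp add: large_entry_def split: if_splits)
    show ?thesis
      unfolding decides_def e fst_conv snd_conv cl dl set_map f using Conj by (simp add: gate_value_def)
  next
    case (Disj js)
    then have e: "e = (dl (map fst ?es), cl (map snd ?es))"
      using assms(1) by (simp add: large_entry_def split: if_splits)
    show ?thesis
      unfolding decides_def e fst_conv snd_conv cl dl set_map f using Disj by (simp add: gate_value_def)
  qed (use assms(2) in \<open>auto simp: large_def\<close>)
qed

text \<open>\<open>X\<close> is the set of those vertices all of whose letters describe \<open>A\<close>.\<close>

locale world =
  fixes C :: circuit and A :: "nat set" and v :: "nat \<Rightarrow> bool" and T :: vertices
    and X :: "nat set" and w :: nat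
  assumes wf: "wf_circuit C"
    and vals: "node_values C A v"
    and pos: "\<And>i u l j. (i, u) \<in> set T \<Longrightarrow> i \<in> X \<Longrightarrow> l \<in> set u \<Longrightarrow> lo l = Suc j \<Longrightarrow> j \<in> inputs C \<Longrightarrow> j \<in> A"
    and neg: "\<And>i u l j. (i, u) \<in> set T \<Longrightarrow> i \<in> X \<Longrightarrow> l \<in> set u \<Longrightarrow> lo l < Suc j \<Longrightarrow> Suc j < hi l \<Longrightarrow> j \<notin> A"
    and witness: "\<And>J. J \<subseteq> inputs C \<Longrightarrow> card J \<le> w \<Longrightarrow> \<exists>(i, u) \<in> set T. i \<in> X \<and>
      (\<forall>j \<in> J. if j \<in> A then \<exists>l \<in> set u. lo l = Suc j else \<exists>l \<in> set u. lo l < Suc j \<and> Suc j < hi l)"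
begin

definition holds0 :: "nat list \<Rightarrow> bool" where "holds0 c \<longleftrightarrow> (\<exists>i \<in> set c. i \<in> X)"
definition holds1 :: "nat list list \<Rightarrow> bool" where "holds1 cs \<longleftrightarrow> (\<forall>c \<in> set cs. holds0 c)"
definition holds2 :: "nat list list list \<Rightarrow> bool" where "holds2 ds \<longleftrightarrow> (\<exists>cs \<in> set ds. holds1 cs)"

lemma holds1_distrib: "holds1 (distrib x y) \<longleftrightarrow> holds1 x \<or> holds1 y"
proof -
  have "holds0 (a @ b) \<longleftrightarrow> holds0 a \<or> holds0 b" for a b by (auto simp: holds0_def)
  then have "holds1 (distrib x y) \<longleftrightarrow> (\<forall>a \<in> set x. \<forall>b \<in> set y. holds0 a \<or> holds0 b)"
    by (simp add: holds1_def distrib_def)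
  also have "\<dots> \<longleftrightarrow> (\<forall>a \<in> set x. holds0 a) \<or> (\<forall>b \<in> set y. holds0 b)" by blast
  finally show ?thesis by (simp add: holds1_def)
qed

lemma holds1_append: "holds1 (x @ y) \<longleftrightarrow> holds1 x \<and> holds1 y"
  by (auto simp: holds1_def)

definition attests :: "letter list \<Rightarrow> nat \<Rightarrow> bool" where
  "attests u j \<longleftrightarrow> (if j \<in> A then \<exists>l \<in> set u. lo l = Suc j else \<exists>l \<in> set u. lo l < Suc j \<and> Suc j < hi l)"

text \<open>Soundness for every vertex of \<open>X\<close>, but completeness only for those that
  attest the values on \<open>J\<close>. Merely demanding that some vertex of \<open>X\<close> be
  listed would not be preserved when lists are intersected.\<close>

definition covers :: "nat set \<Rightarrow> nat list \<times> nat list \<Rightarrow> bool \<Rightarrow> bool" where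
  "covers J e b \<longleftrightarrow> (\<forall>i \<in> X. (i \<in> set (fst e) \<longrightarrow> b) \<and> (i \<in> set (snd e) \<longrightarrow> \<not> b)) \<and>
     (\<forall>(i, u) \<in> set T. i \<in> X \<longrightarrow> (\<forall>j \<in> J. attests u j) \<longrightarrow> i \<in> set (if b then fst e else snd e))"

lemma value_node: "i < length (fst C) \<Longrightarrow> fst C ! i \<noteq> Input \<Longrightarrow> v i \<longleftrightarrow> gate_value v (fst C ! i)"
  using vals by (simp add: node_values_def gate_value_def split: gate.splits)

lemma value_input: "i < length (fst C) \<Longrightarrow> fst C ! i = Input \<Longrightarrow> v i \<longleftrightarrow> i \<in> A"
  using vals by (simp add: node_values_def)

lemma covers_input:
  assumes i: "i < length (fst C)" "fst C ! i = Input"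
  shows "covers {i} (input_entry T i) (v i)"
proof -
  have "i \<in> inputs C" using i by (simp add: inputs_def)
  moreover have "a \<in> set (fst (input_entry T i)) \<longleftrightarrow> (\<exists>u. (a, u) \<in> set T \<and> (\<exists>l \<in> set u. lo l = Suc i))" for a
    by (force simp: input_entry_def)
  moreover have "a \<in> set (snd (input_entry T i)) \<longleftrightarrow>
      (\<exists>u. (a, u) \<in> set T \<and> (\<exists>l \<in> set u. lo l < Suc i \<and> Suc i < hi l))" for a
    by (force simp: input_entry_def)
  ultimately show ?thesis
    using pos neg unfolding covers_def attests_def value_input[OF i] by (simp split: if_split) blast
qed

text \<open>A small gate at most doubles the number of relevant inputs. A vertex attesting
  \<open>J \<union> J'\<close> is listed on the right side for both operands, which serves
  intersection and union alike.\<close>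

lemma tab0_covers:
  "i < length (fst C) \<Longrightarrow> e \<in> set (look (tab0 h C T) i) \<Longrightarrow>
    \<exists>J \<subseteq> inputs C. card J \<le> 2 ^ h \<and> covers J e (v i)"
proof (induction h arbitrary: i e)
  case 0
  then have "fst C ! i = Input" "e = input_entry T i" by (auto simp: look_build split: if_splits)
  then show ?case using covers_input 0 by (intro exI[of _ "{i}"]) (auto simp: inputs_def)
next
  case (Suc h)
  show ?case
  proof (cases "fst C ! i = Input")
    case True
    then have "e = input_entry T i" using Suc.prems by (simp add: look_build)
    then show ?thesis using covers_input Suc.prems True
      by (intro exI[of _ "{i}"]) (auto simp: inputs_def)
  next
    case False
    let ?g = "fst C ! i"
    have e: "e \<in> set (small_entry inter (@) (tab0 h C T) ?g)" "\<not> large ?g"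
      using Suc.prems False by (auto simp: look_build split: if_splits)
    have vi: "v i \<longleftrightarrow> gate_value v ?g" using value_node Suc.prems False by blast
    have IH: "\<exists>J \<subseteq> inputs C. card J \<le> 2 ^ h \<and> covers J a (v j)"
      if "j \<in> set (preds ?g)" "a \<in> set (look (tab0 h C T) j)" for j a
      using Suc.IH[of j a] that preds_less[OF wf Suc.prems(1)] Suc.prems(1) by force
    show ?thesis
      using e(1) False indegree[OF wf Suc.prems(1)] e(2)
    proof (cases rule: small_entry_cases)
      case (1 j a)
      then obtain J where "J \<subseteq> inputs C" "card J \<le> 2 ^ h" "covers J a (v j)" using IH[of j a] by auto
      then show ?thesis using 1 vi
        by (intro exI[of _ J]) (auto simp: covers_def gate_value_def)
    next
      case (2 j j' a b)
      then obtain J J' where J: "J \<subseteq> inputs C" "card J \<le> 2 ^ h" "covers J a (v j)"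
        "J' \<subseteq> inputs C" "card J' \<le> 2 ^ h" "covers J' b (v j')"
        using IH[of j a] IH[of j' b] by auto
      have "covers (J \<union> J') e (v i)"
        using J(3,6) 2 unfolding vi covers_def by (auto simp: gate_value_def inter_def split_beta)
      moreover have "card (J \<union> J') \<le> 2 ^ Suc h" using card_Un_le[of J J'] J by simp
      ultimately show ?thesis using J by (intro exI[of _ "J \<union> J'"]) simp
    next
      case (3 j j' a b)
      then obtain J J' where J: "J \<subseteq> inputs C" "card J \<le> 2 ^ h" "covers J a (v j)"
        "J' \<subseteq> inputs C" "card J' \<le> 2 ^ h" "covers J' b (v j')"
        using IH[of j a] IH[of j' b] by auto
      have "covers (J \<union> J') e (v i)"
        using J(3,6) 3 unfolding vi covers_def by (auto simp: gate_value_def inter_def split_beta)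
      moreover have "card (J \<union> J') \<le> 2 ^ Suc h" using card_Un_le[of J J'] J by simp
      ultimately show ?thesis using J by (intro exI[of _ "J \<union> J'"]) simp
    qed
  qed
qed

text \<open>Here the length \<open>w\<close> of the tuples is used: one vertex of \<open>X\<close>
  attests all of \<open>J\<close> at once.\<close>

lemma covers_decides:
  assumes "J \<subseteq> inputs C" "card J \<le> w" "covers J e b"
  shows "decides holds0 e b"
proof -
  obtain i u where "(i, u) \<in> set T" "i \<in> X" "\<forall>j \<in> J. attests u j"
    using witness[OF assms(1,2)] unfolding attests_def by blast
  then have "i \<in> set (if b then fst e else snd e)" using assms(3) by (auto simp: covers_def)
  then show ?thesis
    using assms(3) \<open>i \<in> X\<close> by (auto simp: covers_def decides_def holds0_def split: if_splits)
qed

lemma tab0_decides: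
  assumes "2 ^ h \<le> w" "i < length (fst C)" "e \<in> set (look (tab0 h C T) i)"
  shows "decides holds0 e (v i)"
  using tab0_covers[OF assms(2,3)] covers_decides assms(1) order_trans by blast

lemma input_decides:
  assumes "1 \<le> w" "i < length (fst C)" "fst C ! i = Input"
  shows "decides holds0 (input_entry T i) (v i)"
  using covers_input[OF assms(2,3)] covers_decides[of "{i}"] assms by (simp add: inputs_def)

lemma tab1_decides:
  "2 ^ h \<le> w \<Longrightarrow> i < length (fst C) \<Longrightarrow> e \<in> set (look (tab1 h C T) i) \<Longrightarrow> decides holds1 e (v i)"
proof (induction h arbitrary: i e)
  case 0
  then show ?case using input_decides[of i]
    by (auto simp: look_build decides_def holds1_def split: if_splits)
next
  case (Suc h)
  let ?g = "fst C ! i"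
  have w: "2 ^ h \<le> w" using Suc.prems(1) by simp
  then have w1: "1 \<le> w" using one_le_power[of "2 :: nat" h] by linarith
  show ?case
  proof (cases "?g = Input")
    case True
    then show ?thesis using input_decides[of i] w1 Suc.prems
      by (auto simp: look_build decides_def holds1_def)
  next
    case False
    have less: "j < length (fst C)" if "j \<in> set (preds ?g)" for j
      using preds_less[OF wf Suc.prems(2) that] Suc.prems(2) by simp
    have "decides holds1 e (gate_value v ?g)"
    proof (cases "large ?g")
      case True
      then show ?thesis using Suc.prems False
        by (intro large_entry_decides[where holds = holds0 and tab = "tab0 h C T"
              and cl = "\<lambda>ys. ys" and dl = "\<lambda>ys. [concat ys]"] tab0_decides w less)
          (auto simp: look_build holds1_def holds0_def)
    next
      case small: False
      show ?thesis using Suc.prems False small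
        by (intro small_entry_decides[where tab = "tab1 h C T" and cj = "(@)" and dj = distrib]
              Suc.IH w less indegree[OF wf Suc.prems(2)])
          (simp_all add: look_build holds1_distrib holds1_append)
    qed
    then show ?thesis unfolding value_node[OF Suc.prems(2) False] .
  qed
qed

lemma tab2_decides:
  "2 ^ h \<le> w \<Longrightarrow> i < length (fst C) \<Longrightarrow> e \<in> set (look (tab2 h C T) i) \<Longrightarrow> decides holds2 e (v i)"
proof (induction h arbitrary: i e)
  case 0
  then show ?case using input_decides[of i]
    by (auto simp: look_build decides_def holds2_def holds1_def split: if_splits)
next
  case (Suc h)
  let ?g = "fst C ! i"
  have w: "2 ^ h \<le> w" using Suc.prems(1) by simp
  then have w1: "1 \<le> w" using one_le_power[of "2 :: nat" h] by linarith
  show ?case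
  proof (cases "?g = Input")
    case True
    then show ?thesis using input_decides[of i] w1 Suc.prems
      by (auto simp: look_build decides_def holds2_def holds1_def)
  next
    case False
    have less: "j < length (fst C)" if "j \<in> set (preds ?g)" for j
      using preds_less[OF wf Suc.prems(2) that] Suc.prems(2) by simp
    have "decides holds2 e (gate_value v ?g)"
    proof (cases "large ?g")
      case True
      then show ?thesis using Suc.prems False
        by (intro large_entry_decides[where holds = holds1 and tab = "tab1 h C T"
              and cl = "\<lambda>ys. [concat ys]" and dl = "\<lambda>ys. ys"] tab1_decides w less)
          (auto simp: look_build holds2_def holds1_def)
    next
      case small: False
      show ?thesis using Suc.prems False small
        by (intro small_entry_decides[where tab = "tab2 h C T" and cj = distrib and dj = "(@)"]
              Suc.IH w less indegree[OF wf Suc.prems(2)])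
          (auto simp: look_build holds2_def holds1_def distrib_def)
    qed
    then show ?thesis unfolding value_node[OF Suc.prems(2) False] .
  qed
qed

end

subsection \<open>Sequences of gaps\<close>

text \<open>The shifted positions of a set of size \<open>k\<close> in increasing order, with the
  sentinels as terms \<open>0\<close> and \<open>k + 1\<close>.\<close>

definition chain :: "circuit \<Rightarrow> nat \<Rightarrow> (nat \<Rightarrow> nat) \<Rightarrow> bool" where
  "chain C k a \<longleftrightarrow> a 0 = 0 \<and> a (Suc k) = Suc (length (fst C)) \<and> (\<forall>r \<le> k. a r < a (Suc r)) \<and>
     (\<forall>r. 1 \<le> r \<and> r \<le> k \<longrightarrow> a r \<in> Suc ` inputs C)"

definition gaps :: "nat \<Rightarrow> (nat \<Rightarrow> nat) \<Rightarrow> letter set" where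
  "gaps k a = (\<lambda>r. (r, a r, a (Suc r))) ` {..k}"

definition chosen :: "nat \<Rightarrow> (nat \<Rightarrow> nat) \<Rightarrow> nat set" where
  "chosen k a = {j. Suc j \<in> a ` {1..k}}"

lemma chosenI: "r \<noteq> 0 \<Longrightarrow> r \<le> k \<Longrightarrow> a r = Suc j \<Longrightarrow> j \<in> chosen k a"
  unfolding chosen_def by (auto intro!: rev_image_eqI[of r])

lemma finite_inputs: "finite (inputs C)"
  unfolding inputs_def by simp

lemma set_input_positions: "set (input_positions C) = Suc ` inputs C"
  unfolding input_positions_def set_map set_filter set_enumerate0 inputs_def tag_eq by force

lemma letters_product: "letters k C = filter (\<lambda>l. lo l < hi l \<and> (fst l = 0 \<longleftrightarrow> lo l = 0) \<and>
       (fst l = k \<longleftrightarrow> hi l = Suc (length (fst C))))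
     (List.product [0..<Suc k] (List.product (0 # input_positions C)
        (input_positions C @ [Suc (length (fst C))])))"
proof -
  have "concat (map (\<lambda>r. concat (map (\<lambda>a. map (\<lambda>b. (r, a, b)) B) A)) R) =
    List.product R (List.product A B)" for A B R :: "nat list"
    by (simp add: product_concat_map map_concat comp_def)
  then show ?thesis unfolding letters_def by (simp only:)
qed

lemma in_letters: "l \<in> set (letters k C) \<longleftrightarrow> fst l \<le> k \<and> (lo l = 0 \<or> lo l \<in> Suc ` inputs C) \<and>
    (hi l \<in> Suc ` inputs C \<or> hi l = Suc (length (fst C))) \<and> lo l < hi l \<and> (fst l = 0 \<longleftrightarrow> lo l = 0) \<and>
    (fst l = k \<longleftrightarrow> hi l = Suc (length (fst C)))"
  unfolding letters_product
  by (cases l) (simp add: set_input_positions less_Suc_eq_le del: upt_Suc, blast)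

text \<open>Counting needs this: without repetitions, different indices carry different
  tuples.\<close>

lemma distinct_letters: "distinct (letters k C)"
proof -
  have "map (\<lambda>p. Suc (fst p)) (enumerate 0 (fst C)) = map Suc [0..<length (fst C)]"
    by (simp flip: map_map[of Suc fst, unfolded comp_def])
  then have "distinct (map (\<lambda>p. Suc (fst p)) (enumerate 0 (fst C)))"
    by (simp add: distinct_map)
  then have d: "distinct (input_positions C)"
    unfolding input_positions_def by (rule distinct_map_filter)
  have "Suc (length (fst C)) \<notin> Suc ` inputs C" "0 \<notin> Suc ` inputs C"
    by (auto simp: inputs_def)
  then show ?thesis
    unfolding letters_product using d
    by (intro distinct_filter distinct_product) (simp_all add: set_input_positions del: upt_Suc)
qed

lemma chain_mono:
  assumes "chain C k a" "r < r'" "r' \<le> Suc k"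
  shows "a r < a r'"
  using assms(2,3)
proof (induction r')
  case (Suc r')
  have "a r' < a (Suc r')" using assms(1) Suc.prems by (simp add: chain_def)
  then show ?case using Suc by (cases "r = r'") auto
qed simp

text \<open>A discrete intermediate value argument, from the sentinel \<open>0\<close> up to the
  sentinel beyond \<open>p\<close>.\<close>

lemma chain_locate:
  assumes "chain C k a" "p \<le> length (fst C)"
  shows "\<exists>r \<le> k. a r \<le> p \<and> p < a (Suc r)"
proof -
  have "p < a m \<Longrightarrow> \<exists>r < m. a r \<le> p \<and> p < a (Suc r)" for m
  proof (induction m)
    case 0
    then show ?case using assms(1) by (simp add: chain_def)
  next
    case (Suc m)
    show ?case
    proof (cases "p < a m")
      case True
      then obtain r where "r < m" "a r \<le> p \<and> p < a (Suc r)" using Suc.IH by blast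
      then show ?thesis by (intro exI[of _ r]) simp
    next
      case False
      then show ?thesis using Suc.prems by (intro exI[of _ m]) simp
    qed
  qed
  moreover have "p < a (Suc k)" using assms by (simp add: chain_def)
  ultimately obtain r where "r < Suc k" "a r \<le> p \<and> p < a (Suc r)" by blast
  then show ?thesis by (intro exI[of _ r]) simp
qed

lemma chain_inj:
  assumes "chain C k a"
  shows "inj_on a {..Suc k}"
proof (rule inj_onI)
  fix x y assume "x \<in> {..Suc k}" "y \<in> {..Suc k}" "a x = a y"
  then show "x = y"
    using chain_mono[OF assms, of x y] chain_mono[OF assms, of y x] by (cases x y rule: linorder_cases) simp_all
qed

lemma chosen_inputs:
  assumes "chain C k a"
  shows "chosen k a \<subseteq> inputs C"
proof
  fix j assume "j \<in> chosen k a"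
  then obtain r where "Suc j = a r" "1 \<le> r" "r \<le> k" by (auto simp: chosen_def)
  then have "Suc j \<in> Suc ` inputs C" using assms by (simp add: chain_def)
  then show "j \<in> inputs C" by auto
qed

lemma card_chosen:
  assumes "chain C k a"
  shows "card (chosen k a) = k"
proof -
  have "Suc ` chosen k a = a ` {1..k}"
  proof
    show "a ` {1..k} \<subseteq> Suc ` chosen k a"
    proof
      fix p assume p: "p \<in> a ` {1..k}"
      then obtain r where "p = a r" "1 \<le> r" "r \<le> k" by auto
      then obtain j where "p = Suc j" using assms unfolding chain_def by blast
      then show "p \<in> Suc ` chosen k a" using p by (simp add: chosen_def)
    qed
  qed (auto simp: chosen_def)
  then have "card (chosen k a) = card (a ` {1..k})" using card_image[of Suc "chosen k a"] by simp
  also have "\<dots> = card {1..k}"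
    by (rule card_image, rule inj_on_subset[OF chain_inj[OF assms]]) auto
  finally show ?thesis by simp
qed

lemma exists_chain:
  assumes "A \<subseteq> inputs C" "card A = k"
  shows "\<exists>a. chain C k a \<and> chosen k a = A"
proof -
  have fin: "finite A" using assms(1) finite_inputs finite_subset by blast
  define xs where "xs = sorted_list_of_set A"
  have xs: "set xs = A" "length xs = k" "sorted_wrt (<) xs"
    using fin assms(2) by (simp_all add: xs_def)
  let ?n = "length (fst C)"
  define ys where "ys = 0 # map Suc xs @ [Suc ?n]"
  have len: "length ys = Suc (Suc k)" using xs by (simp add: ys_def)
  have srt: "sorted_wrt (<) ys"
    using xs assms(1) by (auto simp: ys_def sorted_wrt_append sorted_wrt_map inputs_def)
  have mid: "ys ! r = Suc (xs ! (r - 1))" if "1 \<le> r" "r \<le> k" for r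
    using that xs by (cases r) (simp_all add: ys_def nth_append)
  define a where "a r = ys ! r" for r
  have im: "a ` {1..k} = Suc ` A"
  proof
    show "a ` {1..k} \<subseteq> Suc ` A" using mid xs by (auto simp: a_def)
    show "Suc ` A \<subseteq> a ` {1..k}"
    proof
      fix p assume "p \<in> Suc ` A"
      then obtain i where "i < k" "p = Suc (xs ! i)" using xs by (auto simp: in_set_conv_nth)
      then have "p = a (Suc i)" "Suc i \<in> {1..k}" using mid[of "Suc i"] by (auto simp: a_def)
      then show "p \<in> a ` {1..k}" by blast
    qed
  qed
  have "chain C k a"
    unfolding chain_def
  proof (intro conjI allI impI)
    show "a 0 = 0" by (simp add: a_def ys_def)
    show "a (Suc k) = Suc ?n" using xs by (simp add: a_def ys_def nth_append)
    show "a r < a (Suc r)" if "r \<le> k" for r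
      unfolding a_def by (rule sorted_wrt_nth_less[OF srt]) (use that len in auto)
    show "a r \<in> Suc ` inputs C" if "1 \<le> r \<and> r \<le> k" for r
    proof -
      have "a r \<in> a ` {1..k}" using that by simp
      then show ?thesis unfolding im using assms(1) by auto
    qed
  qed
  moreover have "chosen k a = A" unfolding chosen_def im by auto
  ultimately show ?thesis by blast
qed

lemma gaps_letters: "chain C k a \<Longrightarrow> gaps k a \<subseteq> set (letters k C)"
proof
  fix l assume a: "chain C k a" and "l \<in> gaps k a"
  then obtain r where l: "l = (r, a r, a (Suc r))" "r \<le> k" by (auto simp: gaps_def)
  have 1: "a r < a (Suc r)" using a l by (simp add: chain_def)
  have 2: "r = 0 \<longleftrightarrow> a r = 0"
    using a chain_mono[OF a, of 0 r] l(2) by (cases "r = 0") (auto simp: chain_def)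
  have 3: "r = k \<longleftrightarrow> a (Suc r) = Suc (length (fst C))"
    using a chain_mono[OF a, of "Suc r" "Suc k"] l(2) by (cases "r = k") (auto simp: chain_def)
  have 4: "a r = 0 \<or> a r \<in> Suc ` inputs C"
    using a l(2) unfolding chain_def by (cases "r = 0") simp_all
  have 5: "a (Suc r) \<in> Suc ` inputs C \<or> a (Suc r) = Suc (length (fst C))"
    using a l(2) unfolding chain_def by (cases "r = k") simp_all
  show "l \<in> set (letters k C)" unfolding in_letters l(1) fst_conv snd_conv using 1 2 3 4 5 l(2) by blast
qed

lemma card_gaps: "card (gaps k a) = Suc k"
  unfolding gaps_def by (subst card_image) (auto simp: inj_on_def)

lemma gaps_compatible: "l \<in> gaps k a \<Longrightarrow> m \<in> gaps k a \<Longrightarrow> compatible l m"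
  unfolding gaps_def compatible_def by auto

text \<open>Gap letters tell the truth about the chosen set: a nonzero left end is a chosen
  position, and no term of an increasing sequence lies strictly between two consecutive ones.
  Conversely, each input has a gap that attests it, and up to \<open>w\<close> of these fit into one
  tuple.\<close>

lemma world_of_chain:
  assumes wf: "wf_circuit C" and a: "chain C k a" and v: "node_values C (chosen k a) v" and w: "1 \<le> w"
  defines "t \<equiv> List.n_lists w (letters k C)"
  shows "world C (chosen k a) v (enumerate 0 t) {i. i < length t \<and> set (t ! i) \<subseteq> gaps k a} w"
proof
  let ?X = "{i. i < length t \<and> set (t ! i) \<subseteq> gaps k a}"
  show "wf_circuit C" "node_values C (chosen k a) v" by fact+
  have gap: "l \<in> gaps k a" if "(i, u) \<in> set (enumerate 0 t)" "i \<in> ?X" "l \<in> set u" for i u l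
    using that by (auto simp: in_set_enumerate_eq)
  show "j \<in> chosen k a"
    if h: "(i, u) \<in> set (enumerate 0 t)" "i \<in> ?X" "l \<in> set u" "lo l = Suc j" for i u l j
  proof -
    obtain r where r: "l = (r, a r, a (Suc r))" "r \<le> k" using gap[OF h(1-3)] by (auto simp: gaps_def)
    then have "a r = Suc j" using h(4) by simp
    moreover from this have "r \<noteq> 0" using a by (cases r) (auto simp: chain_def)
    ultimately show ?thesis using r(2) by (intro chosenI[of r])
  qed
  show "j \<notin> chosen k a"
    if h: "(i, u) \<in> set (enumerate 0 t)" "i \<in> ?X" "l \<in> set u" "lo l < Suc j" "Suc j < hi l" for i u l j
  proof
    assume "j \<in> chosen k a"
    then obtain r' where r': "Suc j = a r'" "r' \<le> k" by (auto simp: chosen_def)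
    obtain r where r: "l = (r, a r, a (Suc r))" "r \<le> k" using gap[OF h(1-3)] by (auto simp: gaps_def)
    have j: "a r < a r'" "a r' < a (Suc r)" using h(4,5) r r' by simp_all
    consider "r' \<le> r" | "Suc r \<le> r'" by linarith
    then show False
    proof cases
      case 1
      then show False using j(1) chain_mono[OF a, of r' r] r(2) by (cases "r' = r") auto
    next
      case 2
      then show False using j(2) chain_mono[OF a, of "Suc r" r'] r'(2) by (cases "Suc r = r'") auto
    qed
  qed
  fix J assume J: "J \<subseteq> inputs C" "card J \<le> w"
  let ?P = "\<lambda>j l. if j \<in> chosen k a then lo l = Suc j else lo l < Suc j \<and> Suc j < hi l"
  have "\<exists>l \<in> gaps k a. ?P j l" if "j \<in> J" for j
  proof (cases "j \<in> chosen k a")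
    case True
    then obtain r where "Suc j = a r" "r \<le> k" by (auto simp: chosen_def)
    then show ?thesis using True by (intro bexI[of _ "(r, a r, a (Suc r))"]) (auto simp: gaps_def)
  next
    case False
    have "Suc j \<le> length (fst C)" using that J by (auto simp: inputs_def)
    then obtain r where r: "r \<le> k" "a r \<le> Suc j" "Suc j < a (Suc r)" using chain_locate[OF a] by blast
    have "a r \<noteq> Suc j"
    proof
      assume e: "a r = Suc j"
      then have "r \<noteq> 0" using a by (cases r) (auto simp: chain_def)
      then have "j \<in> chosen k a" using r(1) e by (intro chosenI[of r])
      then show False using False by blast
    qed
    then show ?thesis using False r by (intro bexI[of _ "(r, a r, a (Suc r))"]) (auto simp: gaps_def)
  qed
  then obtain L where L: "\<And>j. j \<in> J \<Longrightarrow> L j \<in> gaps k a \<and> ?P j (L j)" by metis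
  have fin: "finite J" using J(1) finite_inputs finite_subset by blast
  \<comment> \<open>One attesting gap per input in \<open>J\<close>, padded to length
    \<open>w\<close> by the gap with number \<open>0\<close>, which always exists.\<close>
  define u where "u = map L (sorted_list_of_set J) @ replicate (w - card J) (0, a 0, a 1)"
  have "(0, a 0, a 1) \<in> gaps k a" unfolding gaps_def by force
  then have u: "set u \<subseteq> gaps k a" "length u = w" "L ` J \<subseteq> set u"
    using L fin J(2) by (auto simp: u_def)
  then have "u \<in> set t"
    unfolding t_def set_n_lists using gaps_letters[OF a] by blast
  then obtain i where i: "i < length t" "t ! i = u" by (auto simp: in_set_conv_nth)
  show "\<exists>(i, u) \<in> set (enumerate 0 t). i \<in> ?X \<and> (\<forall>j \<in> J. if j \<in> chosen k a
      then \<exists>l \<in> set u. lo l = Suc j else \<exists>l \<in> set u. lo l < Suc j \<and> Suc j < hi l)"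
  proof (rule bexI[of _ "(i, u)"], unfold case_prod_conv, intro conjI ballI)
    show "(i, u) \<in> set (enumerate 0 t)" using i by (simp add: in_set_enumerate_eq)
    show "i \<in> ?X" using i u(1) by simp
    fix j assume "j \<in> J"
    then have "L j \<in> set u" "?P j (L j)" using L u(3) by auto
    then show "if j \<in> chosen k a
      then \<exists>l \<in> set u. lo l = Suc j else \<exists>l \<in> set u. lo l < Suc j \<and> Suc j < hi l"
      by (auto split: if_splits)
  qed
qed

text \<open>Evaluation in topological order: when node \<open>n\<close> receives its value, no
  earlier node refers to it.\<close>

lemma node_values_exist:
  assumes wf: "wf_circuit C"
  shows "\<exists>v. node_values C A v"
proof -
  let ?eq = "\<lambda>v i. v i \<longleftrightarrow> (case fst C ! i of Input \<Rightarrow> i \<in> A | Neg j \<Rightarrow> \<not> v j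
      | Conj js \<Rightarrow> (\<forall>j \<in> set js. v j) | Disj js \<Rightarrow> (\<exists>j \<in> set js. v j))"
  have "n \<le> length (fst C) \<Longrightarrow> \<exists>v. \<forall>i < n. ?eq v i" for n
  proof (induction n)
    case (Suc n)
    then obtain v where v: "\<forall>i < n. ?eq v i" by auto
    let ?v = "v(n := (case fst C ! n of Input \<Rightarrow> n \<in> A | Neg j \<Rightarrow> \<not> v j
      | Conj js \<Rightarrow> (\<forall>j \<in> set js. v j) | Disj js \<Rightarrow> (\<exists>j \<in> set js. v j)))"
    have "?eq ?v i" if i: "i < Suc n" for i
    proof -
      have "j < n" if "j \<in> set (preds (fst C ! i))" for j
        using preds_less[OF wf _ that] i Suc.prems by simp
      then have same: "\<And>j. j \<in> set (preds (fst C ! i)) \<Longrightarrow> ?v j = v j" by fastforce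
      have "?v i \<longleftrightarrow> (case fst C ! i of Input \<Rightarrow> i \<in> A | Neg j \<Rightarrow> \<not> v j
        | Conj js \<Rightarrow> (\<forall>j \<in> set js. v j) | Disj js \<Rightarrow> (\<exists>j \<in> set js. v j))"
      proof (cases "i = n")
        case True
        show ?thesis unfolding True by simp
      next
        case False
        then show ?thesis using v i by simp
      qed
      also have "\<dots> \<longleftrightarrow> (case fst C ! i of Input \<Rightarrow> i \<in> A | Neg j \<Rightarrow> \<not> ?v j
        | Conj js \<Rightarrow> (\<forall>j \<in> set js. ?v j) | Disj js \<Rightarrow> (\<exists>j \<in> set js. ?v j))"
        using same by (cases "fst C ! i") (simp_all del: fun_upd_apply)
      finally show ?thesis .
    qed
    then show ?case by (intro exI[of _ ?v]) blast
  qed simp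
  from this[of "length (fst C)"] show ?thesis unfolding node_values_def by simp
qed

subsection \<open>Correctness of the instances\<close>

text \<open>Doubling in arithmetic form: vertex \<open>x\<close> is a copy of the tuple with index
  \<open>x div 2\<close>, and parity tells the two copies apart.\<close>

lemma named_enumerate:
  "named (enumerate 0 t) = map (\<lambda>x. (x, t ! (x div 2))) [0..<2 * length t]"
proof (induction t rule: rev_induct)
  case Nil
  then show ?case by (simp add: named_def)
next
  case (snoc u t)
  let ?n = "length t"
  have "named (enumerate 0 (t @ [u])) = named (enumerate 0 t) @ [(?n + ?n, u), (Suc (?n + ?n), u)]"
    by (simp add: enumerate_append_eq named_def)
  also have "named (enumerate 0 t) = map (\<lambda>x. (x, (t @ [u]) ! (x div 2))) [0..<2 * ?n]"
    unfolding snoc by (auto simp: nth_append)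
  also have "\<dots> @ [(?n + ?n, u), (Suc (?n + ?n), u)] =
      map (\<lambda>x. (x, (t @ [u]) ! (x div 2))) ([0..<2 * ?n] @ [2 * ?n, Suc (2 * ?n)])"
    by (simp add: mult_2)
  also have "[0..<2 * ?n] @ [2 * ?n, Suc (2 * ?n)] = [0..<2 * length (t @ [u])]"
    by simp
  finally show ?case .
qed

lemma names: "map fst (named (enumerate 0 t)) = [0..<2 * length t]"
  by (simp add: named_enumerate comp_def)

lemma edges_of_single: "edges_of [(x, y)] = {{x, y}}"
  by (auto simp: edges_of_def)

lemma edges_of_matching: "edges_of (map (\<lambda>i. (i + i, Suc (i + i))) c) = (\<lambda>i. {2 * i, Suc (2 * i)}) ` set c"
  by (auto simp: edges_of_def image_iff mult_2)

lemma set_conflict_samples: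
  "set (conflict_samples (enumerate 0 t)) = {([(x, y)], True) | x y. x < 2 * length t \<and> y < 2 * length t \<and>
     x \<noteq> y \<and> conflict (t ! (x div 2)) (t ! (y div 2))}"
proof -
  have N: "set (named (enumerate 0 t)) = (\<lambda>x. (x, t ! (x div 2))) ` {x. x < 2 * length t}"
    unfolding named_enumerate by auto
  show ?thesis unfolding conflict_samples_def by (auto simp: N image_iff)
qed

lemma set_clause_samples:
  "set (clause_samples (enumerate 0 t) cs) =
    (\<lambda>c. (map (\<lambda>i. (i + i, Suc (i + i))) (filter (\<lambda>i. i < length t) c), False)) ` set cs"
proof -
  have "set (map fst (enumerate 0 t)) = {i. i < length t}" by auto
  then show ?thesis unfolding clause_samples_def set_map[of "\<lambda>c. (_ c, False)"] by simp
qed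

lemma IS_instance_inst:
  "IS_instance 1 (map fst (named (enumerate 0 t)))
     (conflict_samples (enumerate 0 t) @ clause_samples (enumerate 0 t) cs)"
proof -
  let ?V = "{0..<2 * length t}"
  have single: "is_graph ?V (edges_of [(x, y)]) \<and> max_degree_at_most 1 ?V (edges_of [(x, y)])"
    if "x < 2 * length t" "y < 2 * length t" "x \<noteq> y" for x y
  proof
    show "is_graph ?V (edges_of [(x, y)])"
      unfolding edges_of_single is_graph_def using that by simp
    have "card {e \<in> {{x, y}}. v \<in> e} \<le> card {{x, y}}" for v by (rule card_mono) auto
    then show "max_degree_at_most 1 ?V (edges_of [(x, y)])"
      unfolding edges_of_single max_degree_at_most_def by simp
  qed
  have matching: "is_graph ?V (edges_of (map (\<lambda>i. (i + i, Suc (i + i))) c)) \<and>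
      max_degree_at_most 1 ?V (edges_of (map (\<lambda>i. (i + i, Suc (i + i))) c))"
    if "\<forall>i \<in> set c. i < length t" for c
  proof
    show "is_graph ?V (edges_of (map (\<lambda>i. (i + i, Suc (i + i))) c))"
      unfolding edges_of_matching is_graph_def using that by force
    have "{e \<in> (\<lambda>i. {2 * i, Suc (2 * i)}) ` set c. v \<in> e} \<subseteq> {{2 * (v div 2), Suc (2 * (v div 2))}}" for v
      by auto
    then have "card {e \<in> (\<lambda>i. {2 * i, Suc (2 * i)}) ` set c. v \<in> e} \<le>
        card {{2 * (v div 2), Suc (2 * (v div 2))}}" for v
      by (intro card_mono) simp_all
    then show "max_degree_at_most 1 ?V (edges_of (map (\<lambda>i. (i + i, Suc (i + i))) c))"
      unfolding edges_of_matching max_degree_at_most_def by simp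
  qed
  have "is_graph ?V (edges_of es) \<and> max_degree_at_most 1 ?V (edges_of es)"
    if es: "(es, l) \<in> set (conflict_samples (enumerate 0 t) @ clause_samples (enumerate 0 t) cs)" for es l
  proof -
    consider x y where "es = [(x, y)]" "x < 2 * length t" "y < 2 * length t" "x \<noteq> y"
      | c where "es = map (\<lambda>i. (i + i, Suc (i + i))) (filter (\<lambda>i. i < length t) c)"
      using es unfolding set_append set_conflict_samples set_clause_samples by blast
    then show ?thesis
    proof cases
      case 1
      then show ?thesis using single by simp
    next
      case 2
      show ?thesis unfolding 2 by (rule matching) simp
    qed
  qed
  then show ?thesis unfolding IS_instance_def names set_upt by auto
qed

lemma independent_single:
  "x \<noteq> y \<Longrightarrow> independent_set V (edges_of [(x, y)]) S \<longleftrightarrow> S \<subseteq> V \<and> \<not> (x \<in> S \<and> y \<in> S)"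
  unfolding independent_set_def edges_of_single by (auto simp: doubleton_eq_iff)

lemma independent_matching:
  "independent_set V (edges_of (map (\<lambda>i. (i + i, Suc (i + i))) c)) S \<longleftrightarrow>
    S \<subseteq> V \<and> \<not> (\<exists>i \<in> set c. 2 * i \<in> S \<and> Suc (2 * i) \<in> S)"
proof -
  have "(\<forall>u \<in> S. \<forall>v \<in> S. {u, v} \<notin> (\<lambda>i. {2 * i, Suc (2 * i)}) ` set c) \<longleftrightarrow>
    \<not> (\<exists>i \<in> set c. 2 * i \<in> S \<and> Suc (2 * i) \<in> S)"
    by (auto simp: image_iff doubleton_eq_iff)
  then show ?thesis unfolding independent_set_def edges_of_matching by simp
qed

text \<open>Removes the graphs: label \<open>True\<close> on one edge forbids a pair of vertices,
  and label \<open>False\<close> on a part of the matching demands that both copies of some listed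
  tuple be chosen.\<close>

lemma IS_solution_inst:
  "IS_solution K (map fst (named (enumerate 0 t)))
     (conflict_samples (enumerate 0 t) @ clause_samples (enumerate 0 t) cs) S \<longleftrightarrow>
   S \<subseteq> {0..<2 * length t} \<and> card S = K \<and>
   (\<forall>x \<in> S. \<forall>y \<in> S. x \<noteq> y \<longrightarrow> \<not> conflict (t ! (x div 2)) (t ! (y div 2))) \<and>
   (\<forall>c \<in> set cs. \<exists>i \<in> set c. 2 * i \<in> S \<and> Suc (2 * i) \<in> S)" (is "?L \<longleftrightarrow> ?R")
proof (cases "S \<subseteq> {0..<2 * length t}")
  case False
  then show ?thesis unfolding IS_solution_def names set_upt by simp
next
  case True
  let ?V = "{0..<2 * length t}"
  let ?ok = "\<lambda>p. independent_set ?V (edges_of (fst p)) S \<longleftrightarrow> snd p"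
  have inV: "x < 2 * length t" if "x \<in> S" for x using True that by auto
  have lt: "i < length t" if "2 * i \<in> S" for i using inV[OF that] by simp
  have "(\<forall>p \<in> set (conflict_samples (enumerate 0 t)). ?ok p) \<longleftrightarrow>
    (\<forall>x y. x < 2 * length t \<and> y < 2 * length t \<and> x \<noteq> y \<and> conflict (t ! (x div 2)) (t ! (y div 2)) \<longrightarrow>
      ?ok ([(x, y)], True))"
    unfolding set_conflict_samples by blast
  also have "\<dots> \<longleftrightarrow> (\<forall>x y. x < 2 * length t \<and> y < 2 * length t \<and> x \<noteq> y \<and>
      conflict (t ! (x div 2)) (t ! (y div 2)) \<longrightarrow> \<not> (x \<in> S \<and> y \<in> S))"
    using True by (simp add: independent_single)
  also have "\<dots> \<longleftrightarrow> (\<forall>x \<in> S. \<forall>y \<in> S. x \<noteq> y \<longrightarrow> \<not> conflict (t ! (x div 2)) (t ! (y div 2)))"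
    using inV by blast
  finally have 1: "(\<forall>p \<in> set (conflict_samples (enumerate 0 t)). ?ok p) \<longleftrightarrow>
    (\<forall>x \<in> S. \<forall>y \<in> S. x \<noteq> y \<longrightarrow> \<not> conflict (t ! (x div 2)) (t ! (y div 2)))" .
  have "?ok (map (\<lambda>i. (i + i, Suc (i + i))) (filter (\<lambda>i. i < length t) c), False) \<longleftrightarrow>
    (\<exists>i \<in> set c. 2 * i \<in> S \<and> Suc (2 * i) \<in> S)" for c
    unfolding fst_conv snd_conv independent_matching using True lt by auto
  then have 2: "(\<forall>p \<in> set (clause_samples (enumerate 0 t) cs). ?ok p) \<longleftrightarrow>
    (\<forall>c \<in> set cs. \<exists>i \<in> set c. 2 * i \<in> S \<and> Suc (2 * i) \<in> S)"
    unfolding set_clause_samples by simp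
  have "?L \<longleftrightarrow> S \<subseteq> ?V \<and> card S = K \<and>
    (\<forall>p \<in> set (conflict_samples (enumerate 0 t)) \<union> set (clause_samples (enumerate 0 t) cs). ?ok p)"
    unfolding IS_solution_def names set_upt set_append by (simp only: case_prod_unfold)
  then show ?thesis unfolding ball_Un 1 2 .
qed

text \<open>Take both copies of every tuple of gaps. There are \<open>k + 1\<close> gaps and they
  are pairwise compatible, so neither size nor conflicts are violated.\<close>

lemma solution_of_chain:
  fixes w k :: nat
  assumes a: "chain C k a"
  defines "t \<equiv> List.n_lists w (letters k C)"
  defines "X \<equiv> {i. i < length t \<and> set (t ! i) \<subseteq> gaps k a}"
  assumes cs: "\<forall>c \<in> set cs. \<exists>i \<in> set c. i \<in> X"
  shows "\<exists>S. IS_solution (2 * Suc k ^ w) (map fst (named (enumerate 0 t)))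
     (conflict_samples (enumerate 0 t) @ clause_samples (enumerate 0 t) cs) S"
proof -
  define S where "S = (\<lambda>i. 2 * i) ` X \<union> (\<lambda>i. Suc (2 * i)) ` X"
  have fin: "finite X" unfolding X_def by simp
  have S: "x div 2 \<in> X" if "x \<in> S" for x using that by (auto simp: S_def)
  have dt: "distinct t" unfolding t_def by (intro distinct_n_lists distinct_letters)
  have "(!) t ` X = {u. set u \<subseteq> gaps k a \<and> length u = w}"
  proof
    show "(!) t ` X \<subseteq> {u. set u \<subseteq> gaps k a \<and> length u = w}"
    proof
      fix u assume "u \<in> (!) t ` X"
      then obtain i where "i < length t" "set (t ! i) \<subseteq> gaps k a" "u = t ! i" by (auto simp: X_def)
      moreover from this have "u \<in> set t" by simp
      ultimately show "u \<in> {u. set u \<subseteq> gaps k a \<and> length u = w}" by (simp add: t_def set_n_lists)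
    qed
    show "{u. set u \<subseteq> gaps k a \<and> length u = w} \<subseteq> (!) t ` X"
    proof
      fix u assume u: "u \<in> {u. set u \<subseteq> gaps k a \<and> length u = w}"
      then have "u \<in> set t" unfolding t_def set_n_lists using gaps_letters[OF a] by blast
      then obtain i where "i < length t" "u = t ! i" by (auto simp: in_set_conv_nth)
      then show "u \<in> (!) t ` X" using u by (auto simp: X_def)
    qed
  qed
  moreover have "inj_on ((!) t) X"
    using dt by (intro inj_onI) (simp add: X_def nth_eq_iff_index_eq)
  ultimately have "card X = card {u. set u \<subseteq> gaps k a \<and> length u = w}"
    using card_image by metis
  also have "\<dots> = Suc k ^ w"
    by (subst card_lists_length_eq) (simp_all add: card_gaps, simp add: gaps_def)
  finally have cX: "card X = Suc k ^ w" .
  have disj: "(\<lambda>i. 2 * i) ` X \<inter> (\<lambda>i. Suc (2 * i)) ` X = {}"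
  proof -
    have "2 * i \<noteq> Suc (2 * j)" for i j :: nat by presburger
    then show ?thesis by blast
  qed
  have "card ((\<lambda>i. 2 * i) ` X) = card X" "card ((\<lambda>i. Suc (2 * i)) ` X) = card X"
    by (rule card_image, simp add: inj_on_def)+
  then have cS: "card S = 2 * Suc k ^ w"
    unfolding S_def using fin disj by (simp add: card_Un_disjoint cX)
  have "IS_solution (2 * Suc k ^ w) (map fst (named (enumerate 0 t)))
     (conflict_samples (enumerate 0 t) @ clause_samples (enumerate 0 t) cs) S"
    unfolding IS_solution_inst
  proof (intro conjI ballI impI)
    show "S \<subseteq> {0..<2 * length t}"
    proof
      fix x assume "x \<in> S"
      then have "x div 2 < length t" using S by (simp add: X_def)
      then show "x \<in> {0..<2 * length t}" by (simp add: div_less_iff_less_mult mult.commute)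
    qed
    show "card S = 2 * Suc k ^ w" by (rule cS)
    show "\<not> conflict (t ! (x div 2)) (t ! (y div 2))" if "x \<in> S" "y \<in> S" for x y
    proof -
      have "set (t ! (x div 2)) \<subseteq> gaps k a" "set (t ! (y div 2)) \<subseteq> gaps k a"
        using S[OF that(1)] S[OF that(2)] by (simp_all add: X_def)
      then show ?thesis unfolding conflict_def using gaps_compatible by blast
    qed
    show "\<exists>i \<in> set c. 2 * i \<in> S \<and> Suc (2 * i) \<in> S" if c: "c \<in> set cs" for c
    proof -
      obtain i where "i \<in> set c" "i \<in> X" using cs c by blast
      then show ?thesis by (intro bexI[of _ i]) (simp_all add: S_def)
    qed
  qed
  then show ?thesis ..
qed

text \<open>Gap numbers act as colours: two letters of equal colour are compatible only if they are
  identical.\<close>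

lemma eq_if_same_colours:
  assumes "map fst u = map fst u'" "\<not> conflict u u'"
  shows "u = u'"
proof (rule nth_equalityI)
  show len: "length u = length u'" using assms(1) map_eq_imp_length_eq by blast
  fix i assume i: "i < length u"
  then have "compatible (u ! i) (u' ! i)" using assms(2) len by (simp add: conflict_def)
  moreover have "fst (u ! i) = fst (u' ! i)"
    using arg_cong[OF assms(1), of "\<lambda>xs. xs ! i"] i len by simp
  ultimately show "u ! i = u' ! i" by (simp add: compatible_def)
qed

text \<open>By pigeonhole. A vertex of a solution is determined by its colour tuple and its parity,
  and the solution size equals the number of such pairs, so every colour tuple occurs in both
  copies. All letters that occur then agree pairwise and form a single sequence of gaps.\<close>

lemma chain_of_solution:
  fixes w k :: nat and C :: circuit
  assumes w: "1 \<le> w"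
  defines "t \<equiv> List.n_lists w (letters k C)"
  assumes sol: "IS_solution (2 * Suc k ^ w) (map fst (named (enumerate 0 t)))
     (conflict_samples (enumerate 0 t) @ clause_samples (enumerate 0 t) cs) S"
  shows "\<exists>a. chain C k a \<and> (\<forall>c \<in> set cs. \<exists>i \<in> set c. i < length t \<and> set (t ! i) \<subseteq> gaps k a)"
proof -
  have S: "S \<subseteq> {0..<2 * length t}" and cS: "card S = 2 * Suc k ^ w"
    and nc: "\<And>x y. x \<in> S \<Longrightarrow> y \<in> S \<Longrightarrow> x \<noteq> y \<Longrightarrow> \<not> conflict (t ! (x div 2)) (t ! (y div 2))"
    and cl: "\<And>c. c \<in> set cs \<Longrightarrow> \<exists>i \<in> set c. 2 * i \<in> S \<and> Suc (2 * i) \<in> S"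
    using sol unfolding IS_solution_inst by blast+
  have dt: "distinct t" unfolding t_def by (intro distinct_n_lists distinct_letters)
  have half: "x div 2 < length t" if "x \<in> S" for x using S that by auto
  have word: "length (t ! (x div 2)) = w" "set (t ! (x div 2)) \<subseteq> set (letters k C)" if "x \<in> S" for x
    using nth_mem[OF half[OF that]] unfolding t_def set_n_lists by auto
  define \<tau> where "\<tau> x = map fst (t ! (x div 2))" for x
  have \<tau>: "x div 2 = y div 2" if "x \<in> S" "y \<in> S" "\<tau> x = \<tau> y" for x y
  proof (cases "x = y")
    case False
    then have "t ! (x div 2) = t ! (y div 2)"
      using eq_if_same_colours nc that unfolding \<tau>_def by blast
    then show ?thesis using dt half that by (simp add: nth_eq_iff_index_eq)
  qed simp
  let ?Ty = "{ts. set ts \<subseteq> {..k} \<and> length ts = w}"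
  let ?f = "\<lambda>x. (\<tau> x, x mod 2)"
  have "?f ` S = ?Ty \<times> {0, 1}"
  proof (rule card_seteq)
    show "finite (?Ty \<times> {0, 1 :: nat})" by (intro finite_cartesian_product finite_lists_length_eq) simp_all
    show "?f ` S \<subseteq> ?Ty \<times> {0, 1}"
    proof
      fix p assume "p \<in> ?f ` S"
      then obtain x where x: "x \<in> S" "p = ?f x" by blast
      have "fst l \<le> k" if "l \<in> set (t ! (x div 2))" for l
        using word(2)[OF x(1)] that unfolding subset_iff in_letters by blast
      then have "set (\<tau> x) \<subseteq> {..k}" unfolding \<tau>_def by auto
      moreover have "length (\<tau> x) = w" using word(1)[OF x(1)] by (simp add: \<tau>_def)
      ultimately have "\<tau> x \<in> ?Ty" by blast
      moreover have "x mod 2 \<in> {0, 1}" using mod_less_divisor[of 2 x] by auto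
      ultimately show "p \<in> ?Ty \<times> {0, 1}" unfolding x(2) by (rule SigmaI)
    qed
    have "inj_on ?f S"
    proof (rule inj_onI)
      fix x y assume xy: "x \<in> S" "y \<in> S" "?f x = ?f y"
      have "\<tau> x = \<tau> y" and m: "x mod 2 = y mod 2" using xy(3) by (simp_all only: prod.inject)
      then have "x div 2 = y div 2" using \<tau> xy by blast
      then show "x = y" using m by (metis div_mult_mod_eq)
    qed
    then have "card (?f ` S) = 2 * Suc k ^ w" using card_image cS by metis
    moreover have "card ?Ty = Suc k ^ w" by (subst card_lists_length_eq) simp_all
    ultimately show "card (?Ty \<times> {0, 1 :: nat}) \<le> card (?f ` S)"
      by (simp add: card_cartesian_product)
  qed
  then have full: "\<exists>x \<in> S. \<tau> x = ts \<and> x mod 2 = b" if "ts \<in> ?Ty" "b = 0 \<or> b = 1" for ts b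
  proof -
    have "(ts, b) \<in> ?Ty \<times> {0, 1}" using that by auto
    then have "(ts, b) \<in> ?f ` S" using \<open>?f ` S = ?Ty \<times> {0, 1}\<close> by simp
    then show ?thesis by auto
  qed
  have \<tau>_Ty: "\<tau> x \<in> ?Ty" if "x \<in> S" for x
  proof -
    have "?f x \<in> ?Ty \<times> {0, 1}" using \<open>?f ` S = ?Ty \<times> {0, 1}\<close> that by blast
    then show ?thesis by simp
  qed
  define Z where "Z = (\<Union>x \<in> S. set (t ! (x div 2)))"
  have Z_letters: "l \<in> set (letters k C)" if "l \<in> Z" for l using that word(2) unfolding Z_def by blast
  have compat: "compatible l m" if lm: "l \<in> Z" "m \<in> Z" for l m
  proof -
    obtain x y where x: "x \<in> S" "l \<in> set (t ! (x div 2))" and y: "y \<in> S" "m \<in> set (t ! (y div 2))"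
      using lm unfolding Z_def by blast
    show ?thesis
    proof (cases "x = y")
      case False
      then show ?thesis using nc[OF x(1) y(1)] x(2) y(2) unfolding conflict_def by blast
    next
      case True
      \<comment> \<open>Two letters of the same tuple: its other copy belongs to \<open>S\<close>
        too, and the absence of conflicts between the copies compares the tuple with itself.\<close>
      have b: "1 - y mod 2 = 0 \<or> 1 - y mod 2 = 1" by linarith
      obtain y' where y': "y' \<in> S" "\<tau> y' = \<tau> y" "y' mod 2 = 1 - y mod 2"
        using full[OF \<tau>_Ty[OF y(1)], of "1 - y mod 2"] b by blast
      then have "y' div 2 = y div 2" using \<tau> y(1) by blast
      moreover have "x \<noteq> y'"
      proof
        assume "x = y'"
        then show False using y'(3) True by presburger
      qed
      ultimately show ?thesis using nc[OF x(1) y'(1)] x(2) y(2) unfolding conflict_def by auto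
    qed
  qed
  have "\<exists>l \<in> Z. fst l = r" if "r \<le> k" for r
  proof -
    \<comment> \<open>The tuple with constant colour \<open>r\<close> exhibits a letter of that
      colour; \<open>1 \<le> w\<close> ensures that it has one.\<close>
    have "replicate w r \<in> ?Ty" using that by auto
    then obtain x where x: "x \<in> S" "\<tau> x = replicate w r" using full[of _ 0] by blast
    then have "t ! (x div 2) \<noteq> []" using word(1)[OF x(1)] w by auto
    then obtain l where l: "l \<in> set (t ! (x div 2))" by (meson ex_in_conv set_empty)
    then have "fst l \<in> set (\<tau> x)" unfolding \<tau>_def by simp
    then have "fst l = r" using x(2) by simp
    then show ?thesis using l x(1) unfolding Z_def by blast
  qed
  then obtain L where L: "\<And>r. r \<le> k \<Longrightarrow> L r \<in> Z \<and> fst (L r) = r" by metis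
  define a where "a r = (if r \<le> k then lo (L r) else Suc (length (fst C)))" for r
  have LL: "L r \<in> set (letters k C)" "fst (L r) = r" if "r \<le> k" for r
    using L[OF that] Z_letters by blast+
  have nxt: "a (Suc r) = hi (L r)" if "r \<le> k" for r
  proof (cases "r = k")
    case True
    then have "hi (L r) = Suc (length (fst C))" using LL[OF that] in_letters by blast
    then show ?thesis using True by (simp add: a_def)
  next
    case False
    then have "Suc r \<le> k" using that by simp
    then have "compatible (L r) (L (Suc r))" using compat L that by blast
    then show ?thesis using LL(2)[OF that] LL(2)[OF \<open>Suc r \<le> k\<close>] \<open>Suc r \<le> k\<close>
      by (simp add: compatible_def a_def)
  qed
  have ch: "chain C k a"
    unfolding chain_def
  proof (intro conjI allI impI)
    have "lo (L 0) = 0" using LL[of 0] in_letters by blast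
    then show "a 0 = 0" by (simp add: a_def)
    show "a (Suc k) = Suc (length (fst C))" by (simp add: a_def)
    show "a r < a (Suc r)" if "r \<le> k" for r
    proof -
      have "lo (L r) < hi (L r)" using LL[OF that] in_letters by blast
      then show ?thesis using nxt[OF that] that by (simp add: a_def)
    qed
    show "a r \<in> Suc ` inputs C" if "1 \<le> r \<and> r \<le> k" for r
    proof -
      have "r \<le> k" "fst (L r) \<noteq> 0" using that LL(2)[of r] by auto
      then have "lo (L r) \<in> Suc ` inputs C" using LL(1)[of r] unfolding in_letters by simp
      then show ?thesis using that by (simp add: a_def)
    qed
  qed
  \<comment> \<open>A letter compatible with the representative of its own colour coincides with
    it.\<close>
  have "Z \<subseteq> gaps k a"
  proof
    fix l assume l: "l \<in> Z"
    then have r: "fst l \<le> k" using Z_letters in_letters by blast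
    have "compatible l (L (fst l))" using compat l L[OF r] by blast
    then have e: "L (fst l) = l" using L[OF r] by (simp add: compatible_def)
    have "a (fst l) = lo l" "a (Suc (fst l)) = hi l" using nxt[OF r] r e by (simp_all add: a_def)
    then show "l \<in> gaps k a"
      unfolding gaps_def using r by (intro image_eqI[of _ _ "fst l"]) simp_all
  qed
  moreover have "\<exists>i \<in> set c. i < length t \<and> set (t ! i) \<subseteq> Z" if c: "c \<in> set cs" for c
  proof -
    obtain i where i: "i \<in> set c" "2 * i \<in> S" using cl[OF c] by blast
    have "i < length t" using half[OF i(2)] by simp
    moreover have "set (t ! i) \<subseteq> Z" unfolding Z_def using i(2) by force
    ultimately show ?thesis using i(1) by blast
  qed
  ultimately have "\<forall>c \<in> set cs. \<exists>i \<in> set c. i < length t \<and> set (t ! i) \<subseteq> gaps k a"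
    by (meson order_trans)
  then show ?thesis using ch by blast
qed

definition solvable :: "IS_inst \<Rightarrow> bool" where
  "solvable p \<longleftrightarrow> (\<exists>X. IS_solution (fst p) (fst (snd (snd p))) (snd (snd (snd p))) X)"

text \<open>An instance is solvable iff the gaps of some set of \<open>k\<close> inputs satisfy its
  disjunct, and by \<open>dec\<close> the output is true for such a set iff some disjunct is
  satisfied. The weft and depth bounds amount to the existence of an entry for the output.\<close>

lemma circuit_instances_correct:
  assumes wf: "wf_circuit C"
  shows "(\<exists>p \<in> set (circuit_instances d (C, k)). solvable p) \<longleftrightarrow>
    weft_at_most 2 C \<and> depth_at_most d C \<and> (\<exists>A. A \<subseteq> inputs C \<and> card A = k \<and> satisfied_by C A)"
proof -
  define w where "w = (2 :: nat) ^ d"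
  have w: "1 \<le> w" by (simp add: w_def)
  define t where "t = List.n_lists w (letters k C)"
  define E where "E = look (tab2 d C (enumerate 0 t)) (snd C)"
  have out: "snd C < length (fst C)" using wf by (auto simp: wf_circuit_def split: prod.splits)
  have E: "E = [] \<longleftrightarrow> \<not> (weft_at_most 2 C \<and> depth_at_most d C)"
    unfolding E_def tab2_empty[OF wf out] shallow_iff[OF wf] ..
  have ci: "set (circuit_instances d (C, k)) = inst w k (enumerate 0 t) ` (\<Union>e \<in> set E. set (fst e))"
    using wf by (simp add: circuit_instances_def E_def w_def t_def verts_def)
  have dec: "decides (world.holds2 {i. i < length t \<and> set (t ! i) \<subseteq> gaps k a}) e (v (snd C))"
    if "chain C k a" "node_values C (chosen k a) v" "e \<in> set E" for a v e
  proof -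
    interpret world C "chosen k a" v "enumerate 0 t" "{i. i < length t \<and> set (t ! i) \<subseteq> gaps k a}" w
      unfolding t_def by (rule world_of_chain[OF wf that(1,2) w])
    show ?thesis using tab2_decides[of d] out that(3) unfolding E_def w_def by simp
  qed
  show ?thesis
  proof
    assume "\<exists>p \<in> set (circuit_instances d (C, k)). solvable p"
    then obtain e cs where e: "e \<in> set E" "cs \<in> set (fst e)"
      and sol: "solvable (inst w k (enumerate 0 t) cs)"
      unfolding ci by blast
    have wd: "weft_at_most 2 C \<and> depth_at_most d C" using E e(1) by auto
    obtain a where a: "chain C k a"
      "\<forall>c \<in> set cs. \<exists>i \<in> set c. i < length t \<and> set (t ! i) \<subseteq> gaps k a"
      using chain_of_solution[OF w] sol unfolding solvable_def inst_def fst_conv snd_conv t_def by blast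
    obtain v where v: "node_values C (chosen k a) v" using node_values_exist[OF wf] by blast
    interpret world C "chosen k a" v "enumerate 0 t" "{i. i < length t \<and> set (t ! i) \<subseteq> gaps k a}" w
      unfolding t_def by (rule world_of_chain[OF wf a(1) v w])
    have "holds1 cs" using a(2) unfolding holds1_def holds0_def by simp
    then have "holds2 (fst e)" using e(2) unfolding holds2_def by blast
    then have "v (snd C)" using dec[OF a(1) v e(1)] unfolding decides_def by blast
    then have "satisfied_by C (chosen k a)" unfolding satisfied_by_def using v by blast
    then show "weft_at_most 2 C \<and> depth_at_most d C \<and> (\<exists>A. A \<subseteq> inputs C \<and> card A = k \<and> satisfied_by C A)"
      using wd chosen_inputs[OF a(1)] card_chosen[OF a(1)] by blast
  next
    assume R: "weft_at_most 2 C \<and> depth_at_most d C \<and> (\<exists>A. A \<subseteq> inputs C \<and> card A = k \<and> satisfied_by C A)"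
    then obtain A v where A: "A \<subseteq> inputs C" "card A = k" "node_values C A v" "v (snd C)"
      unfolding satisfied_by_def by blast
    obtain a where a: "chain C k a" "chosen k a = A" using exists_chain[OF A(1,2)] by blast
    have v: "node_values C (chosen k a) v" using A(3) a(2) by simp
    interpret world C "chosen k a" v "enumerate 0 t" "{i. i < length t \<and> set (t ! i) \<subseteq> gaps k a}" w
      unfolding t_def by (rule world_of_chain[OF wf a(1) v w])
    have "E \<noteq> []" using E R by simp
    then obtain e where e: "e \<in> set E" by (meson ex_in_conv set_empty)
    have "holds2 (fst e)" using dec[OF a(1) v e] A(4) unfolding decides_def by simp
    then obtain cs where cs: "cs \<in> set (fst e)" "holds1 cs" unfolding holds2_def by blast
    have "\<forall>c \<in> set cs. \<exists>i \<in> set c. i \<in> {i. i < length t \<and> set (t ! i) \<subseteq> gaps k a}"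
      using cs(2) unfolding holds1_def holds0_def .
    then have "solvable (inst w k (enumerate 0 t) cs)"
      unfolding solvable_def inst_def fst_conv snd_conv t_def by (rule solution_of_chain[OF a(1)])
    then show "\<exists>p \<in> set (circuit_instances d (C, k)). solvable p"
      unfolding ci using e cs(1) by blast
  qed
qed

lemma instances_correct: "(\<exists>p \<in> set (instances d (x, k)). solvable p) \<longleftrightarrow> (x, k) \<in> WCS 2 d"
proof (cases "is_circuit x")
  case True
  then obtain C :: circuit where x: "x = enc C" unfolding is_circuit_iff by blast
  have inst: "instances d (x, k) = circuit_instances d (C, k)"
    using True by (simp add: instances_def x inj_enc)
  have W: "(x, k) \<in> WCS 2 d \<longleftrightarrow> wf_circuit C \<and> weft_at_most 2 C \<and> depth_at_most d C \<and>
    (\<exists>A. A \<subseteq> inputs C \<and> card A = k \<and> satisfied_by C A)" (is "_ \<longleftrightarrow> ?R C")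
  proof
    assume "(x, k) \<in> WCS 2 d"
    then obtain C' where "x = enc C'" "?R C'" unfolding WCS_def enc_circuit_eq by blast
    then show "?R C" using x by simp
  next
    assume "?R C"
    then show "(x, k) \<in> WCS 2 d" unfolding WCS_def enc_circuit_eq x by blast
  qed
  show ?thesis
  proof (cases "wf_circuit C")
    case True
    then show ?thesis unfolding inst W circuit_instances_correct[OF True] by simp
  next
    case False
    then show ?thesis unfolding inst W by (simp add: circuit_instances_def)
  qed
next
  case False
  then have "x \<noteq> enc C" for C :: circuit unfolding is_circuit_iff by blast
  then have "(x, k) \<notin> WCS 2 d" unfolding WCS_def enc_circuit_eq by blast
  then show ?thesis using False by (simp add: instances_def)
qed

text \<open>Keeps the parameter of every instance a function of \<open>k\<close> and
  \<open>d\<close> alone, and licenses calling the given algorithm on it.\<close>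

lemma instances_valid:
  assumes "p \<in> set (instances d (x, k))"
  shows "fst p = 2 * Suc k ^ (2 ^ d) \<and> fst (snd p) = 1 \<and>
    IS_instance (fst (snd p)) (fst (snd (snd p))) (snd (snd (snd p)))"
proof -
  have "\<exists>cs. p = inst (2 ^ d) k (verts (2 ^ d) k (inv enc x)) cs"
    using assms by (auto simp: instances_def circuit_instances_def split: if_splits)
  then show ?thesis using IS_instance_inst by (auto simp: inst_def verts_def)
qed

section \<open>Fixed-parameter tractability\<close>

subsection \<open>Computable bounds\<close>

lemma computable_iff: "computable f \<longleftrightarrow> (\<exists>T. computes (\<lambda>_. True) f T)"
proof
  assume "computable f"
  then obtain p where "\<forall>n. \<exists>t. runs p (enc n) t (enc (f n))"
    unfolding computable_def enc_nat_simp by blast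
  then obtain T where "\<And>n. runs p (enc n) (T n) (enc (f n))" by metis
  then have "\<exists>t \<le> T n. runs p (enc n) t (enc (f n))" for n by blast
  then show "\<exists>T. computes (\<lambda>_. True) f T" using computes_of_runs[of "\<lambda>_. True" T p f] by blast
next
  assume "\<exists>T. computes (\<lambda>_. True) f T"
  then show "computable f"
    using runs_of_computes[of "\<lambda>_. True" f] unfolding computable_def enc_nat_simp by blast
qed

lemma computable_of_ptime: "ptime f \<Longrightarrow> computable f"
  unfolding computable_iff ptime_on_def by blast

lemma computable_comp: "computable f \<Longrightarrow> computable g \<Longrightarrow> computable (\<lambda>n. f (g n))"
  unfolding computable_iff using computes_comp[of "\<lambda>_. True" g _ "\<lambda>_. True" f] by blast

lemma computable_comp2:
  assumes "ptime (\<lambda>p. h (fst p) (snd p))" "computable f" "computable g"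
  shows "computable (\<lambda>n. h (f n) (g n))"
proof -
  obtain T U V where "computes (\<lambda>_. True) f T" "computes (\<lambda>_. True) g U"
    "computes (\<lambda>_. True) (\<lambda>p. h (fst p) (snd p)) V"
    using assms unfolding computable_iff ptime_on_def by blast
  then have "computes (\<lambda>_. True) (\<lambda>n. h (fst (f n, g n)) (snd (f n, g n)))
      (\<lambda>n. 1 + (20 + 2 * T n + 2 * U n + 2 * tsize (enc n) + 3 * tsize (enc (f n)) + 2 * tsize (enc (g n))) + V (f n, g n))"
    by (intro computes_comp[OF computes_pair]) simp_all
  then show ?thesis unfolding computable_iff by auto
qed

lemma computable_add: "computable f \<Longrightarrow> computable g \<Longrightarrow> computable (\<lambda>n. f n + g n)"
  by (rule computable_comp2[where h = "(+)"]) (intro pt)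

lemma computable_mult: "computable f \<Longrightarrow> computable g \<Longrightarrow> computable (\<lambda>n. f n * g n)"
  by (rule computable_comp2[where h = "(*)"]) (intro pt)

text \<open>Supplies a monotone computable majorant of a function that need not be monotone.\<close>

lemma computable_sum:
  assumes "computable f"
  shows "computable (\<lambda>n. \<Sum>i \<le> n. f i)"
proof -
  let ?S = "\<lambda>p :: nat \<times> nat \<times> nat. snd (snd p) + f (fst (snd p))"
  obtain T where T: "computes (\<lambda>_. True) f T" using assms unfolding computable_iff by blast
  have p: "ptime (\<lambda>p :: nat \<times> nat \<times> nat. fst (snd p))" "ptime (\<lambda>p :: nat \<times> nat \<times> nat. snd (snd p))"
    "ptime (\<lambda>p :: nat \<times> nat. fst p + snd p)" "ptime (\<lambda>n :: nat. [0..<Suc n])" "ptime (\<lambda>n :: nat. 0 :: nat)"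
    by (intro pt)+
  obtain T1 T2 T3 TL TI where T':
    "computes (\<lambda>_. True) (\<lambda>p :: nat \<times> nat \<times> nat. fst (snd p)) T1"
    "computes (\<lambda>_. True) (\<lambda>p :: nat \<times> nat \<times> nat. snd (snd p)) T2"
    "computes (\<lambda>_. True) (\<lambda>p :: nat \<times> nat. fst p + snd p) T3"
    "computes (\<lambda>_. True) (\<lambda>n :: nat. [0..<Suc n]) TL" "computes (\<lambda>_. True) (\<lambda>n :: nat. 0 :: nat) TI"
    using p unfolding ptime_on_def by blast
  have "\<exists>TS. computes (\<lambda>_. True) ?S TS"
    using computes_comp[OF computes_pair[OF T'(2) computes_comp[OF T'(1) T]] T'(3)] by auto
  then obtain TS where S: "computes (\<lambda>_. True) ?S TS" by blast
  let ?A = "\<lambda>x m. foldl (\<lambda>acc a. ?S (x, a, acc)) 0 (take m [0..<Suc x])"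
  \<comment> \<open>Any bound will do here, so sums over all iterations stand in for maxima; they do
    not have to be computable.\<close>
  let ?B = "\<lambda>x. \<Sum>m \<le> length [0..<Suc x]. TS (x, [0..<Suc x] ! m, ?A x m)"
  let ?Z = "\<lambda>x. \<Sum>m \<le> length [0..<Suc x]. tsize (enc (?A x m))"
  have "\<exists>c. computes (\<lambda>_. True) (\<lambda>x. foldl (\<lambda>acc a. ?S (x, a, acc)) 0 [0..<Suc x])
    (\<lambda>x. c * (TL x + TI x + tsize (enc [0..<Suc x]) * (tsize (enc [0..<Suc x]) + tsize (enc x) + ?Z x + ?B x + 1)))"
  proof (rule computes_foldl[OF S T'(4) T'(5)])
    show "TS (x, [0..<Suc x] ! m, ?A x m) \<le> ?B x" if "m < length [0..<Suc x]" for x m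
      by (rule member_le_sum) (use that in simp_all)
    show "tsize (enc (?A x m)) \<le> ?Z x" if "m \<le> length [0..<Suc x]" for x m
      by (rule member_le_sum) (use that in simp_all)
  qed simp
  moreover have "foldl (\<lambda>acc a. ?S (x, a, acc)) 0 [0..<Suc n] = (\<Sum>i \<le> n. f i)" for x n
    by (induction n) simp_all
  ultimately show ?thesis unfolding computable_iff by (simp only:) blast
qed

section \<open>Fixed-parameter time bounds\<close>

definition fbounded :: "(tree \<times> nat \<Rightarrow> nat) \<Rightarrow> bool" where
  "fbounded T \<longleftrightarrow> (\<exists>f c. computable f \<and> (\<forall>y. T y \<le> f (snd y) * tsize (enc y) ^ c))"

lemma fbounded_mono: "fbounded T \<Longrightarrow> (\<And>y. U y \<le> T y) \<Longrightarrow> fbounded U"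
  unfolding fbounded_def by (meson order_trans)

lemma fbounded_param: "computable f \<Longrightarrow> fbounded (\<lambda>y. f (snd y))"
  unfolding fbounded_def by (intro exI[of _ f] exI[of _ 0]) simp

lemma fbounded_const: "fbounded (\<lambda>y. c)"
  using fbounded_param[of "\<lambda>_. c"] computable_of_ptime[OF ptime_const] by simp

lemma fbounded_size: "fbounded (\<lambda>y. tsize (enc y))"
  unfolding fbounded_def
  by (intro exI[of _ "\<lambda>_. 1"] exI[of _ 1]) (simp add: computable_of_ptime[OF ptime_const])

lemma fbounded_add:
  assumes "fbounded T" "fbounded U" shows "fbounded (\<lambda>y. T y + U y)"
proof -
  obtain f c g d where f: "computable f" "\<And>y. T y \<le> f (snd y) * tsize (enc y) ^ c"
    and g: "computable g" "\<And>y. U y \<le> g (snd y) * tsize (enc y) ^ d"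
    using assms unfolding fbounded_def by blast
  have "T y + U y \<le> (f (snd y) + g (snd y)) * tsize (enc y) ^ (c + d)" for y
    using order_trans[OF f(2) poly_weaken[of "f (snd y)" "f (snd y)" c "c + d" "enc y"]]
      order_trans[OF g(2) poly_weaken[of "g (snd y)" "g (snd y)" d "c + d" "enc y"]]
    by (simp add: distrib_right)
  then show ?thesis unfolding fbounded_def using computable_add[OF f(1) g(1)] by blast
qed

lemma fbounded_mult:
  assumes "fbounded T" "fbounded U" shows "fbounded (\<lambda>y. T y * U y)"
proof -
  obtain f c g d where f: "computable f" "\<And>y. T y \<le> f (snd y) * tsize (enc y) ^ c"
    and g: "computable g" "\<And>y. U y \<le> g (snd y) * tsize (enc y) ^ d"
    using assms unfolding fbounded_def by blast
  have "T y * U y \<le> (f (snd y) * g (snd y)) * tsize (enc y) ^ (c + d)" for y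
    using mult_le_mono[OF f(2) g(2), of y y] by (simp add: power_add mult_ac)
  then show ?thesis unfolding fbounded_def using computable_mult[OF f(1) g(1)] by blast
qed

lemma fbounded_power: "fbounded T \<Longrightarrow> fbounded (\<lambda>y. T y ^ n)"
  by (induction n) (simp_all add: fbounded_const fbounded_mult)

lemmas fbounded_intros =
  fbounded_const fbounded_size fbounded_add fbounded_mult fbounded_power

lemma fbounded_pbounded_comp:
  assumes "pbounded (\<lambda>_. True) U" "fbounded (\<lambda>y. tsize (enc (R y)))"
  shows "fbounded (\<lambda>y. U (R y))"
proof -
  obtain c where c: "\<And>x. U x \<le> c * tsize (enc x) ^ c" using assms(1) unfolding pbounded_def by blast
  have "fbounded (\<lambda>y. c * tsize (enc (R y)) ^ c)" by (intro fbounded_intros assms(2))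
  then show ?thesis by (rule fbounded_mono) (rule c)
qed

lemma FPT_iff: "L \<in> FPT \<longleftrightarrow> (\<exists>T. computes (\<lambda>_. True) (\<lambda>y. y \<in> L) T \<and> fbounded T)"
proof
  assume "L \<in> FPT"
  then obtain p f c where f: "computable f"
    and p: "\<And>x k. \<exists>t \<le> f k * tsize (Node x (enc_nat k)) ^ c. runs p (Node x (enc_nat k)) t (enc_bool ((x, k) \<in> L))"
    unfolding FPT_def by blast
  let ?T = "\<lambda>y. f (snd y) * tsize (enc y) ^ c"
  have "\<exists>t \<le> ?T y. runs p (enc y) t (enc (y \<in> L))" for y
    using p[of "snd y" "fst y"] by (cases y) simp
  then obtain b where "computes (\<lambda>_. True) (\<lambda>y. y \<in> L) (\<lambda>y. ?T y + b)"
    using computes_of_runs[of "\<lambda>_. True" ?T p "\<lambda>y. y \<in> L"] by blast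
  moreover have "fbounded (\<lambda>y. ?T y + b)" by (intro fbounded_intros fbounded_param f)
  ultimately show "\<exists>T. computes (\<lambda>_. True) (\<lambda>y. y \<in> L) T \<and> fbounded T" by blast
next
  assume "\<exists>T. computes (\<lambda>_. True) (\<lambda>y. y \<in> L) T \<and> fbounded T"
  then obtain T f c where T: "computes (\<lambda>_. True) (\<lambda>y. y \<in> L) T"
    and f: "computable f" "\<And>y. T y \<le> f (snd y) * tsize (enc y) ^ c"
    unfolding fbounded_def by blast
  obtain p where p: "\<And>y. \<exists>t \<le> T y. runs p (enc y) t (enc (y \<in> L))"
    using runs_of_computes[OF T] by blast
  have "\<exists>t \<le> f k * tsize (Node x (enc_nat k)) ^ c. runs p (Node x (enc_nat k)) t (enc_bool ((x, k) \<in> L))" for x k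
  proof -
    obtain t where "t \<le> T (x, k)" "runs p (enc (x, k)) t (enc ((x, k) \<in> L))" using p by blast
    then show ?thesis using order_trans[OF _ f(2)[of "(x, k)"]] by (intro exI[of _ t]) simp
  qed
  then show "L \<in> FPT" unfolding FPT_def using f(1) by blast
qed

text \<open>The definition only asserts that suitable outputs exist. Selecting one for every input
  yields the function \<open>R\<close>, which the same program computes.\<close>

lemma fpt_reducible_iff: "fpt_reducible A B \<longleftrightarrow> (\<exists>R T g. computes (\<lambda>_. True) R T \<and> fbounded T \<and>
   computable g \<and> (\<forall>y. snd (R y) \<le> g (snd y) \<and> (y \<in> A \<longleftrightarrow> R y \<in> B)))"
proof
  assume "fpt_reducible A B"
  then obtain p f g c where f: "computable f" and g: "computable g"
    and p: "\<And>x k. \<exists>x' k'. \<exists>t \<le> f k * tsize (Node x (enc_nat k)) ^ c.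
        runs p (Node x (enc_nat k)) t (Node x' (enc_nat k')) \<and> k' \<le> g k \<and> ((x, k) \<in> A \<longleftrightarrow> (x', k') \<in> B)"
    unfolding fpt_reducible_def by blast
  let ?T = "\<lambda>y. f (snd y) * tsize (enc y) ^ c"
  have "\<exists>z. (\<exists>t \<le> ?T y. runs p (enc y) t (enc z)) \<and> snd z \<le> g (snd y) \<and> (y \<in> A \<longleftrightarrow> z \<in> B)" for y
  proof -
    obtain x k where y: "y = (x, k)" by (cases y)
    obtain x' k' t where "t \<le> f k * tsize (Node x (enc_nat k)) ^ c"
      "runs p (Node x (enc_nat k)) t (Node x' (enc_nat k'))" "k' \<le> g k" "(x, k) \<in> A \<longleftrightarrow> (x', k') \<in> B"
      using p[of k x] by blast
    then show ?thesis unfolding y by (intro exI[of _ "(x', k')"]) auto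
  qed
  then obtain R where R: "\<And>y. \<exists>t \<le> ?T y. runs p (enc y) t (enc (R y))"
    "\<And>y. snd (R y) \<le> g (snd y) \<and> (y \<in> A \<longleftrightarrow> R y \<in> B)" by metis
  obtain b where "computes (\<lambda>_. True) R (\<lambda>y. ?T y + b)"
    using computes_of_runs[of "\<lambda>_. True" ?T p R] R(1) by blast
  moreover have "fbounded (\<lambda>y. ?T y + b)" by (intro fbounded_intros fbounded_param f)
  ultimately show "\<exists>R T g. computes (\<lambda>_. True) R T \<and> fbounded T \<and>
     computable g \<and> (\<forall>y. snd (R y) \<le> g (snd y) \<and> (y \<in> A \<longleftrightarrow> R y \<in> B))"
    using g R(2) by blast
next
  assume "\<exists>R T g. computes (\<lambda>_. True) R T \<and> fbounded T \<and>
     computable g \<and> (\<forall>y. snd (R y) \<le> g (snd y) \<and> (y \<in> A \<longleftrightarrow> R y \<in> B))"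
  then obtain R T g f c where T: "computes (\<lambda>_. True) R T" and g: "computable g"
    and R: "\<And>y. snd (R y) \<le> g (snd y) \<and> (y \<in> A \<longleftrightarrow> R y \<in> B)"
    and f: "computable f" "\<And>y. T y \<le> f (snd y) * tsize (enc y) ^ c"
    unfolding fbounded_def by blast
  obtain p where p: "\<And>y. \<exists>t \<le> T y. runs p (enc y) t (enc (R y))"
    using runs_of_computes[OF T] by blast
  have "\<exists>x' k'. \<exists>t \<le> f k * tsize (Node x (enc_nat k)) ^ c.
        runs p (Node x (enc_nat k)) t (Node x' (enc_nat k')) \<and> k' \<le> g k \<and> ((x, k) \<in> A \<longleftrightarrow> (x', k') \<in> B)" for x k
  proof -
    obtain t where t: "t \<le> T (x, k)" "runs p (enc (x, k)) t (enc (R (x, k)))" using p by blast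
    obtain x' k' where z: "R (x, k) = (x', k')" by (cases "R (x, k)")
    have "t \<le> f k * tsize (Node x (enc_nat k)) ^ c" using order_trans[OF t(1) f(2)] by simp
    moreover have "runs p (Node x (enc_nat k)) t (Node x' (enc_nat k'))" using t(2) z by simp
    moreover have "k' \<le> g k \<and> ((x, k) \<in> A \<longleftrightarrow> (x', k') \<in> B)" using R[of "(x, k)"] z by simp
    ultimately show ?thesis by blast
  qed
  then show "fpt_reducible A B" unfolding fpt_reducible_def using f(1) g by blast
qed

text \<open>Decide the problem, then output a fixed instance with the same answer: for the circuit
  whose only node is both input and output, weight \<open>1\<close> satisfies it and weight
  \<open>0\<close> does not.\<close>

lemma FPT_subset_W2: "FPT \<subseteq> W_class 2"
proof
  fix L assume "L \<in> FPT"
  then obtain T where T: "computes (\<lambda>_. True) (\<lambda>y. y \<in> L) T" "fbounded T" unfolding FPT_iff by blast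
  let ?C = "([Input], 0) :: circuit"
  let ?h = "\<lambda>b. (enc ?C, if b then 1 else 0 :: nat)"
  have wf: "wf_circuit ?C" by (simp add: wf_circuit_def indegree_ok_def)
  have wd: "weft_at_most 2 ?C \<and> depth_at_most 1 ?C" by (simp flip: shallow_iff[OF wf])
  have sat: "satisfied_by ?C A \<longleftrightarrow> 0 \<in> A" for A
    by (auto simp: satisfied_by_def node_values_def)
  have inp: "inputs ?C = {0}" by (auto simp: inputs_def)
  have yes: "(enc ?C, 1) \<in> WCS 2 1"
  proof -
    have "{0} \<subseteq> inputs ?C \<and> card {0 :: nat} = 1 \<and> satisfied_by ?C {0}" using sat inp by simp
    then show ?thesis unfolding WCS_def enc_circuit_eq using wf wd by blast
  qed
  have no: "(enc ?C, 0) \<notin> WCS 2 1"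
  proof
    assume "(enc ?C, 0) \<in> WCS 2 1"
    then obtain C A where C: "enc ?C = enc C" "A \<subseteq> inputs C" "card A = 0" "satisfied_by C A"
      unfolding WCS_def enc_circuit_eq by blast
    then have "C = ?C" unfolding enc_inject by simp
    then have "finite A" "0 \<in> A" using C sat inp finite_subset[of A "{0}"] by auto
    then show False using C(3) by auto
  qed
  have "ptime ?h" by (intro pt)
  then obtain U where U: "computes (\<lambda>_. True) ?h U" "pbounded (\<lambda>_. True) U" unfolding ptime_on_def by blast
  have "fbounded (\<lambda>y. tsize (enc (y \<in> L)))"
    by (rule fbounded_mono[OF fbounded_const[of 3]]) (case_tac "y \<in> L"; simp)
  then have "fbounded (\<lambda>y. 1 + T y + U (y \<in> L))"
    by (intro fbounded_intros T(2) fbounded_pbounded_comp[OF U(2)])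
  moreover have "computes (\<lambda>_. True) (\<lambda>y. ?h (y \<in> L)) (\<lambda>y. 1 + T y + U (y \<in> L))"
    by (rule computes_comp[OF T(1) U(1)]) simp
  moreover have "snd (?h (y \<in> L)) \<le> 1 \<and> (y \<in> L \<longleftrightarrow> ?h (y \<in> L) \<in> WCS 2 1)" for y
    using yes no by (cases "y \<in> L") (simp_all del: enc_simps)
  ultimately have "fpt_reducible L (WCS 2 1)"
    unfolding fpt_reducible_iff
    by (intro exI[of _ "\<lambda>y. ?h (y \<in> L)"] exI[of _ "\<lambda>y. 1 + T y + U (y \<in> L)"] exI[of _ "\<lambda>_. 1"] conjI allI)
      (simp_all add: computable_of_ptime[OF ptime_const])
  then show "L \<in> W_class 2" unfolding W_class_def by blast
qed

subsection \<open>Using an algorithm for consistency checking\<close>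

lemma enc_functions:
  "enc_bool = enc"
  "enc_pair enc enc = (enc :: 'a::enc \<times> 'b::enc \<Rightarrow> tree)"
  "enc_list enc = (enc :: 'a list \<Rightarrow> tree)"
  by (simp_all add: fun_eq_iff enc_prod')

lemma enc_IS_eq: "enc_IS k d vs S = enc (k, d, vs, S)"
  unfolding enc_IS_def enc_nat_eq enc_functions by simp

text \<open>After the reduction to \<open>WCS 2 d\<close>, the algorithm is run on each instance in
  turn and the answers are joined by disjunction. The depth \<open>d\<close> depends on
  \<open>L\<close> only, so \<open>2 ^ d\<close> is a constant here.\<close>

lemma W2_subset_FPT:
  assumes "fpt_algorithm_ConsCheck_IS_degree p"
  shows "W_class 2 \<subseteq> FPT"
proof
  fix L assume "L \<in> W_class 2"
  then obtain d where "fpt_reducible L (WCS 2 d)" unfolding W_class_def by blast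
  then obtain R TR g where R: "computes (\<lambda>_. True) R TR" "fbounded TR" and g: "computable g"
    and Rg: "\<And>y. snd (R y) \<le> g (snd y)" and RL: "\<And>y. y \<in> L \<longleftrightarrow> R y \<in> WCS 2 d"
    unfolding fpt_reducible_iff by blast
  obtain f c where f: "computable f" and alg: "\<And>k d vs S. IS_instance d vs S \<Longrightarrow>
        (\<exists>r. \<exists>t \<le> f (k + d) * tsize (enc_IS k d vs S) ^ c.
           runs p (enc_IS k d vs S) t (enc_option (enc_list enc_nat) r) \<and> correct_IS_output k vs S r)"
    using assms unfolding fpt_algorithm_ConsCheck_IS_degree_def by blast
  define valid where "valid = (\<lambda>q :: IS_inst. IS_instance (fst (snd q)) (fst (snd (snd q))) (snd (snd (snd q))))"
  \<comment> \<open>Only the raw output tree is kept: \<open>None\<close> is encoded as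
    \<open>Atom\<close> and no \<open>Some\<close> is, which is all a decision needs. Outside valid
    instances nothing is known of the program.\<close>
  have "\<exists>z. valid q \<longrightarrow> (\<exists>t \<le> f (fst q + fst (snd q)) * tsize (enc q) ^ c. runs p (enc q) t z) \<and>
     (z \<noteq> Atom \<longleftrightarrow> solvable q)" for q
  proof (cases "valid q")
    case True
    obtain k d' vs S where q: "q = (k, d', vs, S)" by (cases q)
    have "IS_instance d' vs S" using True by (simp add: valid_def q)
    from alg[OF this, of k] obtain r t where r: "t \<le> f (k + d') * tsize (enc q) ^ c"
      "runs p (enc q) t (enc_option (enc_list enc_nat) r)" "correct_IS_output k vs S r"
      unfolding enc_IS_eq q by blast
    have "enc_option (enc_list enc_nat) r \<noteq> Atom \<longleftrightarrow> solvable q"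
      using r(3) by (cases r) (auto simp: correct_IS_output_def solvable_def q)
    then show ?thesis using r(1,2) q by (intro exI[of _ "enc_option (enc_list enc_nat) r"]) auto
  qed simp
  then obtain ans where ans: "\<And>q. valid q \<Longrightarrow> \<exists>t \<le> f (fst q + fst (snd q)) * tsize (enc q) ^ c. runs p (enc q) t (enc (ans q))"
    "\<And>q. valid q \<Longrightarrow> ans q \<noteq> Atom \<longleftrightarrow> solvable q"
    unfolding enc_tree_def by metis
  obtain b where b: "computes valid ans (\<lambda>q. f (fst q + fst (snd q)) * tsize (enc q) ^ c + b)"
    using computes_of_runs[of valid "\<lambda>q. f (fst q + fst (snd q)) * tsize (enc q) ^ c" p ans] ans(1) by blast
  define TA where "TA = (\<lambda>q :: IS_inst. f (fst q + fst (snd q)) * tsize (enc q) ^ c + b)"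
  have A: "computes valid ans TA" using b unfolding TA_def .

  let ?D = "\<lambda>s :: (tree \<times> nat) \<times> IS_inst \<times> bool. valid (fst (snd s))"
  let ?S = "\<lambda>s :: (tree \<times> nat) \<times> IS_inst \<times> bool. snd (snd s) \<or> ans (fst (snd s)) \<noteq> Atom"
  have "ptime_on ?D (\<lambda>s. fst (snd s))" "ptime_on ?D (\<lambda>s. snd (snd s))"
    "ptime (\<lambda>s :: bool \<times> tree. fst s \<or> snd s \<noteq> Atom)"
    by (intro pt)+
  then obtain T1 T2 T3 where T:
    "computes ?D (\<lambda>s. fst (snd s)) T1" "pbounded ?D T1"
    "computes ?D (\<lambda>s. snd (snd s)) T2" "pbounded ?D T2"
    "computes (\<lambda>_. True) (\<lambda>s :: bool \<times> tree. fst s \<or> snd s \<noteq> Atom) T3" "pbounded (\<lambda>_. True) T3"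
    unfolding ptime_on_def by blast
  obtain c1 c2 c3 where c: "\<And>s. ?D s \<Longrightarrow> T1 s \<le> c1 * tsize (enc s) ^ c1" "\<And>s. ?D s \<Longrightarrow> T2 s \<le> c2 * tsize (enc s) ^ c2"
    "\<And>s. T3 s \<le> c3 * tsize (enc s) ^ c3"
    using T(2,4,6) unfolding pbounded_def by blast
  note A' = computes_comp[OF T(1) A, simplified]
  define TS where "TS = (\<lambda>s. 1 + (20 + 2 * T2 s + 2 * (1 + T1 s + TA (fst (snd s))) + 2 * tsize (enc s) +
     3 * tsize (enc (snd (snd s))) + 2 * tsize (enc (ans (fst (snd s))))) + T3 (snd (snd s), ans (fst (snd s))))"
  have S: "computes ?D ?S TS"
    unfolding TS_def using computes_comp[OF computes_pair[OF T(3) A'] T(5)] by simp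
  \<comment> \<open>A majorant of \<open>TS\<close> that is monotone in a size \<open>s\<close> and
    a time \<open>a\<close>, so that one value bounds all steps of the loop.\<close>
  define bound where "bound = (\<lambda>s a. 1 + (20 + 2 * (c2 * s ^ c2) + 2 * (1 + c1 * s ^ c1 + a) + 2 * s + 3 * s +
     2 * (s + a)) + c3 * (4 + s + a) ^ c3 :: nat)"
  have TS: "TS s \<le> bound n a" if s: "?D s" "tsize (enc s) \<le> n" "TA (fst (snd s)) \<le> a" for s n a
  proof -
    have p1: "c1 * tsize (enc s) ^ c1 \<le> c1 * n ^ c1" "c2 * tsize (enc s) ^ c2 \<le> c2 * n ^ c2"
      using s(2) by (auto intro!: mult_le_mono2 power_mono)
    obtain y q z where so: "s = (y, q, z)" by (cases s)
    have sz: "tsize (enc (ans q)) \<le> tsize (enc q) + TA q"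
      using computes_size[OF A, of q] s(1) by (simp add: so)
    have zn: "tsize (enc (ans (fst (snd s)))) \<le> n + a" using sz s(2,3) by (simp add: so)
    have on: "tsize (enc (snd (snd s))) \<le> n" using s(2) by (simp add: so)
    have "tsize (enc (snd (snd s))) \<le> 3" by (cases "snd (snd s)") simp_all
    then have "tsize (enc (snd (snd s), ans (fst (snd s)))) \<le> 4 + n + a"
      using zn by simp
    then have "c3 * tsize (enc (snd (snd s), ans (fst (snd s)))) ^ c3 \<le> c3 * (4 + n + a) ^ c3"
      by (intro mult_le_mono2 power_mono) simp_all
    then have t3: "T3 (snd (snd s), ans (fst (snd s))) \<le> c3 * (4 + n + a) ^ c3"
      using c(3) order_trans by blast
    show ?thesis unfolding TS_def bound_def
      by (intro add_le_mono mult_le_mono2 le_refl s(2,3) zn on t3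
          order_trans[OF c(1)[OF s(1)] p1(1)] order_trans[OF c(2)[OF s(1)] p1(2)])
  qed

  have szR: "fbounded (\<lambda>y. tsize (enc (R y)))"
    by (rule fbounded_mono[OF fbounded_add[OF fbounded_size R(2)]]) (rule computes_size[OF R(1)], simp)
  obtain TI where TI: "computes (\<lambda>_. True) (instances d) TI" "pbounded (\<lambda>_. True) TI"
    using ptime_instances[of d] unfolding ptime_on_def by blast
  let ?I = "\<lambda>y. instances d (R y)"
  have I: "computes (\<lambda>_. True) ?I (\<lambda>y. 1 + TR y + TI (R y))"
    by (rule computes_comp[OF R(1) TI(1)]) simp
  have fI: "fbounded (\<lambda>y. 1 + TR y + TI (R y))"
    by (intro fbounded_intros R(2) fbounded_pbounded_comp[OF TI(2)] szR)
  have szI: "fbounded (\<lambda>y. tsize (enc (?I y)))"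
    by (rule fbounded_mono[OF fbounded_add[OF fbounded_size fI]]) (rule computes_size[OF I], simp)
  obtain T0 where T0: "computes (\<lambda>_. True) (\<lambda>y :: tree \<times> nat. False) T0" "pbounded (\<lambda>_. True) T0"
    using ptime_const[of "\<lambda>_. True" False] unfolding ptime_on_def by blast
  have f0: "fbounded T0" by (rule fbounded_pbounded_comp[OF T0(2) fbounded_size])

  \<comment> \<open>Instances have parameter at most \<open>2 * Suc (g k) ^ (2 ^ d) + 1\<close>, the
    last \<open>1\<close> being the degree. As \<open>g\<close> only bounds the parameter that
    \<open>R\<close> produces, \<open>f\<close> is summed up to there.\<close>
  define F where "F = (\<lambda>k. \<Sum>i \<le> 2 * Suc (g k) ^ (2 ^ d) + 1. f i)"
  have "ptime (\<lambda>n. 2 * Suc n ^ (2 ^ d) + 1)" by (intro pt)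
  then have "computable (\<lambda>k. 2 * Suc (g k) ^ (2 ^ d) + 1)"
    by (intro computable_comp[OF _ g] computable_of_ptime)
  then have F: "computable F" unfolding F_def by (rule computable_comp[OF computable_sum[OF f]])
  \<comment> \<open>The constant \<open>5\<close> accounts for two pair nodes and a Boolean of size
    at most \<open>3\<close> in the argument of a step; the current instance is no larger than the
    whole list.\<close>
  let ?n = "\<lambda>y. 5 + tsize (enc y) + tsize (enc (?I y))"
  let ?a = "\<lambda>y. F (snd y) * tsize (enc (?I y)) ^ c + b"
  let ?B = "\<lambda>y. bound (?n y) (?a y)"
  have fB: "fbounded ?B"
    unfolding bound_def by (intro fbounded_intros szI fbounded_param F)
  have valid: "valid q" and TA: "TA q \<le> ?a y" if q: "q \<in> set (?I y)" for q y
  proof -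
    have i: "fst q = 2 * Suc (snd (R y)) ^ (2 ^ d)" "fst (snd q) = 1" "valid q"
      using instances_valid[of q d "fst (R y)" "snd (R y)"] q unfolding valid_def prod.collapse by blast+
    show "valid q" by fact
    have "2 * Suc (snd (R y)) ^ (2 ^ d) \<le> 2 * Suc (g (snd y)) ^ (2 ^ d)"
      using Rg[of y] by (intro mult_le_mono2 power_mono) simp_all
    then have "fst q + fst (snd q) \<le> 2 * Suc (g (snd y)) ^ (2 ^ d) + 1" using i by linarith
    then have "f (fst q + fst (snd q)) \<le> F (snd y)"
      unfolding F_def by (intro member_le_sum) simp_all
    moreover have "tsize (enc q) ^ c \<le> tsize (enc (?I y)) ^ c"
      using tsize_le_list[OF q] by (intro power_mono) simp_all
    ultimately show "TA q \<le> ?a y" unfolding TA_def by (intro add_le_mono1 mult_le_mono)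
  qed
  have o3: "tsize (enc z) \<le> 3" for z :: bool by (cases z) simp_all
  have "\<exists>C. computes (\<lambda>_. True) (\<lambda>y. foldl (\<lambda>acc q. ?S (y, q, acc)) False (?I y))
    (\<lambda>y. C * ((1 + TR y + TI (R y)) + T0 y + tsize (enc (?I y)) * (tsize (enc (?I y)) + tsize (enc y) + 3 + ?B y + 1)))"
  proof (rule computes_foldl[OF S I T0(1)])
    fix y n assume n: "n < length (?I y)"
    let ?q = "?I y ! n" and ?acc = "foldl (\<lambda>acc q. ?S (y, q, acc)) False (take n (?I y))"
    have q: "?q \<in> set (?I y)" using n by (rule nth_mem)
    show "?D (y, ?q, ?acc)" using valid[OF q] by simp
    then show "TS (y, ?q, ?acc) \<le> ?B y"
    proof (rule TS)
      show "tsize (enc (y, ?q, ?acc)) \<le> ?n y"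
        using tsize_le_list[OF q] o3[of ?acc] by simp
      show "TA (fst (snd (y, ?q, ?acc))) \<le> ?a y" using TA[OF q] by simp
    qed
  qed (rule o3)
  then obtain C where C: "computes (\<lambda>_. True) (\<lambda>y. foldl (\<lambda>acc q. ?S (y, q, acc)) False (?I y))
    (\<lambda>y. C * ((1 + TR y + TI (R y)) + T0 y + tsize (enc (?I y)) * (tsize (enc (?I y)) + tsize (enc y) + 3 + ?B y + 1)))"
    by blast
  have "foldl (\<lambda>acc q. ?S (y, q, acc)) z l \<longleftrightarrow> z \<or> (\<exists>q \<in> set l. ans q \<noteq> Atom)" for y z l
    by (induction l arbitrary: z) (simp_all add: disj_assoc)
  then have "foldl (\<lambda>acc q. ?S (y, q, acc)) False (?I y) \<longleftrightarrow> (\<exists>q \<in> set (?I y). ans q \<noteq> Atom)" for y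
    by (simp only: simp_thms)
  also have "(\<exists>q \<in> set (?I y). ans q \<noteq> Atom) \<longleftrightarrow> (\<exists>q \<in> set (?I y). solvable q)" for y
    by (rule bex_cong[OF refl], rule ans(2), rule valid)
  also have "(\<exists>q \<in> set (?I y). solvable q) \<longleftrightarrow> y \<in> L" for y
    using instances_correct[of d "fst (R y)" "snd (R y)"] RL[of y] by simp
  finally have "foldl (\<lambda>acc q. ?S (y, q, acc)) False (?I y) \<longleftrightarrow> y \<in> L" for y .
  then have "computes (\<lambda>_. True) (\<lambda>y. y \<in> L)
    (\<lambda>y. C * ((1 + TR y + TI (R y)) + T0 y + tsize (enc (?I y)) * (tsize (enc (?I y)) + tsize (enc y) + 3 + ?B y + 1)))"
    by (intro computes_mono[OF C]) simp_all
  moreover have "fbounded (\<lambda>y. C * ((1 + TR y + TI (R y)) + T0 y + tsize (enc (?I y)) * (tsize (enc (?I y)) + tsize (enc y) + 3 + ?B y + 1)))"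
    by (intro fbounded_mult[of "\<lambda>_. C"] fbounded_add fbounded_mult[OF szI] fbounded_const fbounded_size szI fB f0 R(2) fbounded_pbounded_comp[OF TI(2)] szR)
  ultimately show "L \<in> FPT" unfolding FPT_iff by blast
qed

theorem theorem11:
  assumes "FPT \<noteq> W_class 2"
  shows "\<not> (\<exists>p. fpt_algorithm_ConsCheck_IS_degree p)"
  using assms FPT_subset_W2 W2_subset_FPT by blast

end
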